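(* Let $(\mathcal M,d)$ be an $n$-dimensional straight projective-metric space. The set of the centers of $(\mathcal M,d)$ contains an $n$-dimensional pencil of points $P_i,Q_i$ ($i=1,\dots,k$, $k\ge n$) and tip $O$ such that $d(O,P_i)/d(O,Q_i)$ is irrational for every $i$ if and only if $(\mathcal M,d)$ is either a Minkowski geometry or the hyperbolic geometry.
   Context: A straight projective-metric space of dimension $n\in\mathbb N$ is a metric space $(\mathcal M,d)$, where $\mathcal M$ is either $\mathbb R^n$ or a proper open convex subset of $\mathbb R^n$, such that $d$ is complete, continuous with respect to the standard topology, the geodesic lines of $d$ are exactly the non-empty intersections of $\mathcal M$ with the straight lines, and the geodesic lines of $d$ are isometric with a Euclidean straight line. A metric point reflection at $O\in\mathcal M$ is a non-identical involutive $d$-isometry of $\mathcal M$ onto $\mathcal M$ that fixes $O$ and maps every geodesic line passing through $O$ onto itself. A point $O\in\mathcal M$ is a center of $(\mathcal M,d)$ if there exists a metric point reflection at $O$. Different points $O$ and $P_i,Q_i$ ($i=1,\dots,k$) form a pencil with tip $O$ if the points $O,P_i,Q_i$ are collinear for every $i$. The pencil is $l$-dimensional if the linear space generated by the vectors $\overrightarrow{OP_i}$ is $l$-dimensional. That the set of centers contains the pencil means that $O$ and all the points $P_i,Q_i$ are centers. A Minkowski (Minkowskian) geometry is a space $(\mathbb R^n,d_{\mathcal I})$, where $\mathcal I\subset\mathbb R^n$ is an open, strictly convex, bounded domain that is centrally symmetric with respect to the origin, and $d_{\mathcal I}(x,y)=\inf\{\lambda>0:(y-x)/\lambda\in\mathcal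 I\}$. For collinear points, the affine ratio $(A,B;C)$ is defined by $(A,B;C)\overrightarrow{BC}=\overrightarrow{AC}$, and the affine cross ratio is $(A,B;C,D)=(A,B;C)/(A,B;D)$. The hyperbolic geometry is the Hilbert geometry $(\mathcal E,d_{\mathcal E})$ given in an open (solid) ellipsoid $\mathcal E\subset\mathbb R^n$, where the Hilbert metric is $d_{\mathcal E}(A,B)=0$ if $A=B$, and $d_{\mathcal E}(A,B)=\frac12|\ln(A,B;C,D)|$ if $A\ne B$, with $C,D$ the endpoints of the open segment in which the line $AB$ meets $\mathcal E$.
   Formalization: "Is a Minkowski geometry" is taken up to isometry, and "is the hyperbolic geometry" up to isometry and a positive constant factor of the metric; literally the claim fails, e.g. for twice the Hilbert metric of an ellipsoid. *)

theory Defs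
  imports "HOL-Analysis.Analysis"
begin

definition isometry_between ::
    "'a set \<Rightarrow> ('a \<Rightarrow> 'a \<Rightarrow> real) \<Rightarrow> 'b set \<Rightarrow> ('b \<Rightarrow> 'b \<Rightarrow> real) \<Rightarrow> ('a \<Rightarrow> 'b) \<Rightarrow> bool" where
  "isometry_between M d N e f \<longleftrightarrow>
     bij_betw f M N \<and> (\<forall>x\<in>M. \<forall>y\<in>M. e (f x) (f y) = d x y)"

definition isometric_spaces ::
    "'a set \<Rightarrow> ('a \<Rightarrow> 'a \<Rightarrow> real) \<Rightarrow> 'b set \<Rightarrow> ('b \<Rightarrow> 'b \<Rightarrow> real) \<Rightarrow> bool" where
  "isometric_spaces M d N e \<longleftrightarrow> (\<exists>f. isometry_between M d N e f)"

text \<open>Geodesic lines in the sense of Busemann: images of the real line under locally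
  isometric maps. That they are globally isometric to the real line is a separate axiom
  of straight spaces below.\<close>

definition geodesic_line :: "'a set \<Rightarrow> ('a \<Rightarrow> 'a \<Rightarrow> real) \<Rightarrow> 'a set \<Rightarrow> bool" where
  "geodesic_line M d L \<longleftrightarrow>
     (\<exists>\<gamma>::real \<Rightarrow> 'a. range \<gamma> = L \<and> L \<subseteq> M \<and>
        (\<forall>t. \<exists>\<epsilon>>0. \<forall>r\<in>ball t \<epsilon>. \<forall>s\<in>ball t \<epsilon>. d (\<gamma> r) (\<gamma> s) = \<bar>r - s\<bar>))"

definition straight_line :: "'a::euclidean_space set \<Rightarrow> bool" where
  "straight_line l \<longleftrightarrow> affine l \<and> aff_dim l = 1"

text \<open>The locale \<^locale>\<open>Metric_space\<close> asks for symmetry and nonnegativity of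
  \<open>d\<close> also outside \<open>M\<close>. This only concerns irrelevant values: everything below
  depends on \<open>d\<close> restricted to \<open>M \<times> M\<close>.\<close>

locale straight_projective_metric_space = Metric_space M d
  for M :: "(real ^ 'n) set" and d :: "real ^ 'n \<Rightarrow> real ^ 'n \<Rightarrow> real" +
  assumes carrier: "M = UNIV \<or> (M \<subset> UNIV \<and> open M \<and> convex M)"
    and complete: "mcomplete"
    and continuous: "continuous_on (M \<times> M) (\<lambda>(x, y). d x y)"
    and geodesic_lines: "{L. geodesic_line M d L} = {l \<inter> M | l. straight_line l \<and> l \<inter> M \<noteq> {}}"
    and straight: "\<And>L. geodesic_line M d L \<Longrightarrow> isometric_spaces L d (UNIV :: real set) dist"

definition metric_point_reflection ::
    "'a set \<Rightarrow> ('a \<Rightarrow> 'a \<Rightarrow> real) \<Rightarrow> 'a \<Rightarrow> ('a \<Rightarrow> 'a) \<Rightarrow> bool" where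
  "metric_point_reflection M d p \<sigma> \<longleftrightarrow>
     isometry_between M d M d \<sigma> \<and>
     (\<forall>x\<in>M. \<sigma> (\<sigma> x) = x) \<and>
     (\<exists>x\<in>M. \<sigma> x \<noteq> x) \<and>
     \<sigma> p = p \<and>
     (\<forall>L. geodesic_line M d L \<and> p \<in> L \<longrightarrow> \<sigma> ` L = L)"

definition center :: "'a set \<Rightarrow> ('a \<Rightarrow> 'a \<Rightarrow> real) \<Rightarrow> 'a \<Rightarrow> bool" where
  "center M d p \<longleftrightarrow> p \<in> M \<and> (\<exists>\<sigma>. metric_point_reflection M d p \<sigma>)"

definition pencil :: "nat \<Rightarrow> 'a::euclidean_space \<Rightarrow> (nat \<Rightarrow> 'a) \<Rightarrow> (nat \<Rightarrow> 'a) \<Rightarrow> bool" where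
  "pencil k p P Q \<longleftrightarrow>
     inj_on P {1..k} \<and> inj_on Q {1..k} \<and> P ` {1..k} \<inter> Q ` {1..k} = {} \<and>
     p \<notin> P ` {1..k} \<and> p \<notin> Q ` {1..k} \<and>
     (\<forall>i\<in>{1..k}. collinear {p, P i, Q i})"

definition pencil_dim :: "nat \<Rightarrow> 'a::euclidean_space \<Rightarrow> (nat \<Rightarrow> 'a) \<Rightarrow> nat" where
  "pencil_dim k p P = dim (span ((\<lambda>i. P i - p) ` {1..k}))"

text \<open>Strict convexity of the open set \<open>I\<close>: no segment on its boundary.\<close>

definition indicatrix :: "'a::euclidean_space set \<Rightarrow> bool" where
  "indicatrix I \<longleftrightarrow>
     open I \<and> I \<noteq> {} \<and> bounded I \<and> uminus ` I = I \<and>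
     (\<forall>x\<in>closure I. \<forall>y\<in>closure I. x \<noteq> y \<longrightarrow> open_segment x y \<subseteq> I)"

definition minkowski_dist :: "'a::euclidean_space set \<Rightarrow> 'a \<Rightarrow> 'a \<Rightarrow> real" where
  "minkowski_dist I x y = Inf {r. r > 0 \<and> (y - x) /\<^sub>R r \<in> I}"

text \<open>Meaningful for collinear points with \<open>B \<noteq> C\<close>.\<close>

definition affine_ratio :: "'a::euclidean_space \<Rightarrow> 'a \<Rightarrow> 'a \<Rightarrow> real" where
  "affine_ratio A B C = (THE r. r *\<^sub>R (C - B) = C - A)"

definition affine_cross_ratio :: "'a::euclidean_space \<Rightarrow> 'a \<Rightarrow> 'a \<Rightarrow> 'a \<Rightarrow> real" where
  "affine_cross_ratio A B C D = affine_ratio A B C / affine_ratio A B D"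

text \<open>The endpoints \<open>C\<close>, \<open>D\<close> are unique up to order, and swapping them inverts the cross
  ratio, so that the value \<open>r\<close> is unique.\<close>

definition hilbert_dist :: "'a::euclidean_space set \<Rightarrow> 'a \<Rightarrow> 'a \<Rightarrow> real" where
  "hilbert_dist E A B =
     (if A = B then 0
      else THE r. \<exists>C D. affine hull {A, B} \<inter> E = open_segment C D \<and>
                        r = 1/2 * \<bar>ln (affine_cross_ratio A B C D)\<bar>)"

definition open_ellipsoid :: "'a::euclidean_space set \<Rightarrow> bool" where
  "open_ellipsoid E \<longleftrightarrow> (\<exists>f a. linear f \<and> bij f \<and> E = (\<lambda>x. a + f x) ` ball (0::'a) 1)"

text \<open>Being a Minkowski geometry or the hyperbolic geometry is understood as a property of
  metric spaces, that is up to isometry, and for the hyperbolic geometry also up to the unit of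
  length \<open>c\<close> (curvature \<open>-1/c\<^sup>2\<close>). This is necessary: the double of the Hilbert metric of
  an ellipsoid, the Hilbert metric of the interior of a paraboloid (a projective image of an
  ellipsoid), and \<open>\<bar>g x - g y\<bar>\<close> on the line with a non-affine homeomorphism \<open>g\<close> of the line
  are all straight projective metrics for which every point is a center. Minkowski geometries
  are closed under rescaling.\<close>

definition minkowski_geometry ::
    "'a::euclidean_space set \<Rightarrow> ('a \<Rightarrow> 'a \<Rightarrow> real) \<Rightarrow> bool" where
  "minkowski_geometry M d \<longleftrightarrow>
     (\<exists>I::'a set. indicatrix I \<and> isometric_spaces M d UNIV (minkowski_dist I))"

definition hyperbolic_geometry ::
    "'a::euclidean_space set \<Rightarrow> ('a \<Rightarrow> 'a \<Rightarrow> real) \<Rightarrow> bool" where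
  "hyperbolic_geometry M d \<longleftrightarrow>
     (\<exists>(E::'a set) c. open_ellipsoid E \<and> c > 0 \<and>
        isometric_spaces M d E (\<lambda>x y. c * hilbert_dist E x y))"

end

theory Submission
  imports Defs
begin

text \<open>The centers are closed under reflection in one another and under limits, so two centers at
  incommensurable distances from a third one on the same line force all points of that line to be centers.
  Composing two reflections gives a translation along a line; translating a flat of centers along a line
  of centers transverse to it sweeps out the flat they span, hence every point of \<open>M\<close> is a center.

  If every point is a center and the dimension is at least two, then the reflection in \<open>p\<close> keeps the lines
  through \<open>p\<close> and maps lines to lines, which makes it projective. In homogeneous coordinates the reflections
  generate a group of linear maps of determinant \<open>\<plusminus>1\<close>, and since the stabilizer of a point has bounded
  orbits, the orbit of a vector meets each ray over \<open>M\<close> once. On this orbit the polarity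
  \<open>p \<mapsto> cov p\<close> given by the axes of the reflections is symmetric, because the reflection in the midpoint
  exchanges two vectors. It is therefore induced by an invariant bilinear form with one positive square,
  which is negative semidefinite on the complement of a positive vector. If it vanishes there, \<open>M\<close> is the
  whole space and the reflections are affine: a Minkowski geometry. If it is definite there, the orbit is a
  hyperboloid, and \<open>d\<close> is a multiple of the hyperbolic distance, the factor being the same for all
  lines as asymptotic lines stay close to each other. In between, the stabilizer of a
  point would contain an unbounded shear.\<close>

section \<open>Lines and point reflections\<close>

text \<open>A center is defined by the existence of some reflection. It is replaced by a concrete
  map \<open>reflect p\<close>, given by distances along lines, and being a center becomes the
  statement that this map is an isometry. Sweeping out flats has one obstacle: a translate of a
  point along a line of centers need not visibly reach a given flat. What forces it to is
  \<open>d_midpoints_le\<close>: if the midpoints of two sides of a triangle are centers, they are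
  at most half of the third side apart. In dimension one a reflection need not be projective, so
  that case is split off; there the only line is isometric to the reals, which form a Minkowski
  geometry. In the converse the space is merely isometric to a model, and the isometry is not known
  to respect straight lines; geodesic lines, being an isometry invariant, carry the reflections
  over.\<close>

lemma straight_line_affine_hull:
  fixes x y :: "'a::euclidean_space"
  assumes "x \<noteq> y"
  shows "straight_line (affine hull {x, y})"
  using assms by (simp add: straight_line_def aff_dim_2)

lemma straight_line_eq_affine_hull:
  fixes x y :: "'a::euclidean_space"
  assumes "straight_line l" "x \<in> l" "y \<in> l" "x \<noteq> y"
  shows "l = affine hull {x, y}"
proof -
  have "affine hull {x, y} \<subseteq> l"
    using assms by (intro hull_minimal) (auto simp: straight_line_def)
  from aff_dim_eq_full_gen[OF this] show ?thesis
    using assms by (simp add: straight_line_def aff_dim_2 hull_same)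
qed

lemma affine_hull_pair_param:
  fixes x v :: "'a::real_vector"
  shows "affine hull {x, x + v} = range (\<lambda>t. x + t *\<^sub>R v)"
proof -
  have "(\<exists>u w. z = u *\<^sub>R x + w *\<^sub>R (x + v) \<and> u + w = 1) \<longleftrightarrow> (\<exists>t. z = x + t *\<^sub>R v)" for z
  proof
    assume "\<exists>u w. z = u *\<^sub>R x + w *\<^sub>R (x + v) \<and> u + w = 1"
    then obtain u w where uw: "z = u *\<^sub>R x + w *\<^sub>R (x + v)" "u + w = 1" by blast
    then have "u = 1 - w" by simp
    with uw have "z = x + w *\<^sub>R v" by (simp add: algebra_simps)
    then show "\<exists>t. z = x + t *\<^sub>R v" by blast
  next
    assume "\<exists>t. z = x + t *\<^sub>R v"
    then obtain t where "z = x + t *\<^sub>R v" by blast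
    then have "z = (1 - t) *\<^sub>R x + t *\<^sub>R (x + v)" by (simp add: algebra_simps)
    then show "\<exists>u w. z = u *\<^sub>R x + w *\<^sub>R (x + v) \<and> u + w = 1"
      by (metis diff_add_cancel)
  qed
  then show ?thesis by (auto simp: affine_hull_2)
qed

lemma affine_hull_pair_param': "affine hull {x, y} = range (\<lambda>t. x + t *\<^sub>R (y - x))"
  using affine_hull_pair_param[of x "y - x"] by simp

lemma in_closed_segment_beyond:
  fixes p x :: "'a::real_vector"
  assumes "0 \<le> t"
  shows "p \<in> closed_segment x (p + t *\<^sub>R (p - x))"
proof -
  define w where "w = 1 / (1 + t)"
  have w: "0 \<le> w" "w \<le> 1" "t * w = 1 - w"
    using assms by (auto simp: w_def field_simps)
  have "(1 - w) *\<^sub>R x + w *\<^sub>R (p + t *\<^sub>R (p - x)) = (1 - w - t * w) *\<^sub>R x + (w + t * w) *\<^sub>R p"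
    by (simp add: algebra_simps)
  then have "p = (1 - w) *\<^sub>R x + w *\<^sub>R (p + t *\<^sub>R (p - x))" using w by simp
  with w show ?thesis unfolding in_segment by blast
qed

lemma closed_segment_beyondE:
  fixes p x y :: "'a::real_vector"
  assumes "p \<in> closed_segment x y" "p \<noteq> x"
  obtains t where "0 \<le> t" "y = p + t *\<^sub>R (p - x)"
proof -
  obtain u where u: "0 \<le> u" "u \<le> 1" "p = (1 - u) *\<^sub>R x + u *\<^sub>R y"
    using assms(1) unfolding in_segment by blast
  with assms(2) have u0: "u > 0" by (cases "u = 0") auto
  have "u *\<^sub>R (y - p) = ((1 - u) *\<^sub>R x + u *\<^sub>R y) - (1 - u) *\<^sub>R x - u *\<^sub>R p" by (simp add: algebra_simps)
  also have "\<dots> = (1 - u) *\<^sub>R (p - x)" unfolding u(3)[symmetric] by (simp add: algebra_simps)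
  finally have "(1/u) *\<^sub>R u *\<^sub>R (y - p) = (1/u) *\<^sub>R (1 - u) *\<^sub>R (p - x)" by simp
  moreover have "(1/u) *\<^sub>R u *\<^sub>R (y - p) = y - p" using u0 by simp
  ultimately have "y - p = ((1/u) * (1 - u)) *\<^sub>R (p - x)" by simp
  then have "y = p + ((1/u) * (1 - u)) *\<^sub>R (p - x)" by (simp add: diff_eq_eq add.commute)
  moreover have "0 \<le> (1/u) * (1 - u)" using u u0 by simp
  ultimately show thesis using that by blast
qed

lemma open_small_multiple:
  fixes p v :: "'a::real_normed_vector"
  assumes "open S" "p \<in> S"
  shows "\<exists>e>0. \<forall>s. \<bar>s\<bar> \<le> e \<longrightarrow> p + s *\<^sub>R v \<in> S"
proof -
  obtain r where r: "r > 0" "ball p r \<subseteq> S" using assms open_contains_ball by blast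
  define e where "e = r / (norm v + 1)"
  have n: "norm v + 1 > 0" by (smt (verit) norm_ge_zero)
  show ?thesis
  proof (intro exI[of _ e] conjI allI impI)
    show "e > 0" using r n by (simp add: e_def)
    fix s assume "\<bar>s\<bar> \<le> e"
    then have "\<bar>s\<bar> * norm v \<le> e * norm v" by (intro mult_right_mono) auto
    also have "\<dots> < e * (norm v + 1)" using \<open>e > 0\<close> by (intro mult_strict_left_mono) auto
    also have "\<dots> = r" using n by (simp add: e_def)
    finally have "p + s *\<^sub>R v \<in> ball p r" by (simp add: dist_norm)
    then show "p + s *\<^sub>R v \<in> S" using r by blast
  qed
qed

context straight_projective_metric_space
begin

lemma open_carrier: "open M"
  using carrier by auto

lemma convex_carrier: "convex M"
  using carrier by auto

lemma geodesic_line_iff: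
  "geodesic_line M d L \<longleftrightarrow> (\<exists>l. straight_line l \<and> l \<inter> M \<noteq> {} \<and> L = l \<inter> M)"
  using geodesic_lines by blast

definition chord :: "real ^ 'n \<Rightarrow> real ^ 'n \<Rightarrow> (real ^ 'n) set" where
  "chord x y = affine hull {x, y} \<inter> M"

lemma geodesic_line_chord: "x \<in> M \<Longrightarrow> x \<noteq> y \<Longrightarrow> geodesic_line M d (chord x y)"
  unfolding geodesic_line_iff chord_def
  by (metis IntI straight_line_affine_hull empty_iff hull_inc insertI1)

lemma geodesic_line_eq_chord:
  "geodesic_line M d L \<Longrightarrow> x \<in> L \<Longrightarrow> y \<in> L \<Longrightarrow> x \<noteq> y \<Longrightarrow> L = chord x y"
  unfolding geodesic_line_iff chord_def using straight_line_eq_affine_hull by blast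

lemma chord_self [simp]:
  "x \<in> M \<Longrightarrow> x \<in> chord x y" "y \<in> M \<Longrightarrow> y \<in> chord x y"
  by (auto simp: chord_def hull_inc)

lemma continuous_on_d:
  assumes "continuous_on S f" "continuous_on S g" "f ` S \<subseteq> M" "g ` S \<subseteq> M"
  shows "continuous_on S (\<lambda>t. d (f t) (g t))"
proof -
  have "(\<lambda>t. (f t, g t)) ` S \<subseteq> M \<times> M" using assms(3,4) by auto
  from continuous_on_compose2[OF continuous continuous_on_Pair[OF assms(1,2)] this]
  show ?thesis by simp
qed

lemma tendsto_d:
  assumes "(f \<longlongrightarrow> x) F" "(g \<longlongrightarrow> y) F" "x \<in> M" "y \<in> M"
  shows "((\<lambda>t. d (f t) (g t)) \<longlongrightarrow> d x y) F"
proof -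
  have "isCont (\<lambda>(x, y). d x y) (x, y)"
    using continuous_on_eq_continuous_at[OF open_Times[OF open_carrier open_carrier]] continuous assms(3,4)
    by blast
  from isCont_tendsto_compose[OF this tendsto_Pair[OF assms(1,2)]]
  show ?thesis by simp
qed

definition line_dom :: "real ^ 'n \<Rightarrow> real ^ 'n \<Rightarrow> real set" where
  "line_dom x v = {t. x + t *\<^sub>R v \<in> M}"

lemma line_dom_vimage: "line_dom x v = (\<lambda>t. x + t *\<^sub>R v) -` M"
  by (auto simp: line_dom_def)

lemma open_line_dom: "open (line_dom x v)"
  unfolding line_dom_vimage
  by (intro continuous_open_vimage open_carrier continuous_intros)

lemma convex_line_dom: "convex (line_dom x v)"
proof (rule convexI)
  fix s t u w :: real
  assume *: "s \<in> line_dom x v" "t \<in> line_dom x v" "0 \<le> u" "0 \<le> w" "u + w = 1"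
  have "u *\<^sub>R (x + s *\<^sub>R v) + w *\<^sub>R (x + t *\<^sub>R v) \<in> M"
    using * by (intro convexD[OF convex_carrier]) (auto simp: line_dom_def)
  also have "u *\<^sub>R (x + s *\<^sub>R v) + w *\<^sub>R (x + t *\<^sub>R v) = (u + w) *\<^sub>R x + (u * s + w * t) *\<^sub>R v"
    by (simp add: algebra_simps)
  finally show "u *\<^sub>R s + w *\<^sub>R t \<in> line_dom x v"
    using * by (simp add: line_dom_def)
qed

text \<open>Signed arc length from \<open>x\<close> in direction \<open>v\<close> as a function of
  the affine parameter. Being increasing, it identifies the metric order on the line with the affine
  one; metric reflections act on it by \<open>2 * r - s\<close> (see
  \<open>chart_reflect\<close>).\<close>

definition line_chart :: "real ^ 'n \<Rightarrow> real ^ 'n \<Rightarrow> (real \<Rightarrow> real) \<Rightarrow> bool" where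
  "line_chart x v \<phi> \<longleftrightarrow> \<phi> 0 = 0 \<and> strict_mono_on (line_dom x v) \<phi> \<and>
     \<phi> ` line_dom x v = UNIV \<and> continuous_on (line_dom x v) \<phi> \<and>
     (\<forall>s\<in>line_dom x v. \<forall>t\<in>line_dom x v. d (x + s *\<^sub>R v) (x + t *\<^sub>R v) = \<bar>\<phi> s - \<phi> t\<bar>)"

lemma line_chartD:
  assumes "line_chart x v \<phi>"
  shows "\<phi> 0 = 0" "strict_mono_on (line_dom x v) \<phi>" "\<phi> ` line_dom x v = UNIV"
    "continuous_on (line_dom x v) \<phi>"
    "\<And>s t. s \<in> line_dom x v \<Longrightarrow> t \<in> line_dom x v \<Longrightarrow> d (x + s *\<^sub>R v) (x + t *\<^sub>R v) = \<bar>\<phi> s - \<phi> t\<bar>"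
proof -
  note * = assms[unfolded line_chart_def]
  from * show "\<phi> 0 = 0" "strict_mono_on (line_dom x v) \<phi>" "\<phi> ` line_dom x v = UNIV"
    "continuous_on (line_dom x v) \<phi>" by - (elim conjE, assumption)+
  from * have "\<forall>s\<in>line_dom x v. \<forall>t\<in>line_dom x v. d (x + s *\<^sub>R v) (x + t *\<^sub>R v) = \<bar>\<phi> s - \<phi> t\<bar>"
    by (elim conjE)
  then show "d (x + s *\<^sub>R v) (x + t *\<^sub>R v) = \<bar>\<phi> s - \<phi> t\<bar>"
    if "s \<in> line_dom x v" "t \<in> line_dom x v" for s t
    using that by (rule_tac bspec, rule_tac bspec)
qed

text \<open>The isometry of the line with the reals, read in the affine parameter, is injective and,
  as \<open>d\<close> is continuous, continuous on an interval, hence monotone. Subtracting its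
  value at 0, with a change of sign if it decreases, gives the chart.\<close>

lemma line_chart_exists:
  assumes "x \<in> M" "v \<noteq> 0"
  shows "\<exists>\<phi>. line_chart x v \<phi>"
proof -
  let ?I = "line_dom x v" and ?L = "chord x (x + v)"
  have L: "?L = (\<lambda>t. x + t *\<^sub>R v) ` ?I"
    by (auto simp: chord_def affine_hull_pair_param line_dom_def)
  have "geodesic_line M d ?L"
    using assms by (intro geodesic_line_chord) auto
  then obtain h where h: "bij_betw h ?L UNIV" "\<And>a b. a \<in> ?L \<Longrightarrow> b \<in> ?L \<Longrightarrow> dist (h a) (h b :: real) = d a b"
    using straight unfolding isometric_spaces_def isometry_between_def by blast
  define \<psi> where "\<psi> = (\<lambda>t. h (x + t *\<^sub>R v))"
  have \<psi>d: "\<bar>\<psi> s - \<psi> t\<bar> = d (x + s *\<^sub>R v) (x + t *\<^sub>R v)" if "s \<in> ?I" "t \<in> ?I" for s t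
    using h(2) that unfolding L \<psi>_def dist_real_def by blast
  have \<psi>im: "\<psi> ` ?I = UNIV"
    using h(1) unfolding bij_betw_def L \<psi>_def by (simp add: image_image)
  have \<psi>inj: "inj_on \<psi> ?I"
  proof (rule inj_onI)
    fix s t assume *: "s \<in> ?I" "t \<in> ?I" "\<psi> s = \<psi> t"
    then have "d (x + s *\<^sub>R v) (x + t *\<^sub>R v) = 0" using \<psi>d by fastforce
    then show "s = t" using * assms by (auto simp: line_dom_def)
  qed
  have \<psi>cont: "continuous_on ?I \<psi>"
    unfolding continuous_on_def
  proof
    fix s assume s: "s \<in> ?I"
    have "((\<lambda>t. d (x + t *\<^sub>R v) (x + s *\<^sub>R v)) \<longlongrightarrow> d (x + s *\<^sub>R v) (x + s *\<^sub>R v)) (at s within ?I)"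
      using s by (intro tendsto_d tendsto_intros) (auto simp: line_dom_def)
    then have "((\<lambda>t. d (x + t *\<^sub>R v) (x + s *\<^sub>R v)) \<longlongrightarrow> 0) (at s within ?I)"
      using s by (simp add: line_dom_def)
    then have "((\<lambda>t. \<bar>\<psi> t - \<psi> s\<bar>) \<longlongrightarrow> 0) (at s within ?I)"
      by (rule Lim_transform_eventually) (use s in \<open>auto simp: \<psi>d eventually_at_filter\<close>)
    then show "(\<psi> \<longlongrightarrow> \<psi> s) (at s within ?I)"
      by (simp add: tendsto_rabs_zero_iff LIM_zero_iff)
  qed
  have zero: "0 \<in> ?I" using assms by (simp add: line_dom_def)
  have "is_interval ?I" using convex_line_dom by (simp add: is_interval_convex_1)
  then consider "strict_mono_on ?I \<psi>" | "strict_antimono_on ?I \<psi>"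
    using injective_eq_monotone_map \<psi>cont \<psi>inj by blast
  then show ?thesis
  proof cases
    case 1
    have "z \<in> (\<lambda>t. \<psi> t - \<psi> 0) ` ?I" for z
    proof -
      obtain t where "t \<in> ?I" "\<psi> t = \<psi> 0 + z" using \<psi>im by (metis UNIV_I imageE)
      then show ?thesis by force
    qed
    then have "(\<lambda>t. \<psi> t - \<psi> 0) ` ?I = UNIV" by blast
    then have "line_chart x v (\<lambda>t. \<psi> t - \<psi> 0)"
      unfolding line_chart_def using 1 \<psi>d
      by (auto intro!: continuous_intros \<psi>cont simp: monotone_on_def)
    then show ?thesis by blast
  next
    case 2
    have "z \<in> (\<lambda>t. \<psi> 0 - \<psi> t) ` ?I" for z
    proof -
      obtain t where "t \<in> ?I" "\<psi> t = \<psi> 0 - z" using \<psi>im by (metis UNIV_I imageE)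
      then show ?thesis by force
    qed
    then have "(\<lambda>t. \<psi> 0 - \<psi> t) ` ?I = UNIV" by blast
    then have "line_chart x v (\<lambda>t. \<psi> 0 - \<psi> t)"
      unfolding line_chart_def using 2 \<psi>d[symmetric]
      by (auto intro!: continuous_intros \<psi>cont simp: monotone_on_def abs_minus_commute)
    then show ?thesis by blast
  qed
qed

lemma segment_subset: "x \<in> M \<Longrightarrow> y \<in> M \<Longrightarrow> closed_segment x y \<subseteq> M"
  using convex_carrier convex_contains_segment by blast

lemma between_add:
  assumes "x \<in> M" "y \<in> M" "z \<in> closed_segment x y"
  shows "d x z + d z y = d x y"
proof (cases "x = y")
  case False
  obtain u where u: "0 \<le> u" "u \<le> 1" "z = x + u *\<^sub>R (y - x)"
    using assms(3) by (auto simp: in_segment algebra_simps)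
  let ?v = "y - x"
  obtain \<phi> where "line_chart x ?v \<phi>"
    using line_chart_exists[of x ?v] assms(1) False by auto
  note \<phi> = line_chartD[OF this]
  have dom: "0 \<in> line_dom x ?v" "1 \<in> line_dom x ?v" "u \<in> line_dom x ?v"
    using assms segment_subset u by (auto simp: line_dom_def)
  have "\<phi> 0 \<le> \<phi> u" "\<phi> u \<le> \<phi> 1"
    using \<phi>(2) dom u by (auto simp: strict_mono_on_leD)
  then show ?thesis
    using \<phi>(5)[of 0 u] \<phi>(5)[of u 1] \<phi>(5)[of 0 1] dom u by simp
qed (use assms in auto)

text \<open>Converse of \<open>between_add\<close> on a single line: equality in the triangle
  inequality orders the chart values and hence the parameters.\<close>

lemma betweenI:
  assumes "x \<in> M" "y \<in> M" "x \<noteq> y" "z \<in> chord x y" "d x z + d z y = d x y"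
  shows "z \<in> closed_segment x y"
proof -
  obtain u where u: "z = x + u *\<^sub>R (y - x)" "z \<in> M"
    using assms(4) by (auto simp: chord_def affine_hull_pair_param')
  let ?v = "y - x"
  obtain \<phi> where "line_chart x ?v \<phi>"
    using line_chart_exists[of x ?v] assms(1,3) by auto
  note \<phi> = line_chartD[OF this]
  have dom: "0 \<in> line_dom x ?v" "1 \<in> line_dom x ?v" "u \<in> line_dom x ?v"
    using assms u by (auto simp: line_dom_def)
  have "\<bar>\<phi> 0 - \<phi> u\<bar> + \<bar>\<phi> u - \<phi> 1\<bar> = \<bar>\<phi> 0 - \<phi> 1\<bar>"
    using \<phi>(5)[of 0 u] \<phi>(5)[of u 1] \<phi>(5)[of 0 1] dom u assms(5) by simp
  moreover have "\<phi> 0 < \<phi> 1" using \<phi>(2) dom by (simp add: strict_mono_onD)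
  ultimately have "\<phi> 0 \<le> \<phi> u" "\<phi> u \<le> \<phi> 1" by linarith+
  then have "0 \<le> u" "u \<le> 1"
    using \<phi>(2) dom by (simp_all add: strict_mono_on_less_eq)
  then show ?thesis using u by (auto simp: in_segment algebra_simps intro!: exI[of _ u])
qed

section \<open>The metric reflection in a point\<close>

lemma reflect_ex1:
  assumes "p \<in> M" "x \<in> M"
  shows "\<exists>!y. y \<in> M \<and> p \<in> closed_segment x y \<and> d p y = d p x"
proof (cases "x = p")
  case True
  show ?thesis
  proof (rule ex1I[of _ p])
    show "p \<in> M \<and> p \<in> closed_segment x p \<and> d p p = d p x" using True assms by auto
  next
    fix y assume "y \<in> M \<and> p \<in> closed_segment x y \<and> d p y = d p x"
    then show "y = p" using True assms by auto
  qed
next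
  case False
  let ?v = "p - x"
  obtain \<phi> where "line_chart p ?v \<phi>"
    using line_chart_exists[of p ?v] assms(1) False by auto
  note \<phi> = line_chartD[OF this]
  have dom: "0 \<in> line_dom p ?v" "-1 \<in> line_dom p ?v"
    using assms by (auto simp: line_dom_def)
  have neg: "\<phi> (-1) < 0" using \<phi>(1,2) dom strict_mono_onD[of _ \<phi> "-1" 0] by simp
  \<comment> \<open>\<open>x\<close> has parameter -1; since the chart is onto, its distance can be
    laid off on the other side of \<open>p\<close>.\<close>
  obtain t where t: "t \<in> line_dom p ?v" "\<phi> t = - \<phi> (-1)" using \<phi>(3) by (metis UNIV_I imageE)
  have dpx: "d p x = - \<phi> (-1)" using \<phi>(5)[of 0 "-1"] \<phi>(1) dom neg by simp
  have "\<not> t \<le> 0" using strict_mono_on_leD[OF \<phi>(2) t(1) dom(1)] \<phi>(1) neg t(2) by linarith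
  then have tp: "t > 0" by simp
  show ?thesis
  proof (rule ex1I[of _ "p + t *\<^sub>R ?v"])
    have "p \<in> closed_segment x (p + t *\<^sub>R ?v)"
      using tp by (intro in_closed_segment_beyond) simp
    moreover have "d p (p + t *\<^sub>R ?v) = d p x"
      using \<phi>(5)[of 0 t] \<phi>(1) t dom neg dpx by simp
    ultimately show "p + t *\<^sub>R ?v \<in> M \<and> p \<in> closed_segment x (p + t *\<^sub>R ?v) \<and> d p (p + t *\<^sub>R ?v) = d p x"
      using t by (simp add: line_dom_def)
  next
    fix y assume y: "y \<in> M \<and> p \<in> closed_segment x y \<and> d p y = d p x"
    then obtain s where s0: "0 \<le> s" and ys: "y = p + s *\<^sub>R ?v"
      using closed_segment_beyondE[of p x y] False by blast
    then have sd: "s \<in> line_dom p ?v" using y by (simp add: line_dom_def)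
    have "\<phi> 0 \<le> \<phi> s" using strict_mono_on_leD[OF \<phi>(2)] s0 dom sd by blast
    then have "\<phi> s = \<phi> t"
    proof -
      have "d p y = \<bar>\<phi> 0 - \<phi> s\<bar>" using \<phi>(5)[OF dom(1) sd] ys by simp
      moreover have "d p y = \<phi> t" using y dpx t(2) by simp
      ultimately show ?thesis using \<open>\<phi> 0 \<le> \<phi> s\<close> \<phi>(1) by linarith
    qed
    then have "s = t" using \<phi>(2) sd t(1) strict_mono_on_eqD by metis
    then show "y = p + t *\<^sub>R ?v" using ys by simp
  qed
qed

text \<open>Available at every point of \<open>M\<close>, center or not. Only distances and
  betweenness enter, so an isometry carries it to the reflection in the image point
  (\<open>isometry_reflect\<close>).\<close>

definition reflect :: "real ^ 'n \<Rightarrow> real ^ 'n \<Rightarrow> real ^ 'n" where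
  "reflect p x = (THE y. y \<in> M \<and> p \<in> closed_segment x y \<and> d p y = d p x)"

lemma reflect_props:
  assumes "p \<in> M" "x \<in> M"
  shows reflect_in: "reflect p x \<in> M" and reflect_seg: "p \<in> closed_segment x (reflect p x)"
    and reflect_dist: "d p (reflect p x) = d p x"
proof -
  have *: "reflect p x \<in> M \<and> p \<in> closed_segment x (reflect p x) \<and> d p (reflect p x) = d p x"
    unfolding reflect_def by (rule theI'[OF reflect_ex1[OF assms]])
  from * show "reflect p x \<in> M" by (elim conjE)
  from * show "p \<in> closed_segment x (reflect p x)" by (elim conjE)
  from * show "d p (reflect p x) = d p x" by (elim conjE)
qed

lemma reflect_eqI:
  assumes "p \<in> M" "x \<in> M" "y \<in> M" "p \<in> closed_segment x y" "d p y = d p x"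
  shows "reflect p x = y"
  unfolding reflect_def using reflect_ex1[OF assms(1,2)] assms by (intro the1_equality) auto

lemma reflect_refl [simp]: "p \<in> M \<Longrightarrow> x \<in> M \<Longrightarrow> reflect p (reflect p x) = x"
  by (rule reflect_eqI) (auto simp: reflect_in reflect_seg reflect_dist closed_segment_commute)

lemma reflect_self [simp]: "p \<in> M \<Longrightarrow> reflect p p = p"
  by (rule reflect_eqI) auto

lemma reflect_param:
  assumes "p \<in> M" "x \<in> M" "x \<noteq> p"
  obtains \<tau> where "\<tau> > 0" "reflect p x = p - \<tau> *\<^sub>R (x - p)"
proof -
  have ne: "reflect p x \<noteq> p" using reflect_dist[OF assms(1,2)] assms by force
  obtain t where t: "0 \<le> t" "reflect p x = p + t *\<^sub>R (p - x)"
    using closed_segment_beyondE[OF reflect_seg[OF assms(1,2)]] assms(3) by blast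
  then have "t \<noteq> 0" using ne by auto
  then show thesis using t by (intro that[of t]) (auto simp: algebra_simps)
qed

lemma reflect_chord: "p \<in> M \<Longrightarrow> x \<in> M \<Longrightarrow> x \<noteq> p \<Longrightarrow> reflect p x \<in> chord p x"
  by (metis (no_types, lifting) Int_iff affine_hull_pair_param' chord_def diff_conv_add_uminus rangeI
      reflect_in reflect_param scaleR_minus_left)

abbreviation self_isometry :: "(real ^ 'n \<Rightarrow> real ^ 'n) \<Rightarrow> bool" where
  "self_isometry \<tau> \<equiv> isometry_between M d M d \<tau>"

text \<open>Geodesic lines are given by locally isometric curves, so isometries preserve them; the
  axiom on geodesic lines turns the image back into a chord.\<close>

lemma isometry_chord:
  assumes "self_isometry \<tau>" "x \<in> M" "y \<in> M" "x \<noteq> y"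
  shows "\<tau> ` chord x y = chord (\<tau> x) (\<tau> y)"
proof -
  have \<tau>: "bij_betw \<tau> M M" "\<And>a b. a \<in> M \<Longrightarrow> b \<in> M \<Longrightarrow> d (\<tau> a) (\<tau> b) = d a b"
    using assms(1) by (auto simp: isometry_between_def)
  obtain \<gamma> where \<gamma>: "range \<gamma> = chord x y" "chord x y \<subseteq> M"
    "\<forall>t. \<exists>\<epsilon>>0. \<forall>r\<in>ball t \<epsilon>. \<forall>s\<in>ball t \<epsilon>. d (\<gamma> r) (\<gamma> s) = \<bar>r - s\<bar>"
    using geodesic_line_chord[OF assms(2,4)] unfolding geodesic_line_def by blast
  have \<gamma>M: "\<gamma> t \<in> M" for t using \<gamma>(1,2) by blast
  have "geodesic_line M d (\<tau> ` chord x y)"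
    unfolding geodesic_line_def
  proof (intro exI[of _ "\<tau> \<circ> \<gamma>"] conjI)
    show "range (\<tau> \<circ> \<gamma>) = \<tau> ` chord x y" using \<gamma>(1) by (metis image_comp)
    show "\<tau> ` chord x y \<subseteq> M" using \<gamma>(2) \<tau>(1) by (auto simp: bij_betw_def)
    show "\<forall>t. \<exists>\<epsilon>>0. \<forall>r\<in>ball t \<epsilon>. \<forall>s\<in>ball t \<epsilon>. d ((\<tau> \<circ> \<gamma>) r) ((\<tau> \<circ> \<gamma>) s) = \<bar>r - s\<bar>"
      using \<gamma>(3) by (simp add: \<tau>(2) \<gamma>M)
  qed
  moreover have "\<tau> x \<noteq> \<tau> y" using \<tau>(1) assms by (auto simp: bij_betw_def inj_on_def)
  ultimately show ?thesis using assms by (intro geodesic_line_eq_chord) auto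
qed

lemma isometry_between_segment:
  assumes "self_isometry \<tau>" "x \<in> M" "y \<in> M" "z \<in> closed_segment x y"
  shows "\<tau> z \<in> closed_segment (\<tau> x) (\<tau> y)"
proof (cases "x = y")
  case False
  have \<tau>: "bij_betw \<tau> M M" "\<And>a b. a \<in> M \<Longrightarrow> b \<in> M \<Longrightarrow> d (\<tau> a) (\<tau> b) = d a b"
    using assms(1) by (auto simp: isometry_between_def)
  have zM: "z \<in> M" using assms segment_subset by blast
  have "z \<in> chord x y"
    using assms(4) zM by (auto simp: chord_def affine_hull_pair_param' in_segment algebra_simps)
  then have "\<tau> z \<in> chord (\<tau> x) (\<tau> y)" using isometry_chord[OF assms(1-3) False] by blast
  moreover have "\<tau> x \<in> M" "\<tau> y \<in> M" "\<tau> x \<noteq> \<tau> y"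
    using \<tau>(1) assms False by (auto simp: bij_betw_def inj_on_def)
  moreover have "d (\<tau> x) (\<tau> z) + d (\<tau> z) (\<tau> y) = d (\<tau> x) (\<tau> y)"
    using between_add[OF assms(2-4)] \<tau>(2) assms(2,3) zM by simp
  ultimately show ?thesis by (intro betweenI)
qed (use assms in auto)

lemma isometry_reflect:
  assumes "self_isometry \<tau>" "p \<in> M" "x \<in> M"
  shows "\<tau> (reflect p x) = reflect (\<tau> p) (\<tau> x)"
proof -
  have \<tau>: "bij_betw \<tau> M M" "\<And>a b. a \<in> M \<Longrightarrow> b \<in> M \<Longrightarrow> d (\<tau> a) (\<tau> b) = d a b"
    using assms(1) by (auto simp: isometry_between_def)
  have \<tau>M: "a \<in> M \<Longrightarrow> \<tau> a \<in> M" for a using \<tau>(1) by (auto simp: bij_betw_def)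
  have r: "reflect p x \<in> M" using assms by (intro reflect_in)
  have "d (\<tau> p) (\<tau> (reflect p x)) = d (\<tau> p) (\<tau> x)"
    using \<tau>(2)[OF assms(2) r] \<tau>(2)[OF assms(2,3)] reflect_dist[OF assms(2,3)] by simp
  moreover have "\<tau> p \<in> closed_segment (\<tau> x) (\<tau> (reflect p x))"
    by (rule isometry_between_segment[OF assms(1,3) r reflect_seg[OF assms(2,3)]])
  ultimately show ?thesis
    using reflect_eqI[OF \<tau>M[OF assms(2)] \<tau>M[OF assms(3)] \<tau>M[OF r]] by simp
qed

lemma isometry_comp: "self_isometry \<sigma> \<Longrightarrow> self_isometry \<tau> \<Longrightarrow> self_isometry (\<sigma> \<circ> \<tau>)"
  unfolding isometry_between_def by (auto intro: bij_betw_trans simp: bij_betwE)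

lemma reflect_isometryI:
  assumes "p \<in> M" "\<And>x y. x \<in> M \<Longrightarrow> y \<in> M \<Longrightarrow> d (reflect p x) (reflect p y) = d x y"
  shows "self_isometry (reflect p)"
proof -
  have "bij_betw (reflect p) M M"
    using assms(1) by (intro bij_betwI[where g = "reflect p"]) (auto simp: reflect_in)
  then show ?thesis using assms(2) by (simp add: isometry_between_def)
qed

end

section \<open>Centers\<close>

text \<open>Two successive reflections translate, so \<open>Z\<close> contains
  \<open>2 k a + 2 l b\<close> for all integers \<open>k\<close>, \<open>l\<close>, and these
  numbers are dense when \<open>a / b\<close> is irrational.\<close>

lemma reflection_closed_dense:
  fixes Z :: "real set"
  assumes "0 \<in> Z" "a \<in> Z" "b \<in> Z" and cl: "\<And>r s. r \<in> Z \<Longrightarrow> s \<in> Z \<Longrightarrow> 2 * r - s \<in> Z"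
    and irr: "a / b \<notin> \<rat>" and "\<epsilon> > 0"
  shows "\<exists>z\<in>Z. \<bar>z - r\<bar> < \<epsilon>"
proof -
  have b: "b \<noteq> 0" using irr by auto
  have neg: "- z \<in> Z" if "z \<in> Z" for z using cl[OF assms(1) that] by simp
  have plus: "z + 2 * c \<in> Z" if "z \<in> Z" "c \<in> Z" for z c using cl[OF that(2) neg[OF that(1)]] by (simp add: add.commute)
  have nat: "z + 2 * real n * c \<in> Z" if "z \<in> Z" "c \<in> Z" for z c n
  proof (induction n)
    case (Suc n) then show ?case using plus[OF Suc that(2)] by (simp add: algebra_simps)
  qed (use that in simp)
  have int: "z + 2 * of_int k * c \<in> Z" if "z \<in> Z" "c \<in> Z" for z c k
  proof (cases k rule: int_cases2)
    case (nonneg n) then show ?thesis using nat[OF that] by simp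
  next
    case (nonpos n) then show ?thesis using nat[OF that(1) neg[OF that(2)], of n] by simp
  qed
  \<comment> \<open>After division by \<open>2 * b\<close>, approximating \<open>r\<close> by
    \<open>2 k a - 2 h b\<close> is the density of the fractional parts of the multiples of
    \<open>a / b\<close>.\<close>
  obtain h k where hk: "\<bar>of_int k * (a / b) - of_int h - r / (2 * b)\<bar> < \<epsilon> / (2 * \<bar>b\<bar>)"
    by (rule sequence_of_fractional_parts_is_dense[OF irr, of "\<epsilon> / (2 * \<bar>b\<bar>)" "r / (2 * b)"])
      (use b \<open>\<epsilon> > 0\<close> in simp_all)
  let ?z = "0 + 2 * of_int k * a + 2 * of_int (- h) * b"
  have "?z \<in> Z" using int[OF int[OF assms(1,2)] assms(3)] .
  moreover have "?z - r = 2 * b * (of_int k * (a / b) - of_int h - r / (2 * b))"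
    using b by (simp add: field_simps)
  then have "\<bar>?z - r\<bar> = 2 * \<bar>b\<bar> * \<bar>of_int k * (a / b) - of_int h - r / (2 * b)\<bar>"
    by (simp add: abs_mult)
  moreover have "2 * \<bar>b\<bar> * \<bar>of_int k * (a / b) - of_int h - r / (2 * b)\<bar> < 2 * \<bar>b\<bar> * (\<epsilon> / (2 * \<bar>b\<bar>))"
    using hk b by (intro mult_strict_left_mono) auto
  moreover have "2 * \<bar>b\<bar> * (\<epsilon> / (2 * \<bar>b\<bar>)) = \<epsilon>" using b by simp
  ultimately show ?thesis by (intro bexI[of _ ?z]) simp_all
qed

context straight_projective_metric_space
begin

lemma chordE:
  assumes "y \<in> chord x z"
  obtains t where "y = x + t *\<^sub>R (z - x)" "t \<in> line_dom x (z - x)"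
  using assms by (auto simp: chord_def affine_hull_pair_param' line_dom_def)

lemma reflect_unique_on_chord:
  assumes "p \<in> M" "x \<in> M" "x \<noteq> p" "y \<in> chord p x" "d p y = d p x"
  shows "y = x \<or> y = reflect p x"
proof -
  let ?v = "x - p"
  obtain u where u: "y = p + u *\<^sub>R ?v" "u \<in> line_dom p ?v" using assms(4) by (rule chordE)
  obtain \<phi> where "line_chart p ?v \<phi>"
    using line_chart_exists[of p ?v] assms by auto
  note \<phi> = line_chartD[OF this]
  have dom: "0 \<in> line_dom p ?v" "1 \<in> line_dom p ?v" using assms by (auto simp: line_dom_def)
  have eq: "\<bar>\<phi> u\<bar> = \<bar>\<phi> 1\<bar>" using \<phi>(5)[OF dom(1) u(2)] \<phi>(5)[OF dom] \<phi>(1) u assms(5) by simp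
  have "\<phi> 0 < \<phi> 1" using strict_mono_onD[OF \<phi>(2) dom] by simp
  show ?thesis
  proof (cases "0 \<le> u")
    case True
    then have "\<phi> 0 \<le> \<phi> u" using strict_mono_on_leD[OF \<phi>(2) dom(1) u(2)] by simp
    then have "\<phi> u = \<phi> 1" using eq \<open>\<phi> 0 < \<phi> 1\<close> \<phi>(1) by linarith
    then have "u = 1" using strict_mono_on_eqD[OF \<phi>(2)] u(2) dom(2) by metis
    then show ?thesis using u by simp
  next
    case False
    have "p \<in> closed_segment x (p + (- u) *\<^sub>R (p - x))"
      using False by (intro in_closed_segment_beyond) simp
    also have "p + (- u) *\<^sub>R (p - x) = y" using u by (simp add: algebra_simps)
    finally have "reflect p x = y"
      using assms by (intro reflect_eqI) (auto simp: chord_def)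
    then show ?thesis by simp
  qed
qed

text \<open>Each point is fixed or sent to its opposite. If some point other than \<open>p\<close>
  were fixed, all would be: on the same line because of the distances to two fixed points; off it
  because the midpoint of a fixed and a moved point would have an image both on its own line through
  \<open>p\<close> and on a segment that misses this line. The map would then be the
  identity.\<close>

lemma metric_point_reflection_eq_reflect:
  assumes "metric_point_reflection M d p \<sigma>" "p \<in> M" "x \<in> M"
  shows "\<sigma> x = reflect p x"
proof -
  have iso: "self_isometry \<sigma>" and inv: "\<And>x. x \<in> M \<Longrightarrow> \<sigma> (\<sigma> x) = x" and nid: "\<exists>x\<in>M. \<sigma> x \<noteq> x"
    and p: "\<sigma> p = p" and L: "\<And>L. geodesic_line M d L \<Longrightarrow> p \<in> L \<Longrightarrow> \<sigma> ` L = L"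
    using assms(1) unfolding metric_point_reflection_def by blast+
  have \<sigma>M: "y \<in> M \<Longrightarrow> \<sigma> y \<in> M" for y using iso by (auto simp: isometry_between_def bij_betw_def)
  have \<sigma>d: "a \<in> M \<Longrightarrow> b \<in> M \<Longrightarrow> d (\<sigma> a) (\<sigma> b) = d a b" for a b
    using iso unfolding isometry_between_def by blast
  have ch: "\<sigma> y \<in> chord p y" if "y \<in> M" "y \<noteq> p" for y
  proof -
    have "\<sigma> ` chord p y = chord p y"
      using that assms(2) by (intro L geodesic_line_chord) auto
    then show ?thesis using that by (metis chord_self(2) image_eqI)
  qed
  have dp: "d p (\<sigma> y) = d p y" if "y \<in> M" for y using \<sigma>d[OF assms(2) that] p by simp
  have or: "\<sigma> y = y \<or> \<sigma> y = reflect p y" if "y \<in> M" "y \<noteq> p" for y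
    using reflect_unique_on_chord[OF assms(2) that ch[OF that] dp[OF that(1)]] .
  have "\<sigma> y = y" if x: "x \<in> M" "x \<noteq> p" "\<sigma> x = x" and y: "y \<in> M" for x y
  proof (cases "y \<in> chord p x")
    case True
    let ?v = "x - p"
    obtain u where u: "y = p + u *\<^sub>R ?v" "u \<in> line_dom p ?v" using True by (rule chordE)
    have "\<sigma> y \<in> \<sigma> ` chord p x" using True by blast
    also have "\<sigma> ` chord p x = chord p x"
      using x assms(2) by (intro L geodesic_line_chord) auto
    finally obtain w where w: "\<sigma> y = p + w *\<^sub>R ?v" "w \<in> line_dom p ?v" by (rule chordE)
    obtain \<phi> where "line_chart p ?v \<phi>"
      using line_chart_exists[of p ?v] x assms(2) by auto
    note \<phi> = line_chartD[OF this]
    have dom: "0 \<in> line_dom p ?v" "1 \<in> line_dom p ?v" using assms(2) x by (auto simp: line_dom_def)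
    have "\<phi> 0 < \<phi> 1" using strict_mono_onD[OF \<phi>(2) dom] by simp
    moreover have "\<bar>\<phi> 0 - \<phi> u\<bar> = \<bar>\<phi> 0 - \<phi> w\<bar>"
      using \<phi>(5)[OF dom(1) u(2)] \<phi>(5)[OF dom(1) w(2)] dp[OF y] u w by simp
    moreover have "\<bar>\<phi> 1 - \<phi> u\<bar> = \<bar>\<phi> 1 - \<phi> w\<bar>"
      using \<phi>(5)[OF dom(2) u(2)] \<phi>(5)[OF dom(2) w(2)] \<sigma>d[OF x(1) y] x(3) u w by simp
    ultimately have "\<phi> u = \<phi> w" by linarith
    then have "u = w" using strict_mono_on_eqD[OF \<phi>(2)] u(2) w(2) by metis
    then show ?thesis using u w by simp
  next
    case False
    show ?thesis
    proof (rule ccontr)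
      assume ne: "\<sigma> y \<noteq> y"
      have yp: "y \<noteq> p" using False assms(2) by auto
      then have "\<sigma> y = reflect p y" using or y ne by blast
      moreover obtain k where k: "k > 0" "reflect p y = p - k *\<^sub>R (y - p)"
        by (rule reflect_param[OF assms(2) y yp])
      ultimately have \<sigma>y: "\<sigma> y = p - k *\<^sub>R (y - p)" by simp
      let ?v = "x - p" and ?w = "y - p"
      have indep: "\<alpha> = 0 \<and> \<beta> = 0" if "\<alpha> *\<^sub>R ?v = \<beta> *\<^sub>R ?w" for \<alpha> \<beta>
      proof -
        have "\<beta> = 0"
        proof (rule ccontr)
          assume "\<beta> \<noteq> 0"
          have "(1/\<beta>) *\<^sub>R \<beta> *\<^sub>R ?w = (1/\<beta>) *\<^sub>R \<alpha> *\<^sub>R ?v" using that by simp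
          then have "?w = (\<alpha> / \<beta>) *\<^sub>R ?v" using \<open>\<beta> \<noteq> 0\<close> by simp
          then have "y = p + (\<alpha> / \<beta>) *\<^sub>R ?v" by (simp add: algebra_simps)
          then have "y \<in> chord p x" using y by (auto simp: chord_def affine_hull_pair_param')
          then show False using False by simp
        qed
        then show ?thesis using that x by auto
      qed
      define z where "z = midpoint x y"
      have zs: "z \<in> closed_segment x y" by (simp add: z_def)
      then have zM: "z \<in> M" using segment_subset[OF x(1) y] by blast
      have zp: "z - p = (1/2) *\<^sub>R (?v + ?w)"
      proof -
        have "p = (1/2) *\<^sub>R (p + p)" by (simp flip: scaleR_2)
        then have "z - p = (1/2) *\<^sub>R (x + y) - (1/2) *\<^sub>R (p + p)" by (simp add: z_def midpoint_def)
        also have "\<dots> = (1/2) *\<^sub>R (?v + ?w)" unfolding scaleR_diff_right[symmetric] by simp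
        finally show ?thesis .
      qed
      have "z \<noteq> p"
      proof
        assume "z = p"
        then have "?v + ?w = 0" using zp by simp
        then have "1 *\<^sub>R ?v = (-1) *\<^sub>R ?w" unfolding add_eq_0_iff by simp
        then show False using indep by fastforce
      qed
      obtain c where c: "\<sigma> z = p + c *\<^sub>R (z - p)"
        by (rule chordE[OF ch[OF zM \<open>z \<noteq> p\<close>]])
      have "\<sigma> z \<in> closed_segment x (\<sigma> y)"
        using isometry_between_segment[OF iso x(1) y zs] x(3) by simp
      then obtain u where u: "0 \<le> u" "u \<le> 1" "\<sigma> z = (1 - u) *\<^sub>R x + u *\<^sub>R \<sigma> y"
        unfolding in_segment by blast
      have "(1 - u) *\<^sub>R x + u *\<^sub>R \<sigma> y = p + (1 - u) *\<^sub>R ?v - (u * k) *\<^sub>R ?w"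
        unfolding \<sigma>y by (simp add: algebra_simps)
      then have "(c / 2) *\<^sub>R (?v + ?w) = (1 - u) *\<^sub>R ?v - (u * k) *\<^sub>R ?w"
        using u(3) c zp by simp
      then have "(c / 2 - (1 - u)) *\<^sub>R ?v = (- u * k - c / 2) *\<^sub>R ?w"
        by (simp add: algebra_simps)
      \<comment> \<open>On the line through \<open>p\<close> and \<open>z\<close> both coefficients
        are \<open>c / 2\<close>; on the segment they are \<open>1 - u >= 0\<close> and
        \<open>- u * k <= 0\<close>, which are never equal.\<close>
      from indep[OF this] have "1 - u = - u * k" by linarith
      moreover have "u * k \<ge> 0" using u k by simp
      ultimately have "u = 1" "u * k = 0" using u by linarith+
      then show False using k by simp
    qed
  qed
  then have "\<sigma> x \<noteq> x" if "x \<in> M" "x \<noteq> p" for x using nid that by blast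
  then show ?thesis using or assms p by (cases "x = p") auto
qed

lemma geodesic_line_two_points:
  assumes "geodesic_line M d L" "p \<in> L"
  obtains y where "y \<in> L" "y \<noteq> p"
proof -
  obtain f :: "real ^ 'n \<Rightarrow> real" where "bij_betw f L UNIV"
    using straight[OF assms(1)] unfolding isometric_spaces_def isometry_between_def by blast
  then have "\<exists>y\<in>L. f y = f p + 1" unfolding bij_betw_def by (metis UNIV_I imageE)
  then show thesis using that by force
qed

lemma geodesic_line_subset: "geodesic_line M d L \<Longrightarrow> L \<subseteq> M"
  unfolding geodesic_line_def by blast

lemma exists_other_point:
  assumes "p \<in> M"
  obtains x where "x \<in> M" "x \<noteq> p"
proof -
  obtain e where "e > 0" "ball p e \<subseteq> M" using open_carrier assms open_contains_ball by blast
  moreover have "p + (e/2) *\<^sub>R axis undefined 1 \<in> ball p e" "p + (e/2) *\<^sub>R axis undefined 1 \<noteq> p"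
    using \<open>e > 0\<close> by (auto simp: dist_norm axis_eq_0_iff)
  ultimately show thesis using that by blast
qed

lemma reflect_neq: "p \<in> M \<Longrightarrow> x \<in> M \<Longrightarrow> x \<noteq> p \<Longrightarrow> reflect p x \<noteq> x"
  using reflect_seg[of p x] by auto

text \<open>From here on centers are handled through \<open>reflect\<close> alone. For the converse
  direction, lines through \<open>p\<close> are invariant because isometries map chords to
  chords.\<close>

lemma center_iff: "center M d p \<longleftrightarrow> p \<in> M \<and> self_isometry (reflect p)"
proof
  assume "center M d p"
  then obtain \<sigma> where p: "p \<in> M" and \<sigma>: "metric_point_reflection M d p \<sigma>"
    by (auto simp: center_def)
  have eq: "\<sigma> x = reflect p x" if "x \<in> M" for x
    using metric_point_reflection_eq_reflect[OF \<sigma> p that] .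
  have "self_isometry \<sigma>" using \<sigma> by (simp add: metric_point_reflection_def)
  then have "d (reflect p x) (reflect p y) = d x y" if "x \<in> M" "y \<in> M" for x y
    using that eq by (simp add: isometry_between_def)
  then show "p \<in> M \<and> self_isometry (reflect p)" using p by (auto intro: reflect_isometryI)
next
  assume *: "p \<in> M \<and> self_isometry (reflect p)"
  then have p: "p \<in> M" by simp
  have "metric_point_reflection M d p (reflect p)"
    unfolding metric_point_reflection_def
  proof (intro conjI ballI allI impI)
    show "\<exists>x\<in>M. reflect p x \<noteq> x" using exists_other_point[OF p] reflect_neq[OF p] by metis
  next
    fix L assume L: "geodesic_line M d L \<and> p \<in> L"
    then obtain y where y: "y \<in> L" "y \<noteq> p" using geodesic_line_two_points by blast
    have yM: "y \<in> M" using y L geodesic_line_subset by blast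
    have "L = chord p y" using geodesic_line_eq_chord[of L p y] L y by metis
    moreover have "reflect p ` chord p y = chord p (reflect p y)"
      using isometry_chord[of "reflect p" p y] * yM y by simp
    moreover have "chord p y = chord p (reflect p y)"
      using geodesic_line_eq_chord[OF geodesic_line_chord[OF p], of y p "reflect p y"] reflect_chord[OF p yM y(2)]
        y reflect_neq[OF p reflect_in[OF p yM]] chord_self(1)[OF p] reflect_refl[OF p yM] reflect_self[OF p] by metis
    ultimately show "reflect p ` L = L" by simp
  qed (use * in auto)
  then show "center M d p" using p by (auto simp: center_def)
qed

lemma centerD: "center M d p \<Longrightarrow> p \<in> M" "center M d p \<Longrightarrow> self_isometry (reflect p)"
  by (auto simp: center_iff)

lemma center_dist:
  "center M d p \<Longrightarrow> x \<in> M \<Longrightarrow> y \<in> M \<Longrightarrow> d (reflect p x) (reflect p y) = d x y"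
  using centerD(2) unfolding isometry_between_def by blast

lemma reflect_reflect_conj:
  assumes "center M d p" "q \<in> M" "x \<in> M"
  shows "reflect (reflect p q) x = reflect p (reflect q (reflect p x))"
proof -
  have p: "p \<in> M" using assms(1) by (rule centerD)
  have "reflect p (reflect q (reflect p x)) = reflect (reflect p q) (reflect p (reflect p x))"
    by (rule isometry_reflect[OF centerD(2)[OF assms(1)] assms(2) reflect_in[OF p assms(3)]])
  then show ?thesis unfolding reflect_refl[OF p assms(3)] by (rule sym)
qed

text \<open>The reflection in \<open>reflect p q\<close> is the one in \<open>q\<close> conjugated
  by the one in \<open>p\<close>.\<close>

lemma center_reflect:
  assumes "center M d p" "center M d q"
  shows "center M d (reflect p q)"
proof -
  have pq: "p \<in> M" "q \<in> M" using assms centerD by auto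
  have "self_isometry (reflect (reflect p q))"
  proof (rule reflect_isometryI)
    show "reflect p q \<in> M" using pq by (rule reflect_in)
    show "d (reflect (reflect p q) x) (reflect (reflect p q) y) = d x y" if "x \<in> M" "y \<in> M" for x y
      using that pq assms by (simp add: reflect_reflect_conj center_dist reflect_in)
  qed
  then show ?thesis using pq by (simp add: center_iff reflect_in)
qed

section \<open>Continuity of the reflection in its center\<close>

lemma ray_add:
  assumes "c \<in> M" "c + t *\<^sub>R w \<in> M" "0 \<le> s" "s \<le> t"
  shows "d c (c + s *\<^sub>R w) + d (c + s *\<^sub>R w) (c + t *\<^sub>R w) = d c (c + t *\<^sub>R w)"
    and "c + s *\<^sub>R w \<in> M"
proof -
  have "c + s *\<^sub>R w \<in> closed_segment c (c + t *\<^sub>R w)"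
  proof (cases "t = 0")
    case False
    then show ?thesis unfolding in_segment using assms
      by (intro exI[of _ "s / t"]) (auto simp: algebra_simps)
  qed (use assms in auto)
  then show "d c (c + s *\<^sub>R w) + d (c + s *\<^sub>R w) (c + t *\<^sub>R w) = d c (c + t *\<^sub>R w)" "c + s *\<^sub>R w \<in> M"
    using between_add[OF assms(1,2)] segment_subset[OF assms(1,2)] by blast+
qed

lemma ray_add':
  assumes "a \<in> M" "x + b *\<^sub>R (a - x) \<in> M" "1 \<le> s" "s \<le> b"
  shows "d a (x + s *\<^sub>R (a - x)) + d (x + s *\<^sub>R (a - x)) (x + b *\<^sub>R (a - x)) = d a (x + b *\<^sub>R (a - x))"
    and "x + s *\<^sub>R (a - x) \<in> M"
proof -
  have step: "x + t *\<^sub>R (a - x) = a + (t - 1) *\<^sub>R (a - x)" for t by (simp add: algebra_simps)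
  have *: "a + (b - 1) *\<^sub>R (a - x) \<in> M" "0 \<le> s - 1" "s - 1 \<le> b - 1"
    using assms step[of b] by simp_all
  show "d a (x + s *\<^sub>R (a - x)) + d (x + s *\<^sub>R (a - x)) (x + b *\<^sub>R (a - x)) = d a (x + b *\<^sub>R (a - x))"
    unfolding step by (rule ray_add[OF assms(1) *])
  show "x + s *\<^sub>R (a - x) \<in> M"
    unfolding step by (rule ray_add[OF assms(1) *])
qed

lemma d_pos: "x \<in> M \<Longrightarrow> y \<in> M \<Longrightarrow> x \<noteq> y \<Longrightarrow> 0 < d x y"
  using zero[of x y] nonneg[of x y] by linarith

lemma reflect_param':
  assumes "p \<in> M" "x \<in> M" "x \<noteq> p"
  obtains \<tau> where "\<tau> > 1" "reflect p x = x + \<tau> *\<^sub>R (p - x)"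
proof -
  obtain t where t: "t > 0" "reflect p x = p - t *\<^sub>R (x - p)" using reflect_param[OF assms] .
  then show thesis using that[of "1 + t"] by (auto simp: algebra_simps)
qed

text \<open>On the ray from \<open>x\<close> through \<open>c k\<close> the reflected point has
  parameter \<open>T k\<close>. For the center \<open>p\<close>, a parameter slightly above \<tau>
  gives a point farther from \<open>p\<close> than \<open>x\<close> is, one slightly below a nearer
  point; as \<open>d\<close> is continuous, both comparisons persist for centers close to
  \<open>p\<close>.\<close>

lemma reflect_tendsto:
  assumes x: "x \<in> M" and p: "p \<in> M" "x \<noteq> p" and c: "(c \<longlongrightarrow> p) F" and cM: "eventually (\<lambda>k. c k \<in> M) F"
  shows "((\<lambda>k. reflect (c k) x) \<longlongrightarrow> reflect p x) F"
proof -
  obtain \<tau> where \<tau>: "\<tau> > 1" "reflect p x = x + \<tau> *\<^sub>R (p - x)" using reflect_param'[OF p(1) x p(2)] .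
  have "\<forall>k. \<exists>t. c k \<in> M \<and> x \<noteq> c k \<longrightarrow> t > 1 \<and> reflect (c k) x = x + t *\<^sub>R (c k - x)"
    using reflect_param' x by metis
  then obtain T where T: "\<And>k. c k \<in> M \<Longrightarrow> x \<noteq> c k \<Longrightarrow> T k > 1 \<and> reflect (c k) x = x + T k *\<^sub>R (c k - x)"
    by metis
  have ne: "eventually (\<lambda>k. x \<noteq> c k) F"
    using tendsto_imp_eventually_ne[OF c, of x] p(2) by (metis (mono_tags, lifting) eventually_mono)
  have RM: "x + \<tau> *\<^sub>R (p - x) \<in> M" using \<tau> reflect_in[OF p(1) x] by simp
  have upper: "eventually (\<lambda>k. T k < b) F" if b: "b > \<tau>" and bM: "x + b *\<^sub>R (p - x) \<in> M" for b
  proof -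
    have "d p (x + \<tau> *\<^sub>R (p - x)) + d (x + \<tau> *\<^sub>R (p - x)) (x + b *\<^sub>R (p - x)) = d p (x + b *\<^sub>R (p - x))"
      using \<tau> b by (intro ray_add'(1)[OF p(1) bM]) simp_all
    moreover have "d (x + \<tau> *\<^sub>R (p - x)) (x + b *\<^sub>R (p - x)) > 0"
      using b p by (intro d_pos RM bM) auto
    moreover have "d p (x + \<tau> *\<^sub>R (p - x)) = d p x" using reflect_dist[OF p(1) x] \<tau>(2) by simp
    ultimately have *: "d p x < d p (x + b *\<^sub>R (p - x))" by linarith
    have "((\<lambda>k. d (c k) (x + b *\<^sub>R (c k - x)) - d (c k) x) \<longlongrightarrow> d p (x + b *\<^sub>R (p - x)) - d p x) F"
      using bM p x by (intro tendsto_intros tendsto_d c) auto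
    then have ev: "eventually (\<lambda>k. d (c k) (x + b *\<^sub>R (c k - x)) - d (c k) x > 0) F"
      using * by (intro order_tendstoD) auto
    show ?thesis
      using ev cM ne
    proof eventually_elim
      case (elim k)
      have Tk: "T k > 1" "reflect (c k) x = x + T k *\<^sub>R (c k - x)" using T elim by auto
      have RkM: "x + T k *\<^sub>R (c k - x) \<in> M" using reflect_in[OF elim(2) x] Tk by simp
      show "T k < b"
      proof (rule ccontr)
        assume "\<not> T k < b"
        then have "d (c k) (x + b *\<^sub>R (c k - x)) + d (x + b *\<^sub>R (c k - x)) (x + T k *\<^sub>R (c k - x)) = d (c k) (x + T k *\<^sub>R (c k - x))"
          using \<tau> b by (intro ray_add'(1)[OF elim(2) RkM]) simp_all
        moreover have "d (c k) (x + T k *\<^sub>R (c k - x)) = d (c k) x" using reflect_dist[OF elim(2) x] Tk by simp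
        ultimately show False using elim(1) nonneg[of "x + b *\<^sub>R (c k - x)" "x + T k *\<^sub>R (c k - x)"] by linarith
      qed
    qed
  qed
  have lower: "eventually (\<lambda>k. b < T k) F" if b: "b < \<tau>" "1 < b" for b
  proof -
    have bM: "x + b *\<^sub>R (p - x) \<in> M"
      using b by (intro ray_add'(2)[OF p(1) RM]) simp_all
    have "d p (x + b *\<^sub>R (p - x)) + d (x + b *\<^sub>R (p - x)) (x + \<tau> *\<^sub>R (p - x)) = d p (x + \<tau> *\<^sub>R (p - x))"
      using b by (intro ray_add'(1)[OF p(1) RM]) simp_all
    moreover have "d (x + b *\<^sub>R (p - x)) (x + \<tau> *\<^sub>R (p - x)) > 0"
      using b p by (intro d_pos RM bM) auto
    moreover have "d p (x + \<tau> *\<^sub>R (p - x)) = d p x" using reflect_dist[OF p(1) x] \<tau>(2) by simp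
    ultimately have *: "d p x > d p (x + b *\<^sub>R (p - x))" by linarith
    have "((\<lambda>k. d (c k) x - d (c k) (x + b *\<^sub>R (c k - x))) \<longlongrightarrow> d p x - d p (x + b *\<^sub>R (p - x))) F"
      using bM p x by (intro tendsto_intros tendsto_d c) auto
    then have ev: "eventually (\<lambda>k. d (c k) x - d (c k) (x + b *\<^sub>R (c k - x)) > 0) F"
      using * by (intro order_tendstoD) auto
    have bev: "eventually (\<lambda>k. x + b *\<^sub>R (c k - x) \<in> M) F"
    proof -
      have "((\<lambda>k. x + b *\<^sub>R (c k - x)) \<longlongrightarrow> x + b *\<^sub>R (p - x)) F" by (intro tendsto_intros c)
      then show ?thesis by (rule topological_tendstoD[OF _ open_carrier bM])
    qed
    show ?thesis
      using ev cM ne bev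
    proof eventually_elim
      case (elim k)
      have Tk: "T k > 1" "reflect (c k) x = x + T k *\<^sub>R (c k - x)" using T elim by auto
      show "b < T k"
      proof (rule ccontr)
        assume "\<not> b < T k"
        then have "d (c k) (x + T k *\<^sub>R (c k - x)) + d (x + T k *\<^sub>R (c k - x)) (x + b *\<^sub>R (c k - x)) = d (c k) (x + b *\<^sub>R (c k - x))"
          using Tk by (intro ray_add'(1)[OF elim(2,4)]) simp_all
        moreover have "d (c k) (x + T k *\<^sub>R (c k - x)) = d (c k) x" using reflect_dist[OF elim(2) x] Tk by simp
        ultimately show False using elim(1) nonneg[of "x + T k *\<^sub>R (c k - x)" "x + b *\<^sub>R (c k - x)"] by linarith
      qed
    qed
  qed
  \<comment> \<open>\<open>upper\<close> needs points of \<open>M\<close> at parameters slightly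
    above \<tau>.\<close>
  have "open (line_dom x (p - x))" "\<tau> \<in> line_dom x (p - x)" using RM open_line_dom by (auto simp: line_dom_def)
  then obtain e0 where e0: "e0 > 0" "ball \<tau> e0 \<subseteq> line_dom x (p - x)" using open_contains_ball by blast
  have "(T \<longlongrightarrow> \<tau>) F"
  proof (rule order_tendstoI)
    fix a assume "a < \<tau>"
    define b where "b = max a ((1 + \<tau>) / 2)"
    have "b < \<tau>" "1 < b" "a \<le> b" using \<open>a < \<tau>\<close> \<tau>(1) by (auto simp: b_def max_def)
    then show "eventually (\<lambda>k. a < T k) F" using lower[of b] by (auto elim: eventually_mono)
  next
    fix a assume "\<tau> < a"
    define b where "b = min a (\<tau> + e0 / 2)"
    have "b > \<tau>" "b \<le> a" "b \<in> ball \<tau> e0" using \<open>\<tau> < a\<close> e0(1) by (auto simp: b_def dist_real_def min_def)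
    then have "x + b *\<^sub>R (p - x) \<in> M" using e0(2) unfolding line_dom_def by blast
    from upper[OF \<open>b > \<tau>\<close> this] show "eventually (\<lambda>k. T k < a) F"
      by eventually_elim (use \<open>b \<le> a\<close> in simp)
  qed
  then have "((\<lambda>k. x + T k *\<^sub>R (c k - x)) \<longlongrightarrow> x + \<tau> *\<^sub>R (p - x)) F" by (intro tendsto_intros c)
  moreover have "eventually (\<lambda>k. x + T k *\<^sub>R (c k - x) = reflect (c k) x) F"
    using cM ne by eventually_elim (simp add: T)
  ultimately show ?thesis using \<tau>(2) Lim_transform_eventually by force
qed

end

lemma collinear_param:
  fixes p x y :: "'a::euclidean_space"
  assumes "collinear {p, x, y}" "x \<noteq> p"
  obtains u where "y = p + u *\<^sub>R (x - p)"
proof -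
  have "collinear {p, x, y} \<longleftrightarrow> y \<in> affine hull {p, x}"
    using assms(2) by (intro collinear_3_affine_hull) simp
  then have "y \<in> affine hull {p, x}" using assms(1) by simp
  then show thesis using that by (auto simp: affine_hull_pair_param')
qed

context straight_projective_metric_space
begin

lemma line_dom_mem: "t \<in> line_dom x v \<longleftrightarrow> x + t *\<^sub>R v \<in> M"
  by (simp add: line_dom_def)

lemma chart_surj:
  assumes "line_chart x v \<phi>"
  obtains t where "t \<in> line_dom x v" "\<phi> t = r"
proof -
  have "r \<in> \<phi> ` line_dom x v" using line_chartD(3)[OF assms] by simp
  then show thesis using that by (auto elim!: imageE)
qed

lemma line_segment_param:
  fixes x v :: "'a::real_vector"
  assumes "r \<le> s" "s \<le> t"
  shows "x + s *\<^sub>R v \<in> closed_segment (x + r *\<^sub>R v) (x + t *\<^sub>R v)"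
proof (cases "r = t")
  case False
  define w where "w = (s - r) / (t - r)"
  have w: "0 \<le> w" "w \<le> 1" using assms False by (auto simp: w_def)
  have "w * (t - r) = s - r" using False by (simp add: w_def)
  then have s: "s = (1 - w) * r + w * t" by (simp add: algebra_simps)
  have "(1 - w) *\<^sub>R (x + r *\<^sub>R v) + w *\<^sub>R (x + t *\<^sub>R v) = x + ((1 - w) * r + w * t) *\<^sub>R v"
    by (simp add: algebra_simps)
  then have "x + s *\<^sub>R v = (1 - w) *\<^sub>R (x + r *\<^sub>R v) + w *\<^sub>R (x + t *\<^sub>R v)" unfolding s by (rule sym)
  then show ?thesis unfolding in_segment using w by blast
next
  case True
  then have "s = r" using assms by simp
  then show ?thesis using True by simp
qed

lemma chart_reflect:
  assumes "line_chart x v \<phi>" "s \<in> line_dom x v" "t \<in> line_dom x v"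
  obtains w where "w \<in> line_dom x v" "reflect (x + s *\<^sub>R v) (x + t *\<^sub>R v) = x + w *\<^sub>R v" "\<phi> w = 2 * \<phi> s - \<phi> t"
proof -
  note \<phi> = line_chartD[OF assms(1)]
  obtain w where w: "w \<in> line_dom x v" "\<phi> w = 2 * \<phi> s - \<phi> t" by (rule chart_surj[OF assms(1)])
  have "x + s *\<^sub>R v \<in> closed_segment (x + t *\<^sub>R v) (x + w *\<^sub>R v)"
  proof (cases "t \<le> s")
    case True
    have "\<phi> t \<le> \<phi> s" using strict_mono_on_leD[OF \<phi>(2) assms(3,2) True] .
    then have "\<phi> s \<le> \<phi> w" using w by linarith
    then have "s \<le> w" using strict_mono_onD[OF \<phi>(2) w(1) assms(2)] by (meson not_less)
    then show ?thesis using True by (intro line_segment_param)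
  next
    case False
    then have "\<phi> s \<le> \<phi> t" using strict_mono_on_leD[OF \<phi>(2) assms(2,3)] by simp
    then have "\<phi> w \<le> \<phi> s" using w by linarith
    then have "w \<le> s" using strict_mono_onD[OF \<phi>(2) assms(2) w(1)] by (meson not_less)
    then have "x + s *\<^sub>R v \<in> closed_segment (x + w *\<^sub>R v) (x + t *\<^sub>R v)" using False by (intro line_segment_param) auto
    then show ?thesis by (simp add: closed_segment_commute)
  qed
  moreover have "d (x + s *\<^sub>R v) (x + w *\<^sub>R v) = d (x + s *\<^sub>R v) (x + t *\<^sub>R v)"
    using \<phi>(5)[OF assms(2) w(1)] \<phi>(5)[OF assms(2,3)] w(2) by simp
  ultimately have "reflect (x + s *\<^sub>R v) (x + t *\<^sub>R v) = x + w *\<^sub>R v"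
    using assms(2,3) w(1) by (intro reflect_eqI) (auto simp: line_dom_mem)
  then show thesis using that w by blast
qed

text \<open>The isometry equation passes to the limit by \<open>reflect_tendsto\<close>. That lemma
  excludes the center itself, where the equation is just the preservation of distances to
  \<open>p\<close>.\<close>

lemma center_closed:
  assumes "p \<in> M" "\<And>e. e > 0 \<Longrightarrow> \<exists>c. center M d c \<and> dist c p < e"
  shows "center M d p"
proof -
  have "\<exists>c. center M d c \<and> dist c p < inverse (real (Suc k))" for k by (rule assms(2)) simp
  then obtain c where c: "\<And>k. center M d (c k)" "\<And>k. dist (c k) p < inverse (real (Suc k))" by metis
  have lim: "c \<longlonglongrightarrow> p"
  proof (rule metric_LIMSEQ_I)
    fix e :: real assume "e > 0"
    then obtain n where n: "inverse (real (Suc n)) < e" using reals_Archimedean by blast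
    have "dist (c m) p < e" if "m \<ge> n" for m
    proof -
      have "inverse (real (Suc m)) \<le> inverse (real (Suc n))" using that by (simp add: le_imp_inverse_le)
      then show ?thesis using c(2)[of m] n by linarith
    qed
    then show "\<exists>no. \<forall>m\<ge>no. dist (c m) p < e" by blast
  qed
  have cM: "eventually (\<lambda>k. c k \<in> M) sequentially" using c(1) centerD(1) by simp
  have "self_isometry (reflect p)"
  proof (rule reflect_isometryI[OF assms(1)])
    fix x y assume xy: "x \<in> M" "y \<in> M"
    show "d (reflect p x) (reflect p y) = d x y"
    proof (cases "x = p \<or> y = p")
      case True
      then show ?thesis using xy reflect_dist[OF assms(1)] reflect_self[OF assms(1)] commute by metis
    next
      case False
      have "(\<lambda>k. d (reflect (c k) x) (reflect (c k) y)) \<longlonglongrightarrow> d (reflect p x) (reflect p y)"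
        using False xy assms(1) by (intro tendsto_d reflect_tendsto lim cM reflect_in) auto
      moreover have "(\<lambda>k. d (reflect (c k) x) (reflect (c k) y)) = (\<lambda>k. d x y)"
        using center_dist[OF c(1) xy] by (intro ext)
      ultimately show ?thesis using LIMSEQ_unique tendsto_const by metis
    qed
  qed
  then show ?thesis using assms(1) by (simp add: center_iff)
qed

lemma center_chord:
  assumes "center M d p" "center M d x" "center M d y" "collinear {p, x, y}" "x \<noteq> p"
    and irr: "d p x / d p y \<notin> \<rat>" and t: "p + t *\<^sub>R (x - p) \<in> M"
  shows "center M d (p + t *\<^sub>R (x - p))"
proof -
  let ?v = "x - p"
  have pM: "p \<in> M" "x \<in> M" "y \<in> M" using assms centerD by auto
  obtain u where u: "y = p + u *\<^sub>R ?v" by (rule collinear_param[OF assms(4,5)])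
  obtain \<phi> where ch: "line_chart p ?v \<phi>" using line_chart_exists[of p ?v] pM assms(5) by auto
  note \<phi> = line_chartD[OF ch]
  have dom: "0 \<in> line_dom p ?v" "1 \<in> line_dom p ?v" "u \<in> line_dom p ?v" "t \<in> line_dom p ?v"
    using pM u t by (auto simp: line_dom_mem)
  \<comment> \<open>Chart coordinates of the centers on the line; closure of the centers under
    reflection in one another becomes closure under \<open>2 * r - s\<close>.\<close>
  define Z where "Z = \<phi> ` {s \<in> line_dom p ?v. center M d (p + s *\<^sub>R ?v)}"
  have Z: "0 \<in> Z" "\<phi> 1 \<in> Z" "\<phi> u \<in> Z"
  proof -
    show "0 \<in> Z" unfolding Z_def using dom assms(1) \<phi>(1) by (intro image_eqI[of _ _ 0]) auto
    show "\<phi> 1 \<in> Z" "\<phi> u \<in> Z" unfolding Z_def using dom assms(2,3) u by auto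
  qed
  have cl: "2 * r - s \<in> Z" if rs: "r \<in> Z" "s \<in> Z" for r s
  proof -
    obtain a where a: "r = \<phi> a" "a \<in> line_dom p ?v" "center M d (p + a *\<^sub>R ?v)" using rs(1) unfolding Z_def by blast
    obtain b where b: "s = \<phi> b" "b \<in> line_dom p ?v" "center M d (p + b *\<^sub>R ?v)" using rs(2) unfolding Z_def by blast
    obtain w where w: "w \<in> line_dom p ?v" "reflect (p + a *\<^sub>R ?v) (p + b *\<^sub>R ?v) = p + w *\<^sub>R ?v" "\<phi> w = 2 * \<phi> a - \<phi> b"
      by (rule chart_reflect[OF ch a(2) b(2)])
    have "center M d (p + w *\<^sub>R ?v)" using center_reflect[OF a(3) b(3)] w(2) by simp
    then show ?thesis unfolding Z_def using w a b by (intro image_eqI[of _ _ w]) auto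
  qed
  have irr': "\<phi> 1 / \<phi> u \<notin> \<rat>"
  proof
    assume "\<phi> 1 / \<phi> u \<in> \<rat>"
    moreover have "d p x = \<bar>\<phi> 1\<bar>" "d p y = \<bar>\<phi> u\<bar>"
      using \<phi>(5)[OF dom(1,2)] \<phi>(5)[OF dom(1,3)] \<phi>(1) u by simp_all
    ultimately have "d p x / d p y \<in> \<rat>" by (simp flip: abs_divide)
    then show False using irr by simp
  qed
  show ?thesis
  proof (rule center_closed[OF t])
    fix e :: real assume e: "e > 0"
    obtain e0 where e0: "e0 > 0" "ball t e0 \<subseteq> line_dom p ?v" using open_line_dom dom(4) open_contains_ball by blast
    define \<delta> where "\<delta> = min (e0 / 2) (e / (2 * norm ?v))"
    have \<delta>: "\<delta> > 0" "\<delta> < e0" "\<delta> * norm ?v < e"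
    proof -
      have n: "norm ?v > 0" using assms(5) by simp
      show "\<delta> > 0" "\<delta> < e0" using e0 e n by (auto simp: \<delta>_def min_def)
      have "\<delta> * norm ?v \<le> e / (2 * norm ?v) * norm ?v" by (intro mult_right_mono) (auto simp: \<delta>_def)
      also have "\<dots> = e / 2" using n by simp
      finally show "\<delta> * norm ?v < e" using e by simp
    qed
    have d2: "t - \<delta> \<in> line_dom p ?v" "t + \<delta> \<in> line_dom p ?v"
      using \<delta> by (auto intro!: subsetD[OF e0(2)] simp: dist_real_def)
    have lt: "\<phi> (t - \<delta>) < \<phi> t" "\<phi> t < \<phi> (t + \<delta>)"
      using strict_mono_onD[OF \<phi>(2) d2(1) dom(4)] strict_mono_onD[OF \<phi>(2) dom(4) d2(2)] \<delta>(1) by auto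
    \<comment> \<open>As the chart is increasing, a coordinate between those of
      \<open>t - \<delta>\<close> and \<open>t + \<delta>\<close> belongs to a parameter within
      \<delta> of \<open>t\<close>.\<close>
    obtain z where z: "z \<in> Z" "\<bar>z - \<phi> t\<bar> < min (\<phi> t - \<phi> (t - \<delta>)) (\<phi> (t + \<delta>) - \<phi> t)"
      using reflection_closed_dense[OF Z cl irr', of "min (\<phi> t - \<phi> (t - \<delta>)) (\<phi> (t + \<delta>) - \<phi> t)" "\<phi> t"] lt by auto
    obtain s where s: "z = \<phi> s" "s \<in> line_dom p ?v" "center M d (p + s *\<^sub>R ?v)" using z(1) unfolding Z_def by blast
    have "\<phi> (t - \<delta>) < \<phi> s" "\<phi> s < \<phi> (t + \<delta>)" using z(2) s(1) by linarith+
    then have "t - \<delta> < s" "s < t + \<delta>"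
      using strict_mono_on_leD[OF \<phi>(2) s(2) d2(1)] strict_mono_on_leD[OF \<phi>(2) d2(2) s(2)] by (meson not_less)+
    then have "\<bar>s - t\<bar> * norm ?v \<le> \<delta> * norm ?v" by (intro mult_right_mono) auto
    moreover have "dist (p + s *\<^sub>R ?v) (p + t *\<^sub>R ?v) = \<bar>s - t\<bar> * norm ?v"
      by (simp add: dist_norm flip: scaleR_diff_left)
    ultimately have "dist (p + s *\<^sub>R ?v) (p + t *\<^sub>R ?v) < e" using \<delta>(3) by linarith
    then show "\<exists>c. center M d c \<and> dist c (p + t *\<^sub>R ?v) < e" using s(3) by blast
  qed
qed

text \<open>On a small Euclidean sphere about \<open>x\<close> the distance from \<open>x\<close>
  has a positive minimum, and a point on or beyond the sphere is at least that far away because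
  distances add along the ray.\<close>

lemma near_if_d_small:
  assumes "x \<in> M" "r > 0"
  shows "\<exists>m>0. \<forall>y\<in>M. d x y < m \<longrightarrow> dist x y < r"
proof -
  obtain e where e: "e > 0" "cball x e \<subseteq> M" using open_carrier assms(1) open_contains_cball by blast
  define q where "q = min e r"
  have q: "q > 0" "q \<le> r" "cball x q \<subseteq> M" using e assms by (auto simp: q_def)
  have sM: "sphere x q \<subseteq> M" using q(3) by (auto simp: subset_iff)
  have "continuous_on (sphere x q) (\<lambda>y. d x y)"
    using sM assms(1) by (intro continuous_on_d continuous_intros) auto
  moreover have "sphere x q \<noteq> {}" using q(1) by simp
  ultimately obtain z where z: "z \<in> sphere x q" "\<And>y. y \<in> sphere x q \<Longrightarrow> d x z \<le> d x y"
    using continuous_attains_inf[OF compact_sphere] by metis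
  have "z \<noteq> x" using z(1) q(1) by auto
  then have pos: "d x z > 0" using z(1) sM assms(1) by (intro d_pos) auto
  have "dist x y < r" if y: "y \<in> M" "d x y < d x z" for y
  proof (rule ccontr)
    assume "\<not> dist x y < r"
    then have far: "norm (y - x) \<ge> q" using q by (simp add: dist_norm norm_minus_commute)
    then have n: "norm (y - x) > 0" using q by linarith
    define s where "s = q / norm (y - x)"
    have s: "0 \<le> s" "s \<le> 1" using far n q by (auto simp: s_def)
    have yy: "y = x + 1 *\<^sub>R (y - x)" by simp
    have "d x (x + s *\<^sub>R (y - x)) + d (x + s *\<^sub>R (y - x)) (x + 1 *\<^sub>R (y - x)) = d x (x + 1 *\<^sub>R (y - x))"
      using y s by (intro ray_add(1)[OF assms(1)]) simp_all
    moreover have "x + s *\<^sub>R (y - x) \<in> sphere x q" using n q by (simp add: dist_norm s_def)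
    ultimately have "d x z \<le> d x y" using z(2)[of "x + s *\<^sub>R (y - x)"] nonneg[of "x + s *\<^sub>R (y - x)" y] unfolding yy[symmetric] by linarith
    then show False using y by simp
  qed
  then show ?thesis using pos by blast
qed

lemma isometry_funpow: "self_isometry \<tau> \<Longrightarrow> self_isometry (\<tau> ^^ k)"
proof (induction k)
  case 0 then show ?case by (simp add: isometry_between_def bij_betw_def)
next
  case (Suc k) then show ?case using isometry_comp[of \<tau> "\<tau> ^^ k"] by (simp add: o_def)
qed

lemma isometryD:
  assumes "self_isometry \<tau>"
  shows "x \<in> M \<Longrightarrow> \<tau> x \<in> M" "x \<in> M \<Longrightarrow> y \<in> M \<Longrightarrow> d (\<tau> x) (\<tau> y) = d x y"
proof -
  note * = assms[unfolded isometry_between_def]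
  show "\<tau> x \<in> M" if "x \<in> M" by (rule bij_betw_apply[OF conjunct1[OF *] that])
  show "d (\<tau> x) (\<tau> y) = d x y" if "x \<in> M" "y \<in> M" using conjunct2[OF *] that by (elim ballE) auto
qed

text \<open>In the triangle \<open>x\<close>, \<open>reflect m x\<close>, \<open>reflect n x\<close>
  the points \<open>m\<close> and \<open>n\<close> are midpoints of two sides. The composite \<tau>
  of the two reflections translates the line through \<open>m\<close> and \<open>n\<close> by
  \<open>2 * d m n\<close> and carries \<open>reflect m x\<close> to \<open>reflect n x\<close>.
  Under \<open>k\<close> iterations \<open>m\<close> moves exactly \<open>2 k d m n\<close> and
  \<open>reflect m x\<close> at most \<open>k\<close> times the third side, while the two
  displacements differ by a bounded amount; let \<open>k\<close> grow.\<close>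

lemma d_midpoints_le:
  assumes "center M d m" "center M d n" "x \<in> M"
  shows "2 * d m n \<le> d (reflect m x) (reflect n x)"
proof (cases "m = n")
  case False
  have M: "m \<in> M" "n \<in> M" using assms centerD by auto
  let ?v = "n - m"
  define \<tau> where "\<tau> = reflect n \<circ> reflect m"
  define A where "A = reflect m x"
  have A: "A \<in> M" unfolding A_def using M assms(3) by (intro reflect_in)
  have \<tau>A: "\<tau> A = reflect n x" using M assms(3) by (simp add: \<tau>_def A_def)
  have \<tau>: "self_isometry \<tau>" unfolding \<tau>_def using assms by (intro isometry_comp centerD)
  obtain \<phi> where ch: "line_chart m ?v \<phi>" using line_chart_exists[of m ?v] M False by auto
  note \<phi> = line_chartD[OF ch]
  have dom: "0 \<in> line_dom m ?v" "1 \<in> line_dom m ?v" using M by (auto simp: line_dom_mem)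
  have "\<phi> 0 < \<phi> 1" using strict_mono_onD[OF \<phi>(2) dom] by simp
  then have \<phi>1: "\<phi> 1 = d m n" using \<phi>(5)[OF dom] \<phi>(1) by simp
  have step: "\<exists>w\<in>line_dom m ?v. \<tau> (m + t *\<^sub>R ?v) = m + w *\<^sub>R ?v \<and> \<phi> w = \<phi> t + 2 * d m n" if t: "t \<in> line_dom m ?v" for t
  proof -
    obtain w where w: "w \<in> line_dom m ?v" "reflect (m + 0 *\<^sub>R ?v) (m + t *\<^sub>R ?v) = m + w *\<^sub>R ?v" "\<phi> w = 2 * \<phi> 0 - \<phi> t"
      by (rule chart_reflect[OF ch dom(1) t])
    obtain w' where w': "w' \<in> line_dom m ?v" "reflect (m + 1 *\<^sub>R ?v) (m + w *\<^sub>R ?v) = m + w' *\<^sub>R ?v" "\<phi> w' = 2 * \<phi> 1 - \<phi> w"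
      by (rule chart_reflect[OF ch dom(2) w(1)])
    have "\<tau> (m + t *\<^sub>R ?v) = m + w' *\<^sub>R ?v" using w(2) w'(2) by (simp add: \<tau>_def)
    moreover have "\<phi> w' = \<phi> t + 2 * d m n" using w(3) w'(3) \<phi>(1) \<phi>1 by simp
    ultimately show ?thesis using w'(1) by blast
  qed
  have "\<exists>w\<in>line_dom m ?v. (\<tau> ^^ k) m = m + w *\<^sub>R ?v \<and> \<phi> w = real k * (2 * d m n)" for k
  proof (induction k)
    case 0 show ?case using dom \<phi>(1) by (intro bexI[of _ 0]) auto
  next
    case (Suc k)
    then obtain w where w: "w \<in> line_dom m ?v" "(\<tau> ^^ k) m = m + w *\<^sub>R ?v" "\<phi> w = real k * (2 * d m n)" by blast
    obtain w' where "w' \<in> line_dom m ?v" "\<tau> (m + w *\<^sub>R ?v) = m + w' *\<^sub>R ?v" "\<phi> w' = \<phi> w + 2 * d m n"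
      using step[OF w(1)] by blast
    then have "w' \<in> line_dom m ?v" "(\<tau> ^^ Suc k) m = m + w' *\<^sub>R ?v" "\<phi> w' = real (Suc k) * (2 * d m n)"
      using w by (simp_all add: distrib_right)
    then show ?case by blast
  qed
  then have far: "d m ((\<tau> ^^ k) m) = real k * (2 * d m n)" for k
  proof -
    obtain w where w: "w \<in> line_dom m ?v" "(\<tau> ^^ k) m = m + w *\<^sub>R ?v" "\<phi> w = real k * (2 * d m n)"
      using \<open>\<exists>w\<in>line_dom m ?v. (\<tau> ^^ k) m = m + w *\<^sub>R ?v \<and> \<phi> w = real k * (2 * d m n)\<close> by blast
    have "0 \<le> real k * (2 * d m n)" using nonneg[of m n] by simp
    then show ?thesis using \<phi>(5)[OF dom(1) w(1)] w(2,3) \<phi>(1) by simp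
  qed
  have TM: "(\<tau> ^^ k) y \<in> M" if "y \<in> M" for k y using isometryD(1)[OF isometry_funpow[OF \<tau>] that] .
  have dk: "d A ((\<tau> ^^ k) A) \<le> real k * d A (\<tau> A)" for k
  proof (induction k)
    case 0 then show ?case using A by simp
  next
    case (Suc k)
    have "d A ((\<tau> ^^ Suc k) A) \<le> d A (\<tau> A) + d (\<tau> A) (\<tau> ((\<tau> ^^ k) A))"
      using triangle[OF A isometryD(1)[OF \<tau> A] TM[OF A, of "Suc k"]] by simp
    also have "d (\<tau> A) (\<tau> ((\<tau> ^^ k) A)) = d A ((\<tau> ^^ k) A)" using isometryD(2)[OF \<tau> A TM[OF A]] .
    finally show ?case using Suc by (simp add: algebra_simps)
  qed
  have bd: "real k * (2 * d m n) \<le> 2 * d m A + real k * d A (\<tau> A)" for k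
  proof -
    have "d m ((\<tau> ^^ k) m) \<le> d m A + d A ((\<tau> ^^ k) m)" using triangle[OF M(1) A TM[OF M(1)]] .
    also have "d A ((\<tau> ^^ k) m) \<le> d A ((\<tau> ^^ k) A) + d ((\<tau> ^^ k) A) ((\<tau> ^^ k) m)"
      using triangle[OF A TM[OF A] TM[OF M(1)]] .
    also have "d ((\<tau> ^^ k) A) ((\<tau> ^^ k) m) = d m A"
      using isometryD(2)[OF isometry_funpow[OF \<tau>] A M(1)] commute by simp
    finally show ?thesis using far[of k] dk[of k] by simp
  qed
  have "2 * d m n \<le> d A (\<tau> A)"
  proof (rule ccontr)
    assume "\<not> 2 * d m n \<le> d A (\<tau> A)"
    then have "2 * d m n - d A (\<tau> A) > 0" by simp
    then obtain k where "2 * d m A < real k * (2 * d m n - d A (\<tau> A))" using ex_less_of_nat_mult by blast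
    then show False using bd[of k] by (simp add: algebra_simps)
  qed
  then show ?thesis by (simp add: A_def[symmetric] \<tau>A)
qed (use assms centerD in \<open>auto simp: reflect_in\<close>)

lemma metric_midpoint:
  assumes "x \<in> M" "y \<in> M"
  obtains m where "m \<in> M" "m \<in> closed_segment x y" "reflect m x = y"
proof (cases "x = y")
  case True then show thesis using that[of x] assms by simp
next
  case False
  let ?v = "y - x"
  obtain \<phi> where ch: "line_chart x ?v \<phi>" using line_chart_exists[of x ?v] assms False by auto
  note \<phi> = line_chartD[OF ch]
  have dom: "0 \<in> line_dom x ?v" "1 \<in> line_dom x ?v" using assms by (auto simp: line_dom_mem)
  obtain t where t: "t \<in> line_dom x ?v" "\<phi> t = \<phi> 1 / 2" by (rule chart_surj[OF ch])
  have "\<phi> 0 < \<phi> 1" using strict_mono_onD[OF \<phi>(2) dom] by simp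
  then have "\<phi> 0 < \<phi> t" "\<phi> t < \<phi> 1" using t \<phi>(1) by simp_all
  then have "0 < t" "t < 1"
    using strict_mono_on_leD[OF \<phi>(2) t(1) dom(1)] strict_mono_on_leD[OF \<phi>(2) dom(2) t(1)] by (meson not_less)+
  then have seg: "x + t *\<^sub>R ?v \<in> closed_segment x y"
    using line_segment_param[of 0 t 1 x ?v] by simp
  obtain w where w: "w \<in> line_dom x ?v" "reflect (x + t *\<^sub>R ?v) (x + 0 *\<^sub>R ?v) = x + w *\<^sub>R ?v" "\<phi> w = 2 * \<phi> t - \<phi> 0"
    by (rule chart_reflect[OF ch t(1) dom(1)])
  have "\<phi> w = \<phi> 1" using w(3) t(2) \<phi>(1) by simp
  then have "w = 1" using strict_mono_on_eqD[OF \<phi>(2)] w(1) dom(2) by metis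
  then show thesis using that[of "x + t *\<^sub>R ?v"] seg w(2) t(1) by (simp add: line_dom_mem)
qed

end

section \<open>Spaces with a pencil of centers\<close>

context straight_projective_metric_space
begin

text \<open>If the translates of \<open>y\<close> along the line stayed on the other side of the flat \<open>a = 0\<close> than the
  translates of \<open>p\<close>, the line would stay within a fixed distance of the flat; halving that distance
  repeatedly would put a point of the line off \<open>p\<close> into the flat.\<close>

lemma translates_escape:
  assumes p: "p \<in> M" and y: "y \<in> M"
    and W: "subspace W" "\<And>w. w \<in> W \<Longrightarrow> a \<bullet> w = 0" and av: "a \<bullet> v = 1"
    and flat: "\<And>x. x \<in> M \<Longrightarrow> x - p \<in> W \<Longrightarrow> center M d x"
    and line: "\<And>t. p + t *\<^sub>R v \<in> M \<Longrightarrow> center M d (p + t *\<^sub>R v)"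
    and yF: "y - p - k *\<^sub>R v \<in> W"
  shows "\<exists>u\<in>line_dom p v. 0 \<le> a \<bullet> (reflect (p + u *\<^sub>R v) y - p)"
proof (rule ccontr)
  assume neg: "\<not> ?thesis"
  have v0: "v \<noteq> 0" using av by auto
  obtain \<phi> where ch: "line_chart p v \<phi>" using line_chart_exists[OF p v0] by blast
  note \<phi> = line_chartD[OF ch]
  have zdom: "0 \<in> line_dom p v" using p by (simp add: line_dom_mem)
  have "\<forall>r. \<exists>t. t \<in> line_dom p v \<and> \<phi> t = r" using chart_surj[OF ch] by metis
  then obtain T where T: "\<And>r. T r \<in> line_dom p v" "\<And>r. \<phi> (T r) = r" by metis
  have T0: "T 0 = 0" using strict_mono_on_eqD[OF \<phi>(2), of "T 0" 0] T zdom \<phi>(1) by simp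
  define A where "A r = p + T r *\<^sub>R v" for r
  have AM: "A r \<in> M" for r using T(1) by (simp add: A_def line_dom_mem)
  have A0: "A 0 = p" by (simp add: A_def T0)
  have RA: "reflect (A r) (A s) = A (2 * r - s)" for r s
  proof -
    obtain w where w: "w \<in> line_dom p v" "reflect (p + T r *\<^sub>R v) (p + T s *\<^sub>R v) = p + w *\<^sub>R v" "\<phi> w = 2 * \<phi> (T r) - \<phi> (T s)"
      by (rule chart_reflect[OF ch T(1) T(1)])
    have "w = T (2 * r - s)" using strict_mono_on_eqD[OF \<phi>(2), of w "T (2 * r - s)"] w T by simp
    then show ?thesis using w(2) by (simp add: A_def)
  qed
  have Acenter: "center M d (A r)" for r using line AM by (simp add: A_def)
  have Tpos: "T r > 0" if "r > 0" for r
  proof (rule ccontr)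
    assume "\<not> 0 < T r"
    then have "\<phi> (T r) \<le> \<phi> 0" by (intro strict_mono_on_leD[OF \<phi>(2) T(1) zdom]) simp
    then show False using T(2)[of r] \<phi>(1) that by simp
  qed
  let ?c = "d p y"
  \<comment> \<open>The reflection in \<open>A (r/2)\<close> takes \<open>p\<close> to
    \<open>A r\<close> and \<open>y\<close> to \<open>Y\<close>, which by assumption lies on the
    other side of the flat than \<open>A r\<close>. The segment between them has length
    \<open>d p y\<close> and crosses the flat in \<open>z\<close>.\<close>
  have base: "\<exists>z\<in>M. z - p \<in> W \<and> d (A r) z \<le> ?c" if r: "r > 0" for r
  proof -
    define Y where "Y = reflect (A (r/2)) y"
    have YM: "Y \<in> M" unfolding Y_def by (intro reflect_in AM y)
    have Yneg: "a \<bullet> (Y - p) < 0" using neg T(1) unfolding Y_def A_def by (meson not_le)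
    have dY: "d (A r) Y = ?c"
      using center_dist[OF Acenter p y, of "r/2"] RA[of "r/2" 0] A0 by (simp add: Y_def)
    have YF: "\<exists>k. Y - p - k *\<^sub>R v \<in> W"
    proof (cases "y = A (r/2)")
      case True
      then have "Y = y" using AM by (simp add: Y_def)
      then show ?thesis using yF by blast
    next
      case False
      obtain \<tau> where "Y = A (r/2) - \<tau> *\<^sub>R (y - A (r/2))"
        unfolding Y_def by (rule reflect_param[OF AM y False])
      then have "Y - p - (T (r/2) - \<tau> * k + \<tau> * T (r/2)) *\<^sub>R v = (- \<tau>) *\<^sub>R (y - p - k *\<^sub>R v)"
        by (simp add: A_def algebra_simps)
      then show ?thesis using yF W(1) subspace_scale by metis
    qed
    then obtain k' where k': "Y - p - k' *\<^sub>R v \<in> W" by blast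
    have k'neg: "k' < 0" using W(2)[OF k'] Yneg av by (simp add: inner_diff_right)
    define w where "w = T r / (T r - k')"
    have w: "0 \<le> w" "w \<le> 1" using Tpos[OF r] k'neg by (auto simp: w_def)
    have w2: "(1 - w) * T r + w * k' = 0" using Tpos[OF r] k'neg by (simp add: w_def field_simps)
    define z where "z = (1 - w) *\<^sub>R A r + w *\<^sub>R Y"
    have zs: "z \<in> closed_segment (A r) Y" unfolding in_segment z_def using w by blast
    then have zM: "z \<in> M" using segment_subset[OF AM YM] by blast
    have "z - p = w *\<^sub>R (Y - p - k' *\<^sub>R v) + ((1 - w) * T r + w * k') *\<^sub>R v"
      by (simp add: z_def A_def algebra_simps)
    then have "z - p \<in> W" using w2 k' W(1) by (simp add: subspace_scale)
    moreover have "d (A r) z \<le> ?c"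
      using between_add[OF AM YM zs] nonneg[of z Y] dY by linarith
    ultimately show ?thesis using zM by blast
  qed
  \<comment> \<open>\<open>A r\<close> is the midpoint of \<open>p\<close> and
    \<open>A (2 * r)\<close>, and the midpoint \<open>m\<close> of \<open>p\<close> and
    \<open>z\<close> stays in the flat, so \<open>d_midpoints_le\<close> halves the bound known for
    \<open>2 * r\<close>.\<close>
  have "\<forall>r>0. \<exists>z\<in>M. z - p \<in> W \<and> d (A r) z \<le> ?c / 2 ^ n" for n
  proof (induction n)
    case 0 then show ?case using base by simp
  next
    case (Suc n)
    show ?case
    proof (intro allI impI)
      fix r :: real assume r: "r > 0"
      then obtain z where z: "z \<in> M" "z - p \<in> W" "d (A (2 * r)) z \<le> ?c / 2 ^ n"
        using Suc.IH[rule_format, of "2 * r"] by auto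
      obtain m where m: "m \<in> M" "m \<in> closed_segment p z" "reflect m p = z"
        by (rule metric_midpoint[OF p z(1)])
      obtain u where u: "m = (1 - u) *\<^sub>R p + u *\<^sub>R z" using m(2) unfolding in_segment by blast
      have "m - p = u *\<^sub>R (z - p)" unfolding u by (simp add: algebra_simps)
      then have mW: "m - p \<in> W" using z(2) W(1) by (simp add: subspace_scale)
      have "2 * d (A r) m \<le> d (reflect (A r) p) (reflect m p)"
        using d_midpoints_le[OF Acenter flat[OF m(1) mW] p] .
      then have "2 * d (A r) m \<le> d (A (2 * r)) z" using RA[of r 0] A0 m(3) by simp
      then have "2 * d (A r) m \<le> ?c / 2 ^ n" using z(3) by (rule order_trans)
      then have "d (A r) m \<le> (?c / 2 ^ n) / 2" by (simp only: le_divide_eq_numeral1 mult.commute)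
      also have "(?c / 2 ^ n) / 2 = ?c / 2 ^ Suc n" by simp
      finally have "d (A r) m \<le> ?c / 2 ^ Suc n" .
      then show "\<exists>z\<in>M. z - p \<in> W \<and> d (A r) z \<le> ?c / 2 ^ Suc n" using m(1) mW by blast
    qed
  qed
  then have small: "\<exists>z\<in>M. z - p \<in> W \<and> d (A 1) z \<le> ?c / 2 ^ n" for n by simp
  \<comment> \<open>The Euclidean distance of \<open>A 1\<close> from the hyperplane through
    \<open>p\<close> with normal \<open>a\<close>, which contains the flat.\<close>
  define \<rho> where "\<rho> = T 1 / norm a"
  have a0: "norm a > 0" using av by auto
  have "\<rho> > 0" using Tpos[of 1] a0 by (simp add: \<rho>_def)
  obtain m where m: "m > 0" "\<And>z. z \<in> M \<Longrightarrow> d (A 1) z < m \<Longrightarrow> dist (A 1) z < \<rho>"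
    using near_if_d_small[OF AM[of 1] \<open>\<rho> > 0\<close>] by blast
  obtain n :: nat where n: "?c / 2 ^ n < m"
  proof -
    obtain n where "?c / m < 2 ^ n" using real_arch_pow[of 2 "?c / m"] by auto
    then have "?c < m * 2 ^ n" using m(1) by (simp add: pos_divide_less_eq mult.commute)
    then have "?c / 2 ^ n < m" by (simp add: pos_divide_less_eq)
    then show thesis by (rule that)
  qed
  obtain z where z: "z \<in> M" "z - p \<in> W" "d (A 1) z \<le> ?c / 2 ^ n" using small by blast
  have "dist (A 1) z < \<rho>" using z(3) n by (intro m(2)[OF z(1)]) (rule le_less_trans)
  moreover have "T 1 = a \<bullet> (A 1 - z)"
  proof -
    have "A 1 - z = T 1 *\<^sub>R v - (z - p)" by (simp add: A_def)
    then have "a \<bullet> (A 1 - z) = T 1 * (a \<bullet> v) - a \<bullet> (z - p)" by (simp only: inner_diff_right inner_scaleR_right)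
    then show ?thesis using W(2)[OF z(2)] av by simp
  qed
  moreover have "a \<bullet> (A 1 - z) \<le> norm a * norm (A 1 - z)" by (rule norm_cauchy_schwarz)
  ultimately show False using a0 by (simp add: \<rho>_def dist_norm field_simps)
qed

text \<open>With \<open>y = reflect p x\<close>, it is enough to find \<open>q\<close> on the line
  such that \<open>reflect q y\<close> is in the flat: reflecting this center in \<open>q\<close>
  and then in \<open>p\<close> gives \<open>x\<close>. The height of \<open>reflect q y\<close> over
  the flat is continuous in \<open>q\<close> and, by \<open>translates_escape\<close> in both
  directions of the line, somewhere nonnegative and somewhere nonpositive. If \<open>y\<close> is on
  the line, it is a center anyway.\<close>

lemma centers_flat_extend:
  assumes p: "p \<in> M" and W: "subspace W" and vW: "v \<notin> W"
    and flat: "\<And>x. x \<in> M \<Longrightarrow> x - p \<in> W \<Longrightarrow> center M d x"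
    and line: "\<And>t. p + t *\<^sub>R v \<in> M \<Longrightarrow> center M d (p + t *\<^sub>R v)"
    and x: "x \<in> M" and xF: "x - p - k *\<^sub>R v \<in> W"
  shows "center M d x"
proof -
  have cp: "center M d p" using flat[OF p] W by (simp add: subspace_0)
  \<comment> \<open>The component of \<open>v\<close> orthogonal to \<open>W\<close>, scaled such
    that \<open>a\<close> reads off the coefficient of \<open>v\<close> modulo
    \<open>W\<close>.\<close>
  obtain a where a: "\<And>w. w \<in> W \<Longrightarrow> a \<bullet> w = 0" "a \<bullet> v = 1"
  proof -
    obtain w0 z where wz: "w0 \<in> span W" "\<And>w. w \<in> span W \<Longrightarrow> orthogonal z w" "v = w0 + z"
      using orthogonal_subspace_decomp_exists[of W v] by metis
    have sW: "span W = W" using W by (simp add: span_eq_iff)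
    have "z \<noteq> 0" using wz(1,3) vW sW by auto
    have "z \<bullet> v = z \<bullet> z" using wz(2)[OF wz(1)] unfolding wz(3) by (simp add: orthogonal_def inner_add_right)
    then show thesis using wz(2) sW \<open>z \<noteq> 0\<close>
      by (intro that[of "(1 / (z \<bullet> z)) *\<^sub>R z"]) (auto simp: orthogonal_def)
  qed
  define y where "y = reflect p x"
  have yM: "y \<in> M" unfolding y_def using p x by (rule reflect_in)
  have xy: "x = reflect p y" unfolding y_def using p x by simp
  show ?thesis
  proof (cases "\<exists>t. y = p + t *\<^sub>R v")
    case True
    then have "center M d y" using line yM by blast
    then show ?thesis unfolding xy by (intro center_reflect cp)
  next
    case False
    have yF: "\<exists>k. y - p - k *\<^sub>R v \<in> W"
    proof (cases "x = p")
      case True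
      then have "y = p + 0 *\<^sub>R v" using p by (simp add: y_def)
      then show ?thesis using False by blast
    next
      case xp: False
      obtain \<tau> where "y = p - \<tau> *\<^sub>R (x - p)" unfolding y_def by (rule reflect_param[OF p x xp])
      then have "y - p - (- \<tau> * k) *\<^sub>R v = (- \<tau>) *\<^sub>R (x - p - k *\<^sub>R v)" by (simp add: algebra_simps)
      then show ?thesis using xF W subspace_scale by metis
    qed
    then obtain k' where k': "y - p - k' *\<^sub>R v \<in> W" by blast
    let ?f = "\<lambda>u. a \<bullet> (reflect (p + u *\<^sub>R v) y - p)"
    have "\<exists>u\<in>line_dom p v. 0 \<le> ?f u"
      by (rule translates_escape[OF p yM W a flat line k'])
    then obtain u1 where u1: "u1 \<in> line_dom p v" "0 \<le> ?f u1" by blast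
    have "\<exists>u\<in>line_dom p (- v). 0 \<le> (- a) \<bullet> (reflect (p + u *\<^sub>R (- v)) y - p)"
    proof (rule translates_escape[OF p yM W])
      show "(- a) \<bullet> w = 0" if "w \<in> W" for w using a(1)[OF that] by simp
      show "(- a) \<bullet> (- v) = 1" using a(2) by simp
      show "center M d (p + t *\<^sub>R (- v))" if "p + t *\<^sub>R (- v) \<in> M" for t using line[of "- t"] that by simp
      show "y - p - (- k') *\<^sub>R (- v) \<in> W" using k' by simp
    qed (rule flat)
    then obtain u where "u \<in> line_dom p (- v)" "0 \<le> (- a) \<bullet> (reflect (p + u *\<^sub>R (- v)) y - p)" by blast
    then have u2: "- u \<in> line_dom p v" "?f (- u) \<le> 0" by (simp_all add: line_dom_mem)
    have cont: "continuous_on (line_dom p v) ?f"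
      unfolding continuous_on_def
    proof
      fix s assume s: "s \<in> line_dom p v"
      have "((\<lambda>u. reflect (p + u *\<^sub>R v) y) \<longlongrightarrow> reflect (p + s *\<^sub>R v) y) (at s within line_dom p v)"
      proof (rule reflect_tendsto[OF yM])
        show "p + s *\<^sub>R v \<in> M" using s by (simp add: line_dom_mem)
        show "y \<noteq> p + s *\<^sub>R v" using False by blast
        show "((\<lambda>u. p + u *\<^sub>R v) \<longlongrightarrow> p + s *\<^sub>R v) (at s within line_dom p v)" by (intro tendsto_intros)
        show "\<forall>\<^sub>F u in at s within line_dom p v. p + u *\<^sub>R v \<in> M"
          by (simp add: eventually_at_filter line_dom_mem)
      qed
      then show "(?f \<longlongrightarrow> ?f s) (at s within line_dom p v)" by (intro tendsto_intros)
    qed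
    have "is_interval (line_dom p v)" using convex_line_dom by (simp add: is_interval_convex_1)
    then have "connected (?f ` line_dom p v)"
      using cont by (intro connected_continuous_image) (auto simp: is_interval_connected)
    then have "is_interval (?f ` line_dom p v)" by (simp add: is_interval_connected_1)
    then have "0 \<in> ?f ` line_dom p v"
      using u1 u2 unfolding is_interval_1 by blast
    then obtain u where u: "u \<in> line_dom p v" "?f u = 0" by auto
    let ?q = "p + u *\<^sub>R v"
    have qM: "?q \<in> M" using u by (simp add: line_dom_mem)
    define z where "z = reflect ?q y"
    have zM: "z \<in> M" unfolding z_def using qM yM by (rule reflect_in)
    have "y \<noteq> ?q" using False by blast
    obtain \<tau> where "z = ?q - \<tau> *\<^sub>R (y - ?q)" unfolding z_def by (rule reflect_param[OF qM yM \<open>y \<noteq> ?q\<close>])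
    then have zk: "z - p - (u - \<tau> * k' + \<tau> * u) *\<^sub>R v = (- \<tau>) *\<^sub>R (y - p - k' *\<^sub>R v)" (is "z - p - ?k *\<^sub>R v = _")
      by (simp add: algebra_simps)
    then have zW: "z - p - ?k *\<^sub>R v \<in> W" using k' W subspace_scale by metis
    have "a \<bullet> (z - p) = ?k" using a(1)[OF zW] a(2) by (simp add: inner_diff_right)
    then have "?k = 0" using u(2) by (simp add: z_def)
    then have "z - p \<in> W" using zW by simp
    then have "center M d z" using flat zM by blast
    moreover have "y = reflect ?q z" unfolding z_def using qM yM by simp
    moreover have "center M d ?q" using line qM by blast
    ultimately have "center M d y" using center_reflect by simp
    then show ?thesis unfolding xy by (intro center_reflect cp)
  qed
qed

text \<open>Each line of the pencil consists of centers by \<open>center_chord\<close>; the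
  directions are added one at a time, and the flat of centers grows whenever the new direction is
  not in its span.\<close>

theorem all_centers_if_pencil:
  assumes pen: "pencil k p P Q" "pencil_dim k p P = CARD('n)"
    and c: "center M d p" "\<And>i. i \<in> {1..k} \<Longrightarrow> center M d (P i) \<and> center M d (Q i)"
    and irr: "\<And>i. i \<in> {1..k} \<Longrightarrow> d p (P i) / d p (Q i) \<notin> \<rat>"
    and x: "x \<in> M"
  shows "center M d x"
proof -
  have p: "p \<in> M" using c(1) by (rule centerD)
  have line: "center M d (p + t *\<^sub>R (P i - p))" if "i \<in> {1..k}" "p + t *\<^sub>R (P i - p) \<in> M" for i t
  proof (rule center_chord[OF c(1)])
    show "center M d (P i)" "center M d (Q i)" using c(2) that by auto
    show "collinear {p, P i, Q i}" "P i \<noteq> p" using pen(1) that unfolding pencil_def by auto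
  qed (use irr that in auto)
  have main: "\<forall>x\<in>M. x - p \<in> span ((\<lambda>i. P i - p) ` J) \<longrightarrow> center M d x" if "finite J" "J \<subseteq> {1..k}" for J
    using that
  proof (induction J rule: finite_induct)
    case empty then show ?case using c(1) by simp
  next
    case (insert i J)
    let ?v = "P i - p" and ?S = "(\<lambda>i. P i - p) ` J"
    have IH: "center M d x" if "x \<in> M" "x - p \<in> span ?S" for x using insert that by blast
    show ?case
    proof (intro ballI impI)
      fix x assume x: "x \<in> M" "x - p \<in> span ((\<lambda>i. P i - p) ` insert i J)"
      show "center M d x"
      proof (cases "?v \<in> span ?S")
        case True
        then show ?thesis using x IH by (simp add: span_redundant)
      next
        case False
        obtain t where "x - p - t *\<^sub>R ?v \<in> span ?S" using x(2) span_breakdown_eq[of "x - p" ?v ?S] by auto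
        then show ?thesis
          using line insert.prems by (intro centers_flat_extend[OF p subspace_span False IH _ x(1)]) auto
      qed
    qed
  qed
  have "dim (span ((\<lambda>i. P i - p) ` {1..k})) = DIM(real ^ 'n)" using pen(2) by (simp add: pencil_dim_def)
  then have "span ((\<lambda>i. P i - p) ` {1..k}) = UNIV" by (metis dim_eq_full span_span)
  then show ?thesis using main[of "{1..k}"] x by simp
qed

end

section \<open>Reflections are projective maps\<close>

text \<open>Dimension one is left out because a single line carries no incidence: there a reflection
  is conjugate to an affine one by a homeomorphism, which may be far from projective.\<close>

locale symmetric_projective_metric_space = straight_projective_metric_space M d
  for M :: "(real ^ 'n) set" and d +
  assumes all_centers: "x \<in> M \<Longrightarrow> center M d x"
    and nonempty: "M \<noteq> {}"
    and two_dim: "2 \<le> CARD('n)"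
begin

lemma reflect_dist_eq: "p \<in> M \<Longrightarrow> x \<in> M \<Longrightarrow> y \<in> M \<Longrightarrow> d (reflect p x) (reflect p y) = d x y"
  using center_dist[OF all_centers] .

lemma reflect_conj:
  "p \<in> M \<Longrightarrow> q \<in> M \<Longrightarrow> x \<in> M \<Longrightarrow> reflect (reflect p q) x = reflect p (reflect q (reflect p x))"
  using reflect_reflect_conj[OF all_centers] .

definition independent2 :: "real ^ 'n \<Rightarrow> real ^ 'n \<Rightarrow> bool" where
  "independent2 v w \<longleftrightarrow> (\<forall>\<alpha> \<beta>. \<alpha> *\<^sub>R v = \<beta> *\<^sub>R w \<longrightarrow> \<alpha> = 0 \<and> \<beta> = 0)"

lemma independent2D: "independent2 v w \<Longrightarrow> \<alpha> *\<^sub>R v = \<beta> *\<^sub>R w \<Longrightarrow> \<alpha> = 0 \<and> \<beta> = 0"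
  unfolding independent2_def by blast

lemma independent2_nonzero: "independent2 v w \<Longrightarrow> v \<noteq> 0" "independent2 v w \<Longrightarrow> w \<noteq> 0"
  using independent2D[of v w 1 0] independent2D[of v w 0 1] by auto

lemma independent2I:
  assumes "v \<noteq> 0" "\<And>c. w \<noteq> c *\<^sub>R v"
  shows "independent2 v w"
  unfolding independent2_def
proof (intro allI impI)
  fix \<alpha> \<beta> assume eq: "\<alpha> *\<^sub>R v = \<beta> *\<^sub>R w"
  have "\<beta> = 0"
  proof (rule ccontr)
    assume b: "\<beta> \<noteq> 0"
    have "w = (1 / \<beta>) *\<^sub>R \<beta> *\<^sub>R w" using b by simp
    also have "\<dots> = (\<alpha> / \<beta>) *\<^sub>R v" unfolding eq[symmetric] by simp
    finally show False using assms(2) by blast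
  qed
  then show "\<alpha> = 0 \<and> \<beta> = 0" using eq assms(1) by simp
qed

lemma independent2_scale:
  assumes "independent2 v w" "s \<noteq> 0" "t \<noteq> 0"
  shows "independent2 (s *\<^sub>R v) (t *\<^sub>R w)"
  unfolding independent2_def
proof (intro allI impI)
  fix \<alpha> \<beta> assume "\<alpha> *\<^sub>R s *\<^sub>R v = \<beta> *\<^sub>R t *\<^sub>R w"
  then show "\<alpha> = 0 \<and> \<beta> = 0" using independent2D[OF assms(1), of "\<alpha> * s" "\<beta> * t"] assms(2,3) by simp
qed

lemma exists_independent2:
  assumes "v \<noteq> 0"
  obtains w where "independent2 v w"
proof -
  have "dim {v} \<le> 1" using dim_le_card[of "{v}"] by simp
  then have "dim {v} < DIM(real ^ 'n)" using two_dim by simp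
  then have "span {v} \<noteq> UNIV" by (metis dim_eq_full less_irrefl)
  then obtain w where w: "w \<notin> span {v}" by blast
  have "w \<noteq> c *\<^sub>R v" for c using w by (metis span_base span_scale insertI1)
  then show thesis using that independent2I[OF assms] by blast
qed

text \<open>The reciprocal of the stretch is recorded because this is what turns out to be affine in
  \<open>v\<close>: sending \<open>v\<close> to \<open>- v / (1 + a \<bullet> v)\<close> is
  projective.\<close>

definition factor :: "real ^ 'n \<Rightarrow> real ^ 'n \<Rightarrow> real" where
  "factor p v = (SOME c. 0 < c \<and> reflect p (p + v) = p - (1 / c) *\<^sub>R v)"

lemma factor:
  assumes "p \<in> M" "p + v \<in> M" "v \<noteq> 0"
  shows "0 < factor p v" and "reflect p (p + v) = p - (1 / factor p v) *\<^sub>R v"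
proof -
  obtain \<tau> where "\<tau> > 0" "reflect p (p + v) = p - \<tau> *\<^sub>R (p + v - p)"
    by (rule reflect_param[OF assms(1,2)]) (use assms in auto)
  then have "\<exists>c. 0 < c \<and> reflect p (p + v) = p - (1 / c) *\<^sub>R v"
    by (intro exI[of _ "1 / \<tau>"]) simp
  from someI_ex[OF this] show "0 < factor p v" "reflect p (p + v) = p - (1 / factor p v) *\<^sub>R v"
    unfolding factor_def by blast+
qed

text \<open>The reflection maps lines to lines and keeps each line through \<open>p\<close>, which forces the factor by
  which it divides to be an affine function.\<close>

lemma factor_affine:
  assumes p: "p \<in> M" and v: "p + v \<in> M" and w: "p + w \<in> M" and ind: "independent2 v w"
    and t: "0 \<le> t" "t \<le> 1"
  shows "factor p ((1 - t) *\<^sub>R v + t *\<^sub>R w) = (1 - t) * factor p v + t * factor p w"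
proof -
  let ?z = "(1 - t) *\<^sub>R v + t *\<^sub>R w"
  have v0: "v \<noteq> 0" "w \<noteq> 0" using independent2_nonzero[OF ind] by auto
  have z0: "?z \<noteq> 0"
  proof
    assume "?z = 0"
    then have "(1 - t) *\<^sub>R v = (- t) *\<^sub>R w" by (simp add: add_eq_0_iff)
    from independent2D[OF ind this] show False by auto
  qed
  have seg: "p + ?z \<in> closed_segment (p + v) (p + w)"
    unfolding in_segment using t by (intro exI[of _ t]) (auto simp: algebra_simps)
  then have zM: "p + ?z \<in> M" using segment_subset[OF v w] by blast
  note fv = factor[OF p v v0(1)] and fw = factor[OF p w v0(2)] and fz = factor[OF p zM z0]
  \<comment> \<open>The image of a point of the segment lies on the image segment and on its own
    line through \<open>p\<close>; both expansions in \<open>v\<close> and \<open>w\<close> must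
    agree.\<close>
  have "reflect p (p + ?z) \<in> closed_segment (reflect p (p + v)) (reflect p (p + w))"
    by (rule isometry_between_segment[OF centerD(2)[OF all_centers[OF p]] v w seg])
  then obtain u where "reflect p (p + ?z) = (1 - u) *\<^sub>R reflect p (p + v) + u *\<^sub>R reflect p (p + w)"
    unfolding in_segment by blast
  then have "p - (1 / factor p ?z) *\<^sub>R ?z = (1 - u) *\<^sub>R (p - (1 / factor p v) *\<^sub>R v) + u *\<^sub>R (p - (1 / factor p w) *\<^sub>R w)"
    unfolding fv(2) fw(2) fz(2) .
  also have "\<dots> = p - (((1 - u) / factor p v) *\<^sub>R v + (u / factor p w) *\<^sub>R w)"
    by (simp add: algebra_simps)
  finally have "(1 / factor p ?z) *\<^sub>R ?z = ((1 - u) / factor p v) *\<^sub>R v + (u / factor p w) *\<^sub>R w"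
    by (rule diff_left_imp_eq)
  then have "((1 - t) / factor p ?z - (1 - u) / factor p v) *\<^sub>R v = (u / factor p w - t / factor p ?z) *\<^sub>R w"
    by (simp add: algebra_simps diff_divide_distrib)
  from independent2D[OF ind this]
  have "(1 - t) / factor p ?z = (1 - u) / factor p v" "t / factor p ?z = u / factor p w" by auto
  then have "(1 - t) * factor p v = (1 - u) * factor p ?z" "t * factor p w = u * factor p ?z"
    using fv(1) fw(1) fz(1) by (auto simp: field_simps)
  then show ?thesis by (simp add: algebra_simps)
qed

text \<open>\<open>factor_affine\<close> is silent on collinear vectors, so a transverse
  \<open>w\<close> is averaged in: the points \<open>(c v + w) / 2\<close> lie on a line that misses
  \<open>p\<close>, where the factor is affine, and each has the mean of the factors at
  \<open>c v\<close> and \<open>w\<close>.\<close>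

lemma factor_line_convex:
  assumes p: "p \<in> M" and v: "v \<noteq> 0" and M: "p + r *\<^sub>R v \<in> M" "p + t *\<^sub>R v \<in> M"
    and nz: "r \<noteq> 0" "s \<noteq> 0" "t \<noteq> 0" and le: "r < s" "s < t"
  shows "(t - r) * factor p (s *\<^sub>R v) = (t - s) * factor p (r *\<^sub>R v) + (s - r) * factor p (t *\<^sub>R v)"
proof -
  obtain w0 where w0: "independent2 v w0" using exists_independent2[OF v] .
  obtain e where e: "e > 0" "\<And>s. \<bar>s\<bar> \<le> e \<Longrightarrow> p + s *\<^sub>R w0 \<in> M"
    using open_small_multiple[OF open_carrier p, of w0] by blast
  define w where "w = e *\<^sub>R w0"
  have wM: "p + w \<in> M" using e by (simp add: w_def)
  define u where "u = (s - r) / (t - r)"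
  have u: "0 \<le> u" "u \<le> 1" "u * (t - r) = s - r" using le by (auto simp: u_def)
  have s: "s = (1 - u) * r + u * t" using u(3) by (simp add: algebra_simps)
  have sM: "p + s *\<^sub>R v \<in> M"
    using line_segment_param[of r s t p v] le segment_subset[OF M] by auto
  have half: "factor p ((1/2) *\<^sub>R (c *\<^sub>R v + w)) = (factor p (c *\<^sub>R v) + factor p w) / 2"
    if "c \<noteq> 0" "p + c *\<^sub>R v \<in> M" for c
  proof -
    have "independent2 (c *\<^sub>R v) w" unfolding w_def using that e(1) by (intro independent2_scale w0) auto
    from factor_affine[OF p that(2) wM this, of "1/2"] show ?thesis by (simp add: scaleR_add_right add_divide_distrib)
  qed
  have halfM: "p + (1/2) *\<^sub>R (c *\<^sub>R v + w) \<in> M" if "p + c *\<^sub>R v \<in> M" for c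
  proof -
    have "(1/2) *\<^sub>R (p + c *\<^sub>R v) + (1/2) *\<^sub>R (p + w) \<in> M"
      using convexD[OF convex_carrier that wM] by simp
    moreover have "(1/2) *\<^sub>R (p + c *\<^sub>R v) + (1/2) *\<^sub>R (p + w) = (1/2 + 1/2) *\<^sub>R p + (1/2) *\<^sub>R (c *\<^sub>R v + w)"
      unfolding scaleR_add_left scaleR_add_right by (simp only: add_ac)
    ultimately show ?thesis by simp
  qed
  let ?z = "\<lambda>c. (1/2) *\<^sub>R (c *\<^sub>R v + w)"
  have "independent2 (?z r) (?z t)"
    unfolding independent2_def
  proof (intro allI impI)
    fix \<alpha> \<beta> assume "\<alpha> *\<^sub>R ?z r = \<beta> *\<^sub>R ?z t"
    then have "2 *\<^sub>R \<alpha> *\<^sub>R ?z r = 2 *\<^sub>R \<beta> *\<^sub>R ?z t" by simp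
    then have "\<alpha> *\<^sub>R (r *\<^sub>R v + w) = \<beta> *\<^sub>R (t *\<^sub>R v + w)" by simp
    then have "(\<alpha> * r - \<beta> * t) *\<^sub>R v = ((\<beta> - \<alpha>) * e) *\<^sub>R w0" by (simp add: w_def algebra_simps)
    from independent2D[OF w0 this] have "\<alpha> * r = \<beta> * t" "\<alpha> = \<beta>" using e(1) by auto
    then show "\<alpha> = 0 \<and> \<beta> = 0" using le by auto
  qed
  from factor_affine[OF p halfM[OF M(1)] halfM[OF M(2)] this u(1,2)]
  have "factor p ((1 - u) *\<^sub>R ?z r + u *\<^sub>R ?z t) = (1 - u) * factor p (?z r) + u * factor p (?z t)" .
  moreover have "(1 - u) *\<^sub>R ?z r + u *\<^sub>R ?z t = ?z s"
  proof -
    have "(1 - u) *\<^sub>R ?z r + u *\<^sub>R ?z t = (1/2) *\<^sub>R ((1 - u) *\<^sub>R (r *\<^sub>R v + w) + u *\<^sub>R (t *\<^sub>R v + w))"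
      by (simp add: scaleR_add_right)
    also have "(1 - u) *\<^sub>R (r *\<^sub>R v + w) + u *\<^sub>R (t *\<^sub>R v + w) = s *\<^sub>R v + w"
      unfolding s by (simp add: algebra_simps)
    finally show ?thesis .
  qed
  ultimately have "factor p (s *\<^sub>R v) + factor p w = (1 - u) * (factor p (r *\<^sub>R v) + factor p w) + u * (factor p (t *\<^sub>R v) + factor p w)"
    using half[OF nz(1) M(1)] half[OF nz(2) sM] half[OF nz(3) M(2)] by simp
  then have "factor p (s *\<^sub>R v) = (1 - u) * factor p (r *\<^sub>R v) + u * factor p (t *\<^sub>R v)" by (simp add: algebra_simps)
  then have "(t - r) * factor p (s *\<^sub>R v) = (t - r) * ((1 - u) * factor p (r *\<^sub>R v) + u * factor p (t *\<^sub>R v))"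
    by simp
  also have "\<dots> = ((t - r) - u * (t - r)) * factor p (r *\<^sub>R v) + (u * (t - r)) * factor p (t *\<^sub>R v)"
    by (simp add: algebra_simps)
  finally show ?thesis unfolding u(3) by (simp add: algebra_simps)
qed

lemma factor_involution:
  assumes "p \<in> M" "p + v \<in> M" "v \<noteq> 0"
  shows "p + (- 1 / factor p v) *\<^sub>R v \<in> M" "factor p ((- 1 / factor p v) *\<^sub>R v) * factor p v = 1"
proof -
  note f = factor[OF assms]
  define v' where "v' = (- 1 / factor p v) *\<^sub>R v"
  have r: "reflect p (p + v) = p + v'" using f(2) by (simp add: v'_def)
  then show M: "p + (- 1 / factor p v) *\<^sub>R v \<in> M" using reflect_in[OF assms(1,2)] by (simp add: v'_def)
  have v': "v' \<noteq> 0" "p + v' \<in> M" using assms f M by (auto simp: v'_def)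
  have "p + v = p - (1 / factor p v') *\<^sub>R v'"
    using factor(2)[OF assms(1) v'(2,1)] reflect_refl[OF assms(1,2)] r by simp
  then have "v = (1 / (factor p v' * factor p v)) *\<^sub>R v" by (simp add: v'_def)
  then have "(1 / (factor p v' * factor p v) - 1) *\<^sub>R v = 0" by (simp add: algebra_simps)
  then show "factor p ((- 1 / factor p v) *\<^sub>R v) * factor p v = 1" using assms(3) unfolding v'_def[symmetric] by simp
qed

text \<open>The factor is \<open>c\<close> at parameter 1 and, since reflecting twice is the
  identity, \<open>1 / c\<close> at the parameter \<open>- 1 / c\<close> on the other side of
  \<open>p\<close>. The affine function with these two values is
  \<open>1 + s * (c - 1)\<close>.\<close>

lemma factor_line:
  assumes p: "p \<in> M" and v: "v \<noteq> 0" "p + v \<in> M" and s: "s \<noteq> 0" "p + s *\<^sub>R v \<in> M"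
  shows "factor p (s *\<^sub>R v) = 1 + s * (factor p v - 1)"
proof -
  define c where "c = factor p v"
  define r where "r = - 1 / c"
  have c: "c > 0" using factor(1)[OF p v(2,1)] by (simp add: c_def)
  have rM: "p + r *\<^sub>R v \<in> M" and fr: "factor p (r *\<^sub>R v) = 1 / c"
    using factor_involution[OF p v(2,1)] c by (auto simp: r_def c_def field_simps)
  have r: "r < 0" "r * c = -1" using c by (auto simp: r_def)
  have f1: "factor p (1 *\<^sub>R v) = c" by (simp add: c_def)
  have one: "p + 1 *\<^sub>R v \<in> M" using v by simp
  let ?f = "factor p (s *\<^sub>R v)"
  have *: "(s - r) * c = (s - 1) * (1 / c) + (1 - r) * ?f"
  proof -
    consider "s < r" | "s = r" | "r < s" "s < 1" | "s = 1" | "1 < s" by linarith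
    then show ?thesis
    proof cases
      case 1
      show ?thesis using factor_line_convex[OF p v(1) s(2) one s(1) _ _ 1] r fr f1 by (simp add: algebra_simps diff_divide_distrib)
    next
      case 2 then show ?thesis using fr by (simp add: algebra_simps diff_divide_distrib)
    next
      case 3
      show ?thesis using factor_line_convex[OF p v(1) rM one _ s(1) _ 3] r fr f1 by (simp add: algebra_simps diff_divide_distrib)
    next
      case 4 then show ?thesis using f1 by (simp add: algebra_simps)
    next
      case 5
      show ?thesis using factor_line_convex[OF p v(1) rM s(2) _ _ s(1) _ 5] r fr f1 by (simp add: algebra_simps diff_divide_distrib)
    qed
  qed
  then have e1: "c * ((s - r) * c) = c * ((s - 1) * (1 / c) + (1 - r) * ?f)" by simp
  have e2: "c * ((s - r) * c) = (s * c - r * c) * c" by (simp add: algebra_simps)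
  have expand: "c * (A + (1 - r) * F) = c * A + (c - r * c) * F" for A F
    by (simp add: algebra_simps)
  have e3: "c * ((s - 1) * (1 / c) + (1 - r) * ?f) = c * ((s - 1) * (1 / c)) + (c - r * c) * ?f"
    by (rule expand)
  have e4: "c * ((s - 1) * (1 / c)) = s - 1" using c by simp
  have "(s * c + 1) * c = (s - 1) + (c + 1) * ?f"
    using e1 unfolding e2 e3 e4 r(2) by simp
  then have "(c + 1) * ?f = (c + 1) * (1 + s * (c - 1))" by (simp add: algebra_simps)
  then have "?f = 1 + s * (c - 1)" using c by simp
  then show ?thesis by (simp add: c_def)
qed

text \<open>The slope \<open>G v\<close> of the factor along \<open>v\<close> is homogeneous by
  \<open>factor_line\<close>. It is additive by \<open>factor_affine\<close> at midpoints, where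
  dependent vectors reduce to homogeneity.\<close>

lemma factor_linear:
  assumes p: "p \<in> M"
  shows "\<exists>a. \<forall>v. p + v \<in> M \<longrightarrow> v \<noteq> 0 \<longrightarrow> factor p v = 1 + a \<bullet> v"
proof -
  have "\<forall>v. \<exists>e>0. \<forall>s. \<bar>s\<bar> \<le> e \<longrightarrow> p + s *\<^sub>R v \<in> M" using open_small_multiple[OF open_carrier p] by blast
  then obtain e where e: "\<And>v. e v > 0" "\<And>v s. \<bar>s\<bar> \<le> e v \<Longrightarrow> p + s *\<^sub>R v \<in> M" by metis
  define G where "G v = (if v = 0 then 0 else (factor p (e v *\<^sub>R v) - 1) / e v)" for v
  have G: "factor p (s *\<^sub>R v) = 1 + s * G v" if "v \<noteq> 0" "s \<noteq> 0" "p + s *\<^sub>R v \<in> M" for v s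
  proof -
    have "factor p ((s / e v) *\<^sub>R e v *\<^sub>R v) = 1 + (s / e v) * (factor p (e v *\<^sub>R v) - 1)"
      using that e(1)[of v] e(2)[of "e v" v] by (intro factor_line[OF p]) auto
    then show ?thesis using that e(1)[of v] by (simp add: G_def)
  qed
  have Gscale: "G (c *\<^sub>R v) = c * G v" for c v
  proof (cases "c = 0 \<or> v = 0")
    case False
    define s where "s = e (c *\<^sub>R v)"
    have s: "s > 0" using e(1) by (simp add: s_def)
    have sM: "p + s *\<^sub>R c *\<^sub>R v \<in> M" by (rule e(2)) (use s in \<open>simp add: s_def\<close>)
    have "1 + s * G (c *\<^sub>R v) = 1 + (s * c) * G v"
      using G[of "c *\<^sub>R v" s] G[of v "s * c"] s sM False by simp
    then show ?thesis using s by simp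
  qed (auto simp: G_def)
  have Gadd: "G (v + w) = G v + G w" for v w
  proof (cases "independent2 v w")
    case True
    have nz: "v \<noteq> 0" "w \<noteq> 0" using independent2_nonzero[OF True] by auto
    have "v + w \<noteq> 0"
    proof
      assume "v + w = 0"
      then have "1 *\<^sub>R v = (-1) *\<^sub>R w" by (simp add: add_eq_0_iff)
      from independent2D[OF True this] show False by simp
    qed
    define s where "s = Min {e v, e w, e (v + w)}"
    have s: "s > 0" "s \<le> e v" "s \<le> e w" "s \<le> e (v + w)" using e(1) by (auto simp: s_def)
    have M: "p + s *\<^sub>R v \<in> M" "p + s *\<^sub>R w \<in> M" "p + (s/2) *\<^sub>R (v + w) \<in> M"
      using s by (auto intro!: e(2) simp del: scaleR_add_right)
    have "factor p ((1 - 1/2) *\<^sub>R s *\<^sub>R v + (1/2) *\<^sub>R s *\<^sub>R w) = (1 - 1/2) * factor p (s *\<^sub>R v) + (1/2) * factor p (s *\<^sub>R w)"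
      using s(1) by (intro factor_affine[OF p M(1,2)] independent2_scale True) auto
    moreover have "(1 - 1/2) *\<^sub>R s *\<^sub>R v + (1/2) *\<^sub>R s *\<^sub>R w = (s/2) *\<^sub>R (v + w)" by (simp add: scaleR_add_right)
    ultimately have "1 + s/2 * G (v + w) = (1/2) * (1 + s * G v) + (1/2) * (1 + s * G w)"
      using G[OF nz(1) _ M(1)] G[OF nz(2) _ M(2)] G[OF \<open>v + w \<noteq> 0\<close> _ M(3)] s(1) by simp
    then have "s * G (v + w) = s * (G v + G w)" by (simp add: algebra_simps)
    then show ?thesis using s(1) by simp
  next
    case False
    show ?thesis
    proof (cases "v = 0")
      case True then show ?thesis by (simp add: G_def)
    next
      case v: False
      obtain c where "w = c *\<^sub>R v" using independent2I[OF v, of w] False by blast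
      then have "v + w = (1 + c) *\<^sub>R v" "w = c *\<^sub>R v" by (simp_all add: algebra_simps)
      then show ?thesis using Gscale by (simp add: distrib_right)
    qed
  qed
  have lin: "linear G" using Gadd Gscale by (intro linearI) auto
  show ?thesis
  proof (intro exI[of _ "adjoint G 1"] allI impI)
    fix v assume v: "p + v \<in> M" "v \<noteq> 0"
    have "G v = adjoint G 1 \<bullet> v" using adjoint_works[OF lin, of v 1] by (simp add: inner_commute)
    then show "factor p v = 1 + adjoint G 1 \<bullet> v" using G[OF v(2), of 1] v(1) by simp
  qed
qed

lemma reflect_projective:
  assumes p: "p \<in> M"
  shows "\<exists>a. \<forall>x\<in>M. 0 < 1 + a \<bullet> (x - p) \<and> reflect p x = p - (1 / (1 + a \<bullet> (x - p))) *\<^sub>R (x - p)"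
proof -
  obtain a where a: "\<And>v. p + v \<in> M \<Longrightarrow> v \<noteq> 0 \<Longrightarrow> factor p v = 1 + a \<bullet> v" using factor_linear[OF p] by blast
  show ?thesis
  proof (intro exI[of _ a] ballI)
    fix x assume x: "x \<in> M"
    show "0 < 1 + a \<bullet> (x - p) \<and> reflect p x = p - (1 / (1 + a \<bullet> (x - p))) *\<^sub>R (x - p)"
    proof (cases "x = p")
      case False
      then show ?thesis using factor[OF p, of "x - p"] a[of "x - p"] x by auto
    qed (use p in simp)
  qed
qed

end

section \<open>Homogeneous coordinates and the reflection group\<close>

text \<open>Homogeneous coordinates over the index type \<open>'n option\<close>, which adds a
  coordinate without ordering the others. \<open>hat\<close> is the affine chart, \<open>emb\<close>
  its directions at infinity, and \<open>prj\<close> the central projection back, meaningful only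
  where the \<open>None\<close> coordinate, called the height below, is nonzero.\<close>

definition hat :: "real ^ 'n \<Rightarrow> real ^ 'n option" where
  "hat x = (\<chi> i. case i of None \<Rightarrow> 1 | Some j \<Rightarrow> x $ j)"

definition emb :: "real ^ 'n \<Rightarrow> real ^ 'n option" where
  "emb x = (\<chi> i. case i of None \<Rightarrow> 0 | Some j \<Rightarrow> x $ j)"

definition prj :: "real ^ 'n option \<Rightarrow> real ^ 'n" where
  "prj y = (\<chi> j. y $ Some j / y $ None)"

lemma hat_nth [simp]: "hat x $ None = 1" "hat x $ Some j = x $ j"
  by (simp_all add: hat_def)

lemma emb_nth [simp]: "emb x $ None = 0" "emb x $ Some j = x $ j"
  by (simp_all add: emb_def)

lemma vec_option_eq_iff: "y = z \<longleftrightarrow> y $ None = z $ None \<and> (\<forall>j. y $ Some j = z $ Some j)"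
  by (metis (mono_tags) not_Some_eq vec_eq_iff)

lemma prj_hat [simp]: "prj (hat x) = x"
  by (simp add: prj_def vec_eq_iff)

lemma prj_scale [simp]: "t \<noteq> 0 \<Longrightarrow> prj (t *\<^sub>R y) = prj y"
  by (simp add: prj_def vec_eq_iff)

lemma hat_prj: "y $ None \<noteq> 0 \<Longrightarrow> y = (y $ None) *\<^sub>R hat (prj y)"
  by (simp add: vec_option_eq_iff prj_def)

lemma hat_add: "hat (x + w) = hat x + emb w"
  by (simp add: vec_option_eq_iff)

lemma linear_emb: "linear emb"
  by (rule linearI) (simp_all add: vec_option_eq_iff)

lemma decomp_hat: "y = (y $ None) *\<^sub>R hat x + emb ((\<chi> j. y $ Some j) - (y $ None) *\<^sub>R x)"
  by (simp add: vec_option_eq_iff)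

lemma sum_option: "(\<Sum>i\<in>UNIV. f i) = f None + (\<Sum>j\<in>UNIV. f (Some j))"
  for f :: "'n::finite option \<Rightarrow> real"
  unfolding UNIV_option_conv by (subst sum.insert) (auto simp: sum.reindex)

lemma inner_option: "y \<bullet> z = y $ None * z $ None + (\<Sum>j\<in>UNIV. y $ Some j * z $ Some j)"
  for y z :: "real ^ 'n::finite option"
  by (simp add: inner_vec_def sum_option)

context symmetric_projective_metric_space
begin

definition hcone :: "(real ^ 'n option) set" where
  "hcone = {y. 0 < y $ None \<and> prj y \<in> M}"

lemma hcone_pos: "y \<in> hcone \<Longrightarrow> 0 < y $ None"
  and prj_hcone: "y \<in> hcone \<Longrightarrow> prj y \<in> M"
  by (simp_all add: hcone_def)

lemma hat_in_hcone [simp]: "x \<in> M \<Longrightarrow> hat x \<in> hcone"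
  by (simp add: hcone_def)

lemma hcone_scale: "y \<in> hcone \<Longrightarrow> 0 < t \<Longrightarrow> t *\<^sub>R y \<in> hcone"
  by (simp add: hcone_def)

lemma hcone_prj_eq:
  assumes "y \<in> hcone" "z \<in> hcone" "prj y = prj z"
  shows "z = (z $ None / y $ None) *\<^sub>R y"
proof -
  have yz: "y $ None \<noteq> 0" "z $ None \<noteq> 0" using hcone_pos assms by force+
  have "z = (z $ None) *\<^sub>R hat (prj y)" using hat_prj[OF yz(2)] assms(3) by simp
  also have "\<dots> = (z $ None / y $ None) *\<^sub>R ((y $ None) *\<^sub>R hat (prj y))" using yz by simp
  also have "(y $ None) *\<^sub>R hat (prj y) = y" using hat_prj[OF yz(1)] by simp
  finally show ?thesis .
qed

lemma continuous_on_prj: "continuous_on {y. 0 < y $ None} prj"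
  unfolding prj_def by (intro continuous_intros) auto

lemma open_hcone: "open hcone"
proof -
  have op: "open {y :: real ^ 'n option. 0 < y $ None}"
    by (intro open_Collect_less continuous_intros)
  have "open (prj -` M \<inter> {y. 0 < y $ None})"
    using continuous_open_preimage[OF continuous_on_prj op open_carrier] by (simp add: Int_commute)
  moreover have "hcone = prj -` M \<inter> {y. 0 < y $ None}" by (auto simp: hcone_def)
  ultimately show ?thesis by simp
qed

text \<open>In homogeneous coordinates the reflection in \<open>prj p\<close> is the linear map
  \<open>y \<mapsto> 2 (cov p \<bullet> y) p - y\<close>.\<close>

definition slope :: "real ^ 'n \<Rightarrow> real ^ 'n" where
  "slope p = (SOME a. \<forall>x\<in>M. 0 < 1 + a \<bullet> (x - p) \<and> reflect p x = p - (1 / (1 + a \<bullet> (x - p))) *\<^sub>R (x - p))"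

lemma slope:
  assumes "p \<in> M" "x \<in> M"
  shows "0 < 1 + slope p \<bullet> (x - p)" "reflect p x = p - (1 / (1 + slope p \<bullet> (x - p))) *\<^sub>R (x - p)"
proof -
  have "\<forall>x\<in>M. 0 < 1 + slope p \<bullet> (x - p) \<and> reflect p x = p - (1 / (1 + slope p \<bullet> (x - p))) *\<^sub>R (x - p)"
    unfolding slope_def by (rule someI_ex[OF reflect_projective[OF assms(1)]])
  note * = bspec[OF this assms(2)]
  show "0 < 1 + slope p \<bullet> (x - p)" by (rule conjunct1[OF *])
  show "reflect p x = p - (1 / (1 + slope p \<bullet> (x - p))) *\<^sub>R (x - p)" by (rule conjunct2[OF *])
qed

text \<open>The functional with value 1 at \<open>p\<close> whose kernel projects to the axis of the
  reflection, the hyperplane that the projective involution fixes pointwise. It is homogeneous of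
  degree -1 in \<open>p\<close>, so \<open>hsym p\<close> depends only on the ray of
  \<open>p\<close>; the halves compensate the factor 2 in \<open>hsym\<close>.\<close>

definition cov :: "real ^ 'n option \<Rightarrow> real ^ 'n option" where
  "cov p = (1 / p $ None) *\<^sub>R (\<chi> i. case i of None \<Rightarrow> 1 - (slope (prj p) \<bullet> prj p) / 2 | Some j \<Rightarrow> slope (prj p) $ j / 2)"

definition hsym :: "real ^ 'n option \<Rightarrow> real ^ 'n option \<Rightarrow> real ^ 'n option" where
  "hsym p y = (2 * (cov p \<bullet> y)) *\<^sub>R p - y"

lemma cov_hat: "cov p \<bullet> hat z = (1 / p $ None) * (1 + slope (prj p) \<bullet> (z - prj p) / 2)"
proof -
  have "(\<Sum>j\<in>UNIV. slope (prj p) $ j / 2 * z $ j) = slope (prj p) \<bullet> z / 2"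
    by (simp add: inner_vec_def sum_divide_distrib)
  then show ?thesis
    unfolding cov_def inner_scaleR_left by (simp add: inner_option inner_diff_right diff_divide_distrib)
qed

lemma cov_self:
  assumes "p \<in> hcone"
  shows "cov p \<bullet> p = 1"
proof -
  have p0: "p $ None \<noteq> 0" using hcone_pos[OF assms] by simp
  have "cov p \<bullet> p = cov p \<bullet> (p $ None *\<^sub>R hat (prj p))" using hat_prj[OF p0] by simp
  also have "\<dots> = 1" unfolding inner_scaleR_right cov_hat using p0 by simp
  finally show ?thesis .
qed

lemma linear_hsym: "linear (hsym p)"
  unfolding hsym_def by (rule linearI) (simp_all add: algebra_simps inner_add_right scaleR_right_distrib)

lemma hsym_hcone:
  assumes p: "p \<in> hcone" and y: "y \<in> hcone"
  shows "hsym p y \<in> hcone" and "prj (hsym p y) = reflect (prj p) (prj y)"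
proof -
  let ?x = "prj p" and ?z = "prj y" and ?p0 = "p $ None" and ?y0 = "y $ None"
  let ?D = "slope ?x \<bullet> (?z - ?x)"
  have pos: "0 < ?p0" "0 < ?y0" using p y hcone_pos by auto
  have M: "?x \<in> M" "?z \<in> M" using p y prj_hcone by auto
  note sl = slope[OF M]
  have "cov p \<bullet> y = ?y0 * (cov p \<bullet> hat ?z)"
    using arg_cong[OF hat_prj[of y], of "inner (cov p)"] pos by simp
  then have c: "2 * (cov p \<bullet> y) * ?p0 = ?y0 * (2 + ?D)"
    unfolding cov_hat using pos by (simp add: field_simps)
  have "hsym p y = (2 * (cov p \<bullet> y)) *\<^sub>R (?p0 *\<^sub>R hat ?x) - ?y0 *\<^sub>R hat ?z"
    unfolding hsym_def using hat_prj[of p] hat_prj[of y] pos by simp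
  then have Seq: "hsym p y = ?y0 *\<^sub>R ((2 + ?D) *\<^sub>R hat ?x - hat ?z)"
    unfolding scaleR_scaleR c scaleR_diff_right by simp
  \<comment> \<open>The height is multiplied by a positive number, so the linear map keeps the cone
    itself and not only the lines in it.\<close>
  then have None: "hsym p y $ None = ?y0 * (1 + ?D)" by simp
  have "prj (hsym p y) = ?x - (1 / (1 + ?D)) *\<^sub>R (?z - ?x)"
  proof -
    have "hsym p y $ Some j / hsym p y $ None = ?x $ j - (1 / (1 + ?D)) * (?z $ j - ?x $ j)" for j
    proof -
      have alg: "(b * ((1 + E) * x - z)) / (b * E) = x - (1 / E) * (z - x)" if "0 < b" "0 < E" for b E x z :: real
        using that by (simp add: field_simps)
      have "hsym p y $ Some j = ?y0 * ((1 + (1 + ?D)) * ?x $ j - ?z $ j)" unfolding Seq by simp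
      then show ?thesis unfolding None using alg[OF pos(2) sl(1)] by simp
    qed
    then show ?thesis by (simp add: vec_eq_iff prj_def[of "hsym p y"])
  qed
  then show pr: "prj (hsym p y) = reflect ?x ?z" using sl(2) by simp
  show "hsym p y \<in> hcone" unfolding hcone_def using None pos sl(1) pr reflect_in[OF M] by simp
qed

lemma hsym_hsym [simp]: "p \<in> hcone \<Longrightarrow> hsym p (hsym p y) = y"
  by (simp add: hsym_def inner_diff_right cov_self algebra_simps)

lemma hsym_self [simp]: "p \<in> hcone \<Longrightarrow> hsym p p = p"
  by (simp add: hsym_def cov_self scaleR_2)

section \<open>The group generated by the linear reflections\<close>

inductive_set hgroup :: "(real ^ 'n option \<Rightarrow> real ^ 'n option) set" where
  id: "id \<in> hgroup"
| step: "g \<in> hgroup \<Longrightarrow> p \<in> hcone \<Longrightarrow> hsym p \<circ> g \<in> hgroup"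

lemma hgroup_hsym: "p \<in> hcone \<Longrightarrow> hsym p \<in> hgroup"
  using hgroup.step[OF hgroup.id, of p] by simp

lemma hgroup_comp: "g \<in> hgroup \<Longrightarrow> h \<in> hgroup \<Longrightarrow> g \<circ> h \<in> hgroup"
  by (induction rule: hgroup.induct) (auto simp: comp_assoc intro: hgroup.step)

lemma hgroup_linear: "g \<in> hgroup \<Longrightarrow> linear g"
proof (induction rule: hgroup.induct)
  case (step g p)
  show ?case by (rule linear_compose[OF step.IH linear_hsym])
qed (simp add: linear_ident id_def)

lemma hgroup_hcone: "g \<in> hgroup \<Longrightarrow> y \<in> hcone \<Longrightarrow> g y \<in> hcone"
  by (induction arbitrary: y rule: hgroup.induct) (auto intro: hsym_hcone)

lemma hgroup_isometry:
  assumes "g \<in> hgroup"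
  shows "y \<in> hcone \<Longrightarrow> z \<in> hcone \<Longrightarrow> d (prj (g y)) (prj (g z)) = d (prj y) (prj z)"
  using assms
proof (induction rule: hgroup.induct)
  case (step g p)
  then show ?case
    by (simp add: hsym_hcone(2) hgroup_hcone reflect_dist_eq prj_hcone)
qed simp

lemma hgroup_inverse:
  assumes "g \<in> hgroup"
  shows "\<exists>h\<in>hgroup. \<forall>y. h (g y) = y \<and> g (h y) = y"
  using assms
proof (induction rule: hgroup.induct)
  case id then show ?case using hgroup.id by (intro bexI[of _ id]) auto
next
  case (step g p)
  then obtain h where h: "h \<in> hgroup" "\<And>y. h (g y) = y" "\<And>y. g (h y) = y" by blast
  show ?case
    using step.hyps h by (intro bexI[of _ "h \<circ> hsym p"]) (auto intro: hgroup_comp hgroup_hsym)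
qed

lemma hgroup_funpow: "g \<in> hgroup \<Longrightarrow> g ^^ m \<in> hgroup"
  by (induction m) (auto intro: hgroup_comp hgroup.id simp flip: id_def)

lemma det_hsym:
  assumes "p \<in> hcone"
  shows "\<bar>det (matrix (hsym p))\<bar> = 1"
proof -
  have "hsym p \<circ> hsym p = id" using assms by (simp add: fun_eq_iff)
  then have "matrix (hsym p) ** matrix (hsym p) = mat 1"
    using matrix_compose[OF linear_hsym linear_hsym, of p p] by (simp add: matrix_id_mat_1)
  then have "det (matrix (hsym p)) * det (matrix (hsym p)) = 1" by (metis det_I det_mul)
  then show ?thesis by (metis abs_mult_self_eq abs_1 abs_square_eq_1 power2_eq_square)
qed

lemma det_hgroup: "g \<in> hgroup \<Longrightarrow> \<bar>det (matrix g)\<bar> = 1"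
proof (induction rule: hgroup.induct)
  case id then show ?case by (simp add: matrix_id_mat_1)
next
  case (step g p)
  have "det (matrix (hsym p \<circ> g)) = det (matrix (hsym p)) * det (matrix g)"
    unfolding matrix_compose[OF hgroup_linear[OF step.hyps(1)] linear_hsym] by (rule det_mul)
  then show ?case using step.IH det_hsym[OF step.hyps(2)] by (simp only: abs_mult mult_1)
qed

text \<open>The orbit of a base point meets every ray of the cone exactly once: a stabilizer element rescaling
  the base point has bounded normalized powers, because it is an isometry fixing a point, while
  its determinant is of modulus 1.\<close>

lemma stabilizer_bounded:
  assumes p: "p \<in> M"
  shows "\<exists>K. \<forall>g\<in>hgroup. \<forall>\<kappa>>0. g (hat p) = \<kappa> *\<^sub>R hat p \<longrightarrow> (\<forall>v. norm (g v) \<le> K * \<kappa> * norm v)"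
proof -
  obtain m where m: "m > 0" "\<And>y. y \<in> M \<Longrightarrow> d p y < m \<Longrightarrow> dist p y < 1"
    using near_if_d_small[OF p, of 1] by auto
  \<comment> \<open>The Euclidean ball of radius \<open>r\<close> lies in the \<open>d\<close>-ball
    of radius \<open>m\<close>, and an isometry fixing \<open>p\<close> keeps the latter within
    Euclidean distance 1 of \<open>p\<close>.\<close>
  obtain r where r: "r > 0" "cball p r \<subseteq> M" "\<And>y. y \<in> cball p r \<Longrightarrow> d p y < m"
  proof -
    have "continuous_on M (\<lambda>y. d p y)" using p by (intro continuous_on_d continuous_intros) auto
    then have "open ((\<lambda>y. d p y) -` {..<m} \<inter> M)"
      using continuous_open_preimage[OF _ open_carrier open_lessThan] by (simp add: Int_commute)
    moreover have "(\<lambda>y. d p y) -` {..<m} \<inter> M = {y \<in> M. d p y < m}" by auto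
    ultimately have "open {y \<in> M. d p y < m}" by simp
    moreover have "p \<in> {y \<in> M. d p y < m}" using p m by simp
    ultimately obtain r where "r > 0" "cball p r \<subseteq> {y \<in> M. d p y < m}"
      using open_contains_cball by blast
    then show thesis using that[of r] by blast
  qed
  \<comment> \<open>A vector of height below 2 that projects to within distance 1 of
    \<open>p\<close> has norm at most \<open>2 * (norm (hat p) + 1)\<close>; the last summand passes
    from \<open>hat p + u\<close> to \<open>u\<close>.\<close>
  define K1 where "K1 = 2 * (norm (hat p :: real ^ 'n option) + 1) + norm (hat p :: real ^ 'n option)"
  have small: "norm (g (emb w)) \<le> \<kappa> * K1" if g: "g \<in> hgroup" "\<kappa> > 0" "g (hat p) = \<kappa> *\<^sub>R hat p" and w: "norm w \<le> r" for g \<kappa> w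
  proof -
    define u where "u = (1 / \<kappa>) *\<^sub>R g (emb w)"
    have lin: "linear g" using g(1) by (rule hgroup_linear)
    have *: "hat p + s *\<^sub>R u \<in> hcone \<and> dist p (prj (hat p + s *\<^sub>R u)) < 1" if s: "\<bar>s\<bar> = 1" for s
    proof -
      have ball: "p + s *\<^sub>R w \<in> cball p r" using s w by (simp add: dist_norm)
      then have c: "hat (p + s *\<^sub>R w) \<in> hcone" using r by (intro hat_in_hcone) blast
      have eq: "hat p + s *\<^sub>R u = (1 / \<kappa>) *\<^sub>R g (hat (p + s *\<^sub>R w))"
        using g by (simp add: hat_add linear_add[OF lin] linear_scale[OF lin] linear_scale[OF linear_emb] u_def scaleR_add_right)
      then have "hat p + s *\<^sub>R u \<in> hcone" using hgroup_hcone[OF g(1) c] g(2) by (simp add: hcone_scale)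
      moreover have "d p (prj (g (hat (p + s *\<^sub>R w)))) < m"
        using hgroup_isometry[OF g(1) hat_in_hcone[OF p] c] g(2,3) r(3)[OF ball] by simp
      then have "dist p (prj (g (hat (p + s *\<^sub>R w)))) < 1"
        using m(2) prj_hcone[OF hgroup_hcone[OF g(1) c]] by blast
      ultimately show ?thesis using eq g(2) by simp
    qed
    from *[of 1] *[of "-1"] have c: "hat p + u \<in> hcone" "hat p - u \<in> hcone" and dd: "dist p (prj (hat p + u)) < 1" by simp_all
    \<comment> \<open>Both \<open>hat p + u\<close> and \<open>hat p - u\<close> are in the cone and
      their heights add up to 2.\<close>
    have t: "0 < (hat p + u) $ None" "(hat p + u) $ None < 2" using hcone_pos[OF c(1)] hcone_pos[OF c(2)] by simp_all
    obtain e where e: "prj (hat p + u) = p + e" "norm e < 1"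
    proof (rule that[of "prj (hat p + u) - p"])
      show "norm (prj (hat p + u) - p) < 1" using dd by (simp add: dist_norm norm_minus_commute)
    qed simp
    have ne: "norm (emb e) \<le> norm e"
      unfolding norm_le by (simp add: inner_option inner_vec_def)
    have "hat p + u = (hat p + u) $ None *\<^sub>R (hat p + emb e)" using hat_prj[of "hat p + u"] t e by (simp add: hat_add)
    then have "norm (hat p + u) = (hat p + u) $ None * norm (hat p + emb e)" using t by (metis abs_of_pos norm_scaleR)
    also have "\<dots> \<le> 2 * (norm (hat p :: real ^ 'n option) + 1)"
      using t e ne norm_triangle_ineq[of "hat p" "emb e"] by (intro mult_mono) auto
    finally have "norm u \<le> K1" using norm_triangle_ineq4[of "hat p + u" "hat p"] by (simp add: K1_def)
    moreover have "norm (g (emb w)) = \<kappa> * norm u" using g(2) by (simp add: u_def)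
    ultimately show ?thesis using g(2) by (simp add: mult_left_mono)
  qed
  have K1: "K1 \<ge> 0" by (simp add: K1_def)
  have lin_small: "norm (g (emb w)) \<le> \<kappa> * (K1 / r) * norm w" if g: "g \<in> hgroup" "\<kappa> > 0" "g (hat p) = \<kappa> *\<^sub>R hat p" for g \<kappa> w
  proof (cases "w = 0")
    case False
    have "norm (g (emb ((r / norm w) *\<^sub>R w))) \<le> \<kappa> * K1" using r(1) False by (intro small g) auto
    moreover have "g (emb ((r / norm w) *\<^sub>R w)) = (r / norm w) *\<^sub>R g (emb w)"
      by (simp add: linear_scale[OF linear_emb] linear_scale[OF hgroup_linear[OF g(1)]])
    ultimately have "r / norm w * norm (g (emb w)) \<le> \<kappa> * K1" using r(1) by simp
    then show ?thesis using r(1) False by (simp add: field_simps)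
  qed (use g in \<open>simp add: linear_0[OF linear_emb] linear_0[OF hgroup_linear[OF g(1)]]\<close>)
  define N where "N = norm (hat p :: real ^ 'n option)"
  define K where "K = N + (K1 / r) * (1 + norm p)"
  show ?thesis
  proof (intro exI[of _ K] ballI allI impI)
    fix g \<kappa> v assume g: "g \<in> hgroup" "(0::real) < \<kappa>" "g (hat p) = \<kappa> *\<^sub>R hat p"
    let ?w = "(\<chi> j. v $ Some j) - (v $ None) *\<^sub>R p"
    have v0: "\<bar>v $ None\<bar> \<le> norm v" by (rule component_le_norm_cart)
    have "norm (\<chi> j. v $ Some j) \<le> norm v"
      unfolding norm_le by (simp add: inner_option[of v v] inner_vec_def[of "\<chi> j. v $ Some j"])
    moreover have "norm ?w \<le> norm (\<chi> j. v $ Some j) + \<bar>v $ None\<bar> * norm p"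
      using norm_triangle_ineq4[of "\<chi> j. v $ Some j" "(v $ None) *\<^sub>R p"] by simp
    moreover have "\<bar>v $ None\<bar> * norm p \<le> norm v * norm p" using v0 by (simp add: mult_right_mono)
    ultimately have w: "norm ?w \<le> (1 + norm p) * norm v" by (simp add: algebra_simps)
    have lin: "linear g" using g(1) by (rule hgroup_linear)
    have "g v = (v $ None * \<kappa>) *\<^sub>R hat p + g (emb ?w)"
      by (subst decomp_hat[of v p]) (simp add: linear_add[OF lin] linear_scale[OF lin] g(3))
    then have "norm (g v) \<le> \<bar>v $ None\<bar> * \<kappa> * N + norm (g (emb ?w))"
      using norm_triangle_ineq[of "(v $ None * \<kappa>) *\<^sub>R hat p" "g (emb ?w)"] g(2) by (simp add: N_def abs_mult)
    also have "norm (g (emb ?w)) \<le> \<kappa> * (K1 / r) * norm ?w" by (rule lin_small[OF g])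
    also have "\<kappa> * (K1 / r) * norm ?w \<le> \<kappa> * (K1 / r) * ((1 + norm p) * norm v)"
      using w g(2) K1 r(1) by (intro mult_left_mono) auto
    also have "\<bar>v $ None\<bar> * \<kappa> * N \<le> norm v * \<kappa> * N" using v0 g(2) by (intro mult_right_mono) (auto simp: N_def)
    finally show "norm (g v) \<le> K * \<kappa> * norm v" by (simp add: K_def algebra_simps)
  qed
qed

end

section \<open>The invariant bilinear form\<close>

lemma abs_det_le:
  fixes A :: "real ^ 'm ^ 'm"
  assumes "\<And>i j. \<bar>A $ i $ j\<bar> \<le> C"
  shows "\<bar>det A\<bar> \<le> real (card {p. p permutes (UNIV :: 'm set)}) * C ^ CARD('m)"
proof -
  have "\<bar>det A\<bar> \<le> (\<Sum>p\<in>{p. p permutes (UNIV :: 'm set)}. \<bar>of_int (sign p) * (\<Prod>i\<in>UNIV. A $ i $ p i)\<bar>)"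
    unfolding det_def by (rule sum_abs)
  also have "\<dots> \<le> (\<Sum>p\<in>{p. p permutes (UNIV :: 'm set)}. C ^ CARD('m))"
  proof (rule sum_mono)
    fix p :: "'m \<Rightarrow> 'm"
    have "\<bar>of_int (sign p) * (\<Prod>i\<in>UNIV. A $ i $ p i)\<bar> = (\<Prod>i\<in>UNIV. \<bar>A $ i $ p i\<bar>)"
      by (simp add: abs_mult sign_def abs_prod)
    also have "\<dots> \<le> (\<Prod>i\<in>(UNIV :: 'm set). C)" by (intro prod_mono) (simp add: assms)
    finally show "\<bar>of_int (sign p) * (\<Prod>i\<in>UNIV. A $ i $ p i)\<bar> \<le> C ^ CARD('m)" by simp
  qed
  finally show ?thesis by simp
qed

text \<open>For \<open>a < 1\<close> the differences \<delta> decrease. If one is negative, the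
  sequence falls below 0 at least linearly. If none is, the sequence stays above \<open>l 0\<close>,
  so each difference drops by at least \<open>2 (1 - a) l 0\<close> and one becomes negative after
  all.\<close>

lemma positive_recurrence_ge_1:
  fixes l :: "nat \<Rightarrow> real"
  assumes pos: "\<And>k. 0 < l k" and rec: "\<And>k. l (Suc (Suc k)) = 2 * a * l (Suc k) - l k"
  shows "1 \<le> a"
proof (rule ccontr)
  assume a: "\<not> 1 \<le> a"
  define \<delta> where "\<delta> k = l (Suc k) - l k" for k
  have step: "\<delta> (Suc k) = \<delta> k - 2 * (1 - a) * l (Suc k)" for k
    using rec[of k] by (simp add: \<delta>_def algebra_simps)
  have dec: "\<delta> (Suc k) \<le> \<delta> k" for k using step[of k] pos[of "Suc k"] a by (simp add: mult_nonneg_nonneg)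
  have mono: "\<delta> (j + m) \<le> \<delta> j" for j m
    by (induction m) (use dec order_trans in auto)
  show False
  proof (cases "\<exists>j. \<delta> j < 0")
    case True
    then obtain j where j: "\<delta> j < 0" by blast
    have "l (j + m) \<le> l j + real m * \<delta> j" for m
    proof (induction m)
      case (Suc m)
      have "l (j + Suc m) = l (j + m) + \<delta> (j + m)" by (simp add: \<delta>_def)
      then show ?case using Suc mono[of j m] by (simp add: algebra_simps)
    qed simp
    moreover obtain m where "l j < real m * (- \<delta> j)" using ex_less_of_nat_mult[of "- \<delta> j" "l j"] j by auto
    ultimately show False using pos[of "j + m"] by (smt (verit) mult_minus_right)
  next
    case False
    then have nn: "0 \<le> \<delta> k" for k by (simp add: not_less)
    have l0: "l 0 \<le> l k" for k
    proof (induction k)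
      case (Suc k) then show ?case using nn[of k] by (simp add: \<delta>_def)
    qed simp
    define c where "c = 2 * (1 - a) * l 0"
    have c: "c > 0" using a pos[of 0] by (simp add: c_def)
    have "\<delta> k \<le> \<delta> 0 - real k * c" for k
    proof (induction k)
      case (Suc k)
      have "c \<le> 2 * (1 - a) * l (Suc k)" unfolding c_def using a l0 by (intro mult_left_mono) auto
      then show ?case using Suc step[of k] by (simp add: algebra_simps)
    qed simp
    moreover obtain m where "\<delta> 0 < real m * c" using ex_less_of_nat_mult[OF c] by auto
    ultimately show False using nn[of m] by (smt (verit))
  qed
qed

context symmetric_projective_metric_space
begin

definition base :: "real ^ 'n" where "base = (SOME x. x \<in> M)"

definition org :: "real ^ 'n option" where "org = hat base"

lemma base_in: "base \<in> M"
  unfolding base_def using nonempty by (simp add: some_in_eq)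

lemma org_hcone: "org \<in> hcone"
  by (simp add: org_def base_in)

lemma hcone_functional_zero:
  assumes "linear f" "\<And>x. x \<in> hcone \<Longrightarrow> f x = (0::real)"
  shows "f x = 0"
proof -
  obtain e where e: "e > 0" "\<And>s. \<bar>s\<bar> \<le> e \<Longrightarrow> org + s *\<^sub>R x \<in> hcone"
    using open_small_multiple[OF open_hcone org_hcone] by blast
  have "f (org + e *\<^sub>R x) = 0" "f org = 0" using e assms(2) org_hcone by auto
  then show ?thesis using e(1) by (simp add: linear_add[OF assms(1)] linear_scale[OF assms(1)])
qed

lemma stabilizer_factor_ge_1:
  assumes g: "g \<in> hgroup" "\<kappa> > 0" "g org = \<kappa> *\<^sub>R org"
  shows "1 \<le> \<kappa>"
proof (rule ccontr)
  assume lt: "\<not> 1 \<le> \<kappa>"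
  obtain K where K: "\<And>g \<kappa> v. g \<in> hgroup \<Longrightarrow> \<kappa> > 0 \<Longrightarrow> g org = \<kappa> *\<^sub>R org \<Longrightarrow> norm (g v) \<le> K * \<kappa> * norm v"
    using stabilizer_bounded[OF base_in] unfolding org_def by blast
  have gm: "(g ^^ m) org = \<kappa> ^ m *\<^sub>R org" for m
    by (induction m) (simp_all add: g(3) linear_scale[OF hgroup_linear[OF g(1)]] mult.commute)
  let ?N = "CARD('n option)"
  let ?c = "real (card {p. p permutes (UNIV :: 'n option set)})"
  \<comment> \<open>By the Leibniz formula a determinant with entries at most
    \<open>K * \<kappa> ^ m\<close> tends to 0 for \<open>\<kappa> < 1\<close>, but its modulus is
    1.\<close>
  have bd: "1 \<le> ?c * (K * \<kappa> ^ m) ^ ?N" for m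
  proof -
    have "\<bar>matrix (g ^^ m) $ i $ j\<bar> \<le> K * \<kappa> ^ m" for i j
    proof -
      have "\<bar>(g ^^ m) (axis j 1) $ i\<bar> \<le> norm ((g ^^ m) (axis j 1))" by (rule component_le_norm_cart)
      also have "\<dots> \<le> K * \<kappa> ^ m * norm (axis j (1::real))"
        using g(2) by (intro K hgroup_funpow g(1) gm) simp
      finally show ?thesis by (simp add: matrix_def norm_axis_1)
    qed
    from abs_det_le[OF this] show ?thesis using det_hgroup[OF hgroup_funpow[OF g(1)]] by simp
  qed
  have pw: "(K * \<kappa> ^ m) ^ N = K ^ N * (\<kappa> ^ N) ^ m" for m N
    by (simp add: power_mult_distrib power_mult[symmetric] mult.commute)
  have low: "1 \<le> ?c * K ^ ?N * (\<kappa> ^ ?N) ^ m" for m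
    using bd[of m] unfolding pw mult.assoc .
  have lim: "(\<lambda>m. ?c * K ^ ?N * (\<kappa> ^ ?N) ^ m) \<longlonglongrightarrow> ?c * K ^ ?N * 0"
  proof (rule tendsto_mult_left, rule LIMSEQ_power_zero)
    have "\<kappa> ^ Suc (CARD('n)) < 1" using g(2) lt by (intro power_Suc_less_one) auto
    then show "norm (\<kappa> ^ ?N) < 1" using g(2) by (simp add: card_UNIV_option)
  qed
  have "1 \<le> ?c * K ^ ?N * 0" by (rule LIMSEQ_le_const[OF lim]) (use low in blast)
  then show False by simp
qed

lemma stabilizer_factor:
  assumes g: "g \<in> hgroup" "\<kappa> > 0" "g org = \<kappa> *\<^sub>R org"
  shows "\<kappa> = 1"
proof -
  obtain h where h: "h \<in> hgroup" "\<And>y. h (g y) = y" using hgroup_inverse[OF g(1)] by blast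
  have "org = h (\<kappa> *\<^sub>R org)" using h(2)[of org] g(3) by simp
  also have "\<dots> = \<kappa> *\<^sub>R h org" by (rule linear_scale[OF hgroup_linear[OF h(1)]])
  finally have "(1 / \<kappa>) *\<^sub>R org = (1 / \<kappa>) *\<^sub>R \<kappa> *\<^sub>R h org" by simp
  then have "h org = (1 / \<kappa>) *\<^sub>R org" using g(2) by simp
  then have "1 \<le> 1 / \<kappa>" using g(2) by (intro stabilizer_factor_ge_1[OF h(1)]) auto
  then show ?thesis using stabilizer_factor_ge_1[OF g] g(2) by (simp add: field_simps)
qed

section \<open>The orbit as a section of the cone\<close>

definition orbit :: "(real ^ 'n option) set" where
  "orbit = (\<lambda>g. g org) ` hgroup"

lemma org_orbit: "org \<in> orbit"
  unfolding orbit_def by (intro image_eqI[of _ _ id]) (simp_all add: hgroup.id)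

lemma orbit_hcone: "x \<in> orbit \<Longrightarrow> x \<in> hcone"
  unfolding orbit_def using hgroup_hcone[OF _ org_hcone] by auto

lemma orbit_hgroup:
  assumes "x \<in> orbit" "g \<in> hgroup" shows "g x \<in> orbit"
proof -
  obtain h where "h \<in> hgroup" "x = h org" using assms(1) by (auto simp: orbit_def)
  then show ?thesis unfolding orbit_def using hgroup_comp[OF assms(2)] by (intro image_eqI[of _ _ "g \<circ> h"]) auto
qed

lemma orbit_hsym: "p \<in> hcone \<Longrightarrow> x \<in> orbit \<Longrightarrow> hsym p x \<in> orbit"
  by (rule orbit_hgroup[OF _ hgroup_hsym])

lemma orbit_unique:
  assumes "x \<in> orbit" "t *\<^sub>R x \<in> orbit" "0 < t"
  shows "t = 1"
proof -
  obtain g where g: "g \<in> hgroup" "x = g org" using assms(1) by (auto simp: orbit_def)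
  obtain h where h: "h \<in> hgroup" "t *\<^sub>R x = h org" using assms(2) by (auto simp: orbit_def)
  obtain k where k: "k \<in> hgroup" "\<And>y. k (g y) = y" using hgroup_inverse[OF g(1)] by blast
  have "(k \<circ> h) org = t *\<^sub>R org"
    using linear_scale[OF hgroup_linear[OF k(1)], of t x] h(2) k(2)[of org] g(2) by simp
  then show ?thesis using stabilizer_factor[OF hgroup_comp[OF k(1) h(1)] assms(3)] by simp
qed

lemma hcone_midpoint:
  assumes "x \<in> hcone" "y \<in> hcone"
  obtains m t where "m \<in> hcone" "0 < t" "hsym m x = t *\<^sub>R y"
proof -
  obtain m where m: "m \<in> M" "reflect m (prj x) = prj y"
    using metric_midpoint[OF prj_hcone[OF assms(1)] prj_hcone[OF assms(2)]] by metis
  have hm: "hat m \<in> hcone" using m(1) by simp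
  have s: "hsym (hat m) x \<in> hcone" "prj (hsym (hat m) x) = prj y"
    using hsym_hcone[OF hm assms(1)] m(2) by simp_all
  have "hsym (hat m) x = (hsym (hat m) x $ None / y $ None) *\<^sub>R y"
    by (rule hcone_prj_eq[OF assms(2) s(1) s(2)[symmetric]])
  moreover have "0 < hsym (hat m) x $ None / y $ None" using hcone_pos[OF s(1)] hcone_pos[OF assms(2)] by simp
  ultimately show thesis by (intro that[OF hm])
qed

lemma orbit_ray:
  assumes "c \<in> hcone"
  obtains t where "0 < t" "t *\<^sub>R c \<in> orbit"
proof -
  obtain m t where m: "m \<in> hcone" "0 < t" "hsym m org = t *\<^sub>R c"
    by (rule hcone_midpoint[OF org_hcone assms])
  show thesis using that[OF m(2)] orbit_hsym[OF m(1) org_orbit] m(3) by simp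
qed

text \<open>The reflection in the metric midpoint takes \<open>x\<close> to the ray of
  \<open>y\<close>, and the orbit meets that ray only in \<open>y\<close>. Rescaling
  \<open>m\<close> into the orbit does not change its reflection.\<close>

lemma orbit_midpoint:
  assumes "x \<in> orbit" "y \<in> orbit"
  obtains m where "m \<in> orbit" "hsym m x = y"
proof -
  obtain m t where m: "m \<in> hcone" "0 < t" "hsym m x = t *\<^sub>R y"
    by (rule hcone_midpoint[OF orbit_hcone[OF assms(1)] orbit_hcone[OF assms(2)]])
  have "t = 1" using orbit_unique[OF assms(2) _ m(2)] orbit_hsym[OF m(1) assms(1)] m(3) by simp
  obtain s where s: "0 < s" "s *\<^sub>R m \<in> orbit" by (rule orbit_ray[OF m(1)])
  have "hsym (s *\<^sub>R m) x = hsym m x"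
    using s(1) by (simp add: hsym_def cov_def)
  then show thesis using that[OF s(2)] m(3) \<open>t = 1\<close> by simp
qed

text \<open>\<open>hsym (hsym q p)\<close> and \<open>hsym q \<circ> hsym p \<circ> hsym q\<close>
  lift the same reflection of \<open>M\<close>, hence agree on each vector \<open>y\<close> of the
  cone up to a factor \<rho>. Both send \<open>y\<close> to a multiple of \<open>hsym q p\<close>
  minus \<open>y\<close>. Either \<rho> is 1 and the multiples agree, or \<open>y\<close> is itself
  a multiple of \<open>hsym q p\<close> and the normalization of \<open>cov\<close> decides. The
  open cone determines a functional.\<close>

lemma cov_equivariant:
  assumes p: "p \<in> hcone" and q: "q \<in> hcone"
  shows "cov p \<bullet> hsym q x = cov (hsym q p) \<bullet> x"
proof -
  let ?p' = "hsym q p"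
  have p': "?p' \<in> hcone" by (rule hsym_hcone[OF q p])
  have "cov p \<bullet> hsym q y - cov ?p' \<bullet> y = 0" if y: "y \<in> hcone" for y
  proof -
    define \<psi> where "\<psi> = cov p \<bullet> hsym q y"
    define \<phi> where "\<phi> = cov ?p' \<bullet> y"
    define y1 where "y1 = hsym ?p' y"
    define y2 where "y2 = hsym q (hsym p (hsym q y))"
    have c: "y1 \<in> hcone" "y2 \<in> hcone" unfolding y1_def y2_def by (intro hsym_hcone p q p' y)+
    have "prj y1 = reflect (reflect (prj q) (prj p)) (prj y)"
      unfolding y1_def by (simp add: hsym_hcone p q p' y)
    also have "\<dots> = reflect (prj q) (reflect (prj p) (reflect (prj q) (prj y)))"
      by (intro reflect_conj prj_hcone p q y)
    also have "\<dots> = prj y2" unfolding y2_def by (simp add: hsym_hcone p q p' y)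
    finally have pr: "prj y1 = prj y2" .
    define \<rho> where "\<rho> = y2 $ None / y1 $ None"
    have y21: "y2 = \<rho> *\<^sub>R y1" unfolding \<rho>_def by (rule hcone_prj_eq[OF c pr])
    have "y2 = hsym q ((2 * \<psi>) *\<^sub>R p - hsym q y)" unfolding y2_def \<psi>_def by (simp add: hsym_def[of p])
    also have "\<dots> = (2 * \<psi>) *\<^sub>R ?p' - y"
      using q by (simp add: linear_diff[OF linear_hsym] linear_scale[OF linear_hsym])
    finally have y2: "y2 = (2 * \<psi>) *\<^sub>R ?p' - y" .
    have y1: "y1 = (2 * \<phi>) *\<^sub>R ?p' - y" unfolding y1_def \<phi>_def hsym_def[of ?p'] ..
    have eq: "(2 * \<psi> - 2 * \<rho> * \<phi>) *\<^sub>R ?p' = (1 - \<rho>) *\<^sub>R y"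
      using y21 unfolding y1 y2 by (simp add: algebra_simps)
    have "\<psi> = \<phi>"
    proof (cases "\<rho> = 1")
      case True
      have "?p' \<noteq> 0" using hcone_pos[OF p'] by auto
      then show ?thesis using eq True by simp
    next
      case False
      define c where "c = (2 * \<psi> - 2 * \<rho> * \<phi>) / (1 - \<rho>)"
      have "(1 / (1 - \<rho>)) *\<^sub>R (1 - \<rho>) *\<^sub>R y = (1 / (1 - \<rho>)) *\<^sub>R (2 * \<psi> - 2 * \<rho> * \<phi>) *\<^sub>R ?p'" unfolding eq ..
      then have yc: "y = c *\<^sub>R ?p'" using False by (simp add: c_def)
      have "\<phi> = c" unfolding \<phi>_def yc by (simp add: cov_self p')
      moreover have "\<psi> = c" unfolding \<psi>_def yc using q by (simp add: linear_scale[OF linear_hsym] cov_self p)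
      ultimately show ?thesis by simp
    qed
    then show ?thesis by (simp add: \<psi>_def \<phi>_def)
  qed
  moreover have "linear (\<lambda>y. cov p \<bullet> hsym q y - cov ?p' \<bullet> y)"
    by (rule linearI) (simp_all add: linear_add[OF linear_hsym] linear_scale[OF linear_hsym] inner_add_right algebra_simps)
  ultimately have "cov p \<bullet> hsym q x - cov ?p' \<bullet> x = 0" using hcone_functional_zero by blast
  then show ?thesis by simp
qed

lemma cov_symmetric:
  assumes "p \<in> orbit" "x \<in> orbit"
  shows "cov p \<bullet> x = cov x \<bullet> p"
proof -
  obtain m where m: "m \<in> orbit" "hsym m p = x" by (rule orbit_midpoint[OF assms])
  show ?thesis using cov_equivariant[OF orbit_hcone[OF assms(1)] orbit_hcone[OF m(1)], of p] m(2) by simp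
qed

lemma span_orbit: "span orbit = UNIV"
proof -
  have "x \<in> span orbit" for x
  proof -
    have cs: "c \<in> span orbit" if c: "c \<in> hcone" for c
    proof -
      obtain t where t: "0 < t" "t *\<^sub>R c \<in> orbit" by (rule orbit_ray[OF c])
      have "(1 / t) *\<^sub>R t *\<^sub>R c \<in> span orbit" using t by (intro span_scale span_base)
      then show ?thesis using t by simp
    qed
    obtain e where e: "e > 0" "\<And>s. \<bar>s\<bar> \<le> e \<Longrightarrow> org + s *\<^sub>R x \<in> hcone"
      using open_small_multiple[OF open_hcone org_hcone] by blast
    have "(1 / e) *\<^sub>R ((org + e *\<^sub>R x) - org) \<in> span orbit"
      using e by (intro span_scale span_diff cs org_hcone) auto
    then show ?thesis using e(1) by simp
  qed
  then show ?thesis by auto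
qed

lemma linear_zero_if_zero_on_orbit:
  assumes "linear f" "\<And>x. x \<in> orbit \<Longrightarrow> f x = 0"
  shows "f x = 0"
proof (rule linear_eq_0_on_span[OF assms])
  show "x \<in> span orbit" by (simp add: span_orbit)
qed

text \<open>On the orbit \<open>cov\<close> is not known to be linear. Extend it linearly from a
  basis contained in the orbit: symmetry gives \<open>L p \<bullet> x = cov x \<bullet> p\<close>
  for basis vectors \<open>p\<close> and thus for all \<open>p\<close>; for \<open>p\<close> in the
  orbit, symmetry once more gives \<open>L p = cov p\<close>, because the orbit spans.\<close>

lemma form_exists:
  "\<exists>L. linear L \<and> (\<forall>x y. L x \<bullet> y = L y \<bullet> x) \<and> (\<forall>p\<in>orbit. L p = cov p)"
proof -
  obtain Bs where Bs: "Bs \<subseteq> orbit" "independent Bs" "orbit \<subseteq> span Bs"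
    using basis_exists[of orbit] by metis
  obtain L where L: "linear L" "\<And>b. b \<in> Bs \<Longrightarrow> L b = cov b"
    using linear_independent_extend[OF Bs(2), of cov] by blast
  have sp: "span Bs = UNIV" using Bs(3) span_orbit by (metis span_mono span_span top.extremum_unique)
  have Lc: "L p \<bullet> x = cov x \<bullet> p" if x: "x \<in> orbit" for p x
  proof -
    have lin: "linear (\<lambda>p. L p \<bullet> x - cov x \<bullet> p)"
      by (rule linearI) (simp_all add: linear_add[OF L(1)] linear_scale[OF L(1)] inner_add_left inner_add_right algebra_simps)
    have "L b \<bullet> x - cov x \<bullet> b = 0" if "b \<in> Bs" for b
      using L(2)[OF that] cov_symmetric[of b x] Bs(1) that x by auto
    then have "L p \<bullet> x - cov x \<bullet> p = 0" using linear_eq_0_on_span[OF lin, of Bs p] sp by auto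
    then show ?thesis by simp
  qed
  have Lp: "L p = cov p" if p: "p \<in> orbit" for p
  proof -
    have lin: "linear (\<lambda>x. (L p - cov p) \<bullet> x)" by (rule linearI) (simp_all add: inner_add_right)
    have "(L p - cov p) \<bullet> x = 0" if "x \<in> orbit" for x
      using Lc[OF that, of p] cov_symmetric[OF p that] by (simp add: inner_diff_left)
    then have "(L p - cov p) \<bullet> (L p - cov p) = 0" by (rule linear_zero_if_zero_on_orbit[OF lin])
    then show ?thesis by simp
  qed
  have "L x \<bullet> y = L y \<bullet> x" for x y
  proof -
    have lin: "linear (\<lambda>y. L x \<bullet> y - L y \<bullet> x)"
      by (rule linearI) (simp_all add: linear_add[OF L(1)] linear_scale[OF L(1)] inner_add_left inner_add_right algebra_simps)
    have "L x \<bullet> y - L y \<bullet> x = 0" if "y \<in> orbit" for y using Lc[OF that, of x] Lp[OF that] by simp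
    then have "L x \<bullet> y - L y \<bullet> x = 0" by (rule linear_zero_if_zero_on_orbit[OF lin])
    then show ?thesis by simp
  qed
  then show ?thesis using L(1) Lp by blast
qed

section \<open>The form and its signature\<close>

definition form_map :: "real ^ 'n option \<Rightarrow> real ^ 'n option" where
  "form_map = (SOME L. linear L \<and> (\<forall>x y. L x \<bullet> y = L y \<bullet> x) \<and> (\<forall>p\<in>orbit. L p = cov p))"

definition bil :: "real ^ 'n option \<Rightarrow> real ^ 'n option \<Rightarrow> real" where
  "bil x y = form_map x \<bullet> y"

lemma form_map: "linear form_map" "form_map x \<bullet> y = form_map y \<bullet> x" "p \<in> orbit \<Longrightarrow> form_map p = cov p"
proof -
  note * = someI_ex[OF form_exists, folded form_map_def]
  show "linear form_map" by (rule conjunct1[OF *])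
  show "form_map x \<bullet> y = form_map y \<bullet> x" using conjunct1[OF conjunct2[OF *]] by (elim allE)
  show "form_map p = cov p" if "p \<in> orbit" by (rule bspec[OF conjunct2[OF conjunct2[OF *]] that])
qed

lemma bil_add_left: "bil (x + x') y = bil x y + bil x' y"
  unfolding bil_def linear_add[OF form_map(1)] by (rule inner_add_left)

lemma bil_scale_left: "bil (t *\<^sub>R x) y = t * bil x y"
  unfolding bil_def linear_scale[OF form_map(1)] by (rule inner_scaleR_left)

lemma bil_commute: "bil x y = bil y x"
  unfolding bil_def by (rule form_map(2))

lemma bil_simps:
  "bil (x + x') y = bil x y + bil x' y" "bil x (y + y') = bil x y + bil x y'"
  "bil (x - x') y = bil x y - bil x' y" "bil x (y - y') = bil x y - bil x y'"
  "bil (t *\<^sub>R x) y = t * bil x y" "bil x (t *\<^sub>R y) = t * bil x y"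
proof -
  show "bil (x + x') y = bil x y + bil x' y" by (rule bil_add_left)
  show "bil x (y + y') = bil x y + bil x y'" unfolding bil_def by (rule inner_add_right)
  show "bil (x - x') y = bil x y - bil x' y"
    using bil_add_left[of "x - x'" x' y] by simp
  show "bil x (y - y') = bil x y - bil x y'" unfolding bil_def by (rule inner_diff_right)
  show "bil (t *\<^sub>R x) y = t * bil x y" by (rule bil_scale_left)
  show "bil x (t *\<^sub>R y) = t * bil x y" unfolding bil_def by (rule inner_scaleR_right)
qed

lemma bil_orbit: "p \<in> orbit \<Longrightarrow> bil p y = cov p \<bullet> y"
  by (simp add: bil_def form_map(3))

lemma bil_self: "p \<in> orbit \<Longrightarrow> bil p p = 1"
  by (simp add: bil_orbit cov_self orbit_hcone)

lemma hsym_orbit: "p \<in> orbit \<Longrightarrow> hsym p y = (2 * bil p y) *\<^sub>R p - y"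
  by (simp add: hsym_def bil_orbit)

text \<open>Reversed Cauchy-Schwarz inequality. Reflecting each vector in its successor continues
  \<open>x\<close>, \<open>p\<close> to the sequence \<open>x\<close>, \<open>p\<close>,
  \<open>2 a p - x\<close>, ... in the orbit, with \<open>a = bil p x\<close>. Its heights are
  positive and obey the recurrence of \<open>positive_recurrence_ge_1\<close>.\<close>

lemma bil_ge_1:
  assumes "p \<in> orbit" "x \<in> orbit"
  shows "1 \<le> bil p x"
proof -
  define a where "a = bil p x"
  \<comment> \<open>Pairs of consecutive members of this sequence.\<close>
  define Y where "Y k = ((\<lambda>(u, v). (v, (2 * a) *\<^sub>R v - u)) ^^ k) (x, p)" for k
  have inv: "fst (Y k) \<in> orbit \<and> snd (Y k) \<in> orbit \<and> bil (snd (Y k)) (fst (Y k)) = a" for k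
  proof (induction k)
    case 0 then show ?case using assms by (simp add: Y_def a_def)
  next
    case (Suc k)
    obtain u v where uv: "Y k = (u, v)" by (cases "Y k")
    then have YS: "Y (Suc k) = (v, (2 * a) *\<^sub>R v - u)" by (simp add: Y_def)
    have u: "u \<in> orbit" "v \<in> orbit" "bil v u = a" using Suc uv by auto
    have "(2 * a) *\<^sub>R v - u \<in> orbit"
      using orbit_hsym[OF orbit_hcone[OF u(2)] u(1)] hsym_orbit[OF u(2), of u] u(3) by simp
    moreover have "bil ((2 * a) *\<^sub>R v - u) v = a" using u by (simp add: bil_simps bil_self bil_commute[of u v])
    ultimately show ?case using u YS by simp
  qed
  show ?thesis unfolding a_def[symmetric]
  proof (rule positive_recurrence_ge_1[of "\<lambda>k. fst (Y k) $ None"])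
    show "0 < fst (Y k) $ None" for k using inv orbit_hcone hcone_pos by blast
    show "fst (Y (Suc (Suc k))) $ None = 2 * a * fst (Y (Suc k)) $ None - fst (Y k) $ None" for k
      by (cases "Y k") (simp add: Y_def)
  qed
qed

text \<open>Scaling \<open>p + e w\<close> into the orbit takes a factor \<open>t\<close> whose
  square times \<open>1 + e^2 bil w w\<close> is 1, while \<open>bil_ge_1\<close> against
  \<open>p\<close> gives \<open>t >= 1\<close>.\<close>

lemma bil_perp_nonpos:
  assumes "p \<in> orbit" "bil p w = 0"
  shows "bil w w \<le> 0"
proof -
  obtain e where e: "e > 0" "\<And>s. \<bar>s\<bar> \<le> e \<Longrightarrow> p + s *\<^sub>R w \<in> hcone"
    using open_small_multiple[OF open_hcone orbit_hcone[OF assms(1)]] by blast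
  then have "p + e *\<^sub>R w \<in> hcone" by simp
  then obtain t where t: "0 < t" "t *\<^sub>R (p + e *\<^sub>R w) \<in> orbit" by (rule orbit_ray)
  have "1 = bil (t *\<^sub>R (p + e *\<^sub>R w)) (t *\<^sub>R (p + e *\<^sub>R w))" using bil_self[OF t(2)] by simp
  also have "\<dots> = t\<^sup>2 * (1 + e\<^sup>2 * bil w w)"
    using assms bil_commute[of w p] by (simp add: bil_simps bil_self power2_eq_square algebra_simps)
  finally have 1: "t\<^sup>2 * (1 + e\<^sup>2 * bil w w) = 1" by simp
  have "1 \<le> bil p (t *\<^sub>R (p + e *\<^sub>R w))" by (rule bil_ge_1[OF assms(1) t(2)])
  then have "1 \<le> t" using assms by (simp add: bil_simps bil_self)
  then have t2: "1 \<le> t\<^sup>2" by simp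
  show ?thesis
  proof (rule ccontr)
    assume "\<not> bil w w \<le> 0"
    then have "e\<^sup>2 * bil w w > 0" using e(1) by simp
    then have "1 * 1 < t\<^sup>2 * (1 + e\<^sup>2 * bil w w)" using t2 by (intro mult_le_less_imp_less) auto
    then show False using 1 by simp
  qed
qed

text \<open>Isotropic vectors of a semidefinite form lie in its radical: along
  \<open>u' + s w\<close> the form is affine in \<open>s\<close> and at most 0, so its slope
  vanishes.\<close>

lemma bil_isotropic_radical:
  assumes "p \<in> orbit" "bil p w = 0" "bil w w = 0"
  shows "bil w u = 0"
proof -
  define u' where "u' = u - bil p u *\<^sub>R p"
  have pu: "bil p u' = 0" using assms(1) by (simp add: u'_def bil_simps bil_self)
  have "bil u' u' + 2 * s * bil w u' \<le> 0" for s
  proof -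
    have "bil p (u' + s *\<^sub>R w) = 0" using pu assms by (simp add: bil_simps)
    from bil_perp_nonpos[OF assms(1) this] show ?thesis
      using assms(3) bil_commute[of u' w] by (simp add: bil_simps algebra_simps)
  qed
  \<comment> \<open>At this \<open>s\<close> the affine expression would be 1.\<close>
  from this[of "(1 - bil u' u') / (2 * bil w u')"] have "bil w u' = 0" by (cases "bil w u' = 0") (auto simp: field_simps)
  then show ?thesis using assms(2) bil_commute[of w p] by (simp add: u'_def bil_simps)
qed

lemma orbit_if_bil_1:
  assumes "c \<in> hcone" "bil c c = 1"
  shows "c \<in> orbit"
proof -
  obtain t where t: "0 < t" "t *\<^sub>R c \<in> orbit" by (rule orbit_ray[OF assms(1)])
  have "t * t = 1" using bil_self[OF t(2)] assms(2) by (simp add: bil_simps)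
  then have "t = 1" using t(1) by (metis abs_of_pos abs_square_eq_1 power2_eq_square)
  then show ?thesis using t by simp
qed

text \<open>A partially degenerate form would give the stabilizer of the base point a shear
  \<open>x \<mapsto> x + l(x) w\<close>, whose powers are unbounded.\<close>

lemma form_not_mixed:
  assumes w: "bil org w = 0" "bil w w = 0" "w \<noteq> 0" and u: "bil org u = 0" "bil u u \<noteq> 0"
  shows False
proof -
  have wz: "bil w x = 0" "bil x w = 0" for x
    using bil_isotropic_radical[OF org_orbit w(1,2), of x] bil_commute[of x w] by simp_all
  obtain e where e: "e > 0" "\<And>s. \<bar>s\<bar> \<le> e \<Longrightarrow> org + s *\<^sub>R w \<in> hcone"
    using open_small_multiple[OF open_hcone org_hcone] by blast
  obtain \<delta> where \<delta>: "\<delta> > 0" "\<And>s. \<bar>s\<bar> \<le> \<delta> \<Longrightarrow> org + s *\<^sub>R u \<in> hcone"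
    using open_small_multiple[OF open_hcone org_hcone] by blast
  have "org + \<delta> *\<^sub>R u \<in> hcone" using \<delta> by simp
  then obtain t where t: "0 < t" "t *\<^sub>R (org + \<delta> *\<^sub>R u) \<in> orbit" by (rule orbit_ray)
  define q where "q = t *\<^sub>R (org + \<delta> *\<^sub>R u)"
  have q: "q \<in> orbit" using t by (simp add: q_def)
  obtain e' where e': "e' > 0" "\<And>s. \<bar>s\<bar> \<le> e' \<Longrightarrow> q + s *\<^sub>R w \<in> hcone"
    using open_small_multiple[OF open_hcone orbit_hcone[OF q]] by blast
  define b where "b = min e' (e / t)"
  have b: "b > 0" "\<bar>b\<bar> \<le> e'" "\<bar>b * t\<bar> \<le> e"
    using e e' t by (auto simp: b_def abs_mult min_def field_simps)
  define q' where "q' = q + b *\<^sub>R w"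
  \<comment> \<open>The shift of \<open>org\<close> has the extra factor
    \<open>t = bil q org\<close>, so that the two shears that make up \<open>g\<close> cancel at
    \<open>org\<close>.\<close>
  define o' where "o' = org + (b * t) *\<^sub>R w"
  have q': "q' \<in> orbit" unfolding q'_def
    by (rule orbit_if_bil_1[OF e'(2)[OF b(2)]]) (simp add: bil_simps wz bil_self q)
  have o': "o' \<in> orbit" unfolding o'_def
    by (rule orbit_if_bil_1[OF e(2)[OF b(3)]]) (simp add: bil_simps wz bil_self org_orbit)
  define g where "g = (hsym q \<circ> hsym q') \<circ> (hsym o' \<circ> hsym org)"
  have g: "g \<in> hgroup" unfolding g_def by (intro hgroup_comp hgroup_hsym orbit_hcone q q' o' org_orbit)
  have bo': "bil o' x = bil org x" and bq': "bil q' x = bil q x" for x by (simp_all add: o'_def q'_def bil_simps wz)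
  have s1: "hsym o' (hsym org x) = x + (2 * (b * t) * bil org x) *\<^sub>R w" for x
    unfolding hsym_orbit[OF o'] hsym_orbit[OF org_orbit] bo'
    by (simp add: bil_simps bil_self[OF org_orbit] o'_def algebra_simps)
  have s2: "hsym q (hsym q' x) = x - (2 * b * bil q x) *\<^sub>R w" for x
    unfolding hsym_orbit[OF q'] hsym_orbit[OF q] bq'
    by (simp add: bil_simps bil_self[OF q] q'_def wz algebra_simps)
  define l where "l x = 2 * b * (t * bil org x - bil q x)" for x
  have gx: "g x = x + l x *\<^sub>R w" for x
    unfolding g_def l_def by (simp add: s1 s2 bil_simps wz algebra_simps)
  have lx: "l x = - 2 * b * t * \<delta> * bil u x" for x
    unfolding l_def q_def by (simp add: bil_simps algebra_simps)
  have lw: "l w = 0" by (simp add: lx wz)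
  have ladd: "l (x + c *\<^sub>R w) = l x" for x c by (simp add: lx bil_simps wz)
  have gm: "(g ^^ m) x = x + (real m * l x) *\<^sub>R w" for m x
  proof (induction m)
    case (Suc m) then show ?case by (simp add: gx ladd algebra_simps)
  qed simp
  have "l org = 0" using u(1) bil_commute[of u org] by (simp add: lx)
  then have fixd: "(g ^^ m) org = 1 *\<^sub>R org" for m by (simp add: gm)
  obtain K where K: "\<And>g \<kappa> v. g \<in> hgroup \<Longrightarrow> \<kappa> > 0 \<Longrightarrow> g org = \<kappa> *\<^sub>R org \<Longrightarrow> norm (g v) \<le> K * \<kappa> * norm v"
    using stabilizer_bounded[OF base_in] unfolding org_def by blast
  have lu: "l u \<noteq> 0" using b t \<delta> u(2) by (simp add: lx)
  have "real m * (\<bar>l u\<bar> * norm w) \<le> K * norm u + norm u" for m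
  proof -
    have "norm ((g ^^ m) u) \<le> K * 1 * norm u" by (rule K[OF hgroup_funpow[OF g] _ fixd]) simp
    moreover have "norm ((real m * l u) *\<^sub>R w) \<le> norm ((g ^^ m) u) + norm u"
      using norm_triangle_ineq4[of "(g ^^ m) u" u] by (simp add: gm)
    ultimately show ?thesis by (simp add: abs_mult mult.assoc)
  qed
  moreover obtain m where "K * norm u + norm u < real m * (\<bar>l u\<bar> * norm w)"
    using ex_less_of_nat_mult[of "\<bar>l u\<bar> * norm w" "K * norm u + norm u"] lu w(3) by auto
  ultimately show False by (meson not_less)
qed

text \<open>The form is the square of the functional \<open>bil org\<close>, which is 1 on the
  orbit. Reflections double displacements in its kernel, so the orbit contains
  \<open>org + w\<close> for every \<open>w\<close> in the kernel. Heights are positive on the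
  orbit, hence 0 on the kernel; thus \<open>bil org\<close> is the height and the orbit is the
  hyperplane of height 1.\<close>

lemma flat_case:
  assumes "\<And>w. bil org w = 0 \<Longrightarrow> bil w w = 0"
  shows "M = UNIV" and "reflect p x = 2 *\<^sub>R p - x"
proof -
  have dec: "bil x y = bil org x * bil org y" for x y
  proof -
    define w where "w = x - bil org x *\<^sub>R org"
    have "bil org w = 0" using bil_self[OF org_orbit] by (simp add: w_def bil_simps)
    then have "bil w y = 0" using bil_isotropic_radical[OF org_orbit] assms by blast
    then show ?thesis using bil_commute[of y org] by (simp add: w_def bil_simps)
  qed
  have one: "bil org p = 1" if "p \<in> orbit" for p
  proof -
    have "bil org p * bil org p = 1" using bil_self[OF that] dec[of p p] by simp
    then show ?thesis using bil_ge_1[OF org_orbit that] by (metis abs_of_nonneg abs_square_eq_1 power2_eq_square order_trans zero_le_one)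
  qed
  have dbl: "org + 2 *\<^sub>R w \<in> orbit" if "org + w \<in> orbit" for w
  proof -
    have "hsym (org + w) org = org + 2 *\<^sub>R w"
      using hsym_orbit[OF that] one[OF that] bil_commute[of "org + w" org] by (simp add: scaleR_add_right scaleR_2)
    then show ?thesis using orbit_hsym[OF orbit_hcone[OF that] org_orbit] by simp
  qed
  have all: "org + w \<in> orbit" if w: "bil org w = 0" for w
  proof -
    obtain e where e: "e > 0" "\<And>s. \<bar>s\<bar> \<le> e \<Longrightarrow> org + s *\<^sub>R w \<in> hcone"
      using open_small_multiple[OF open_hcone org_hcone] by blast
    have wz: "bil w y = 0" "bil y w = 0" for y using dec[of w y] dec[of y w] w by simp_all
    \<comment> \<open>A small multiple of \<open>w\<close> stays in the cone; \<open>k\<close>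
      doublings restore \<open>w\<close>.\<close>
    obtain k where k: "(1/2) ^ k < e" using real_arch_pow_inv[OF e(1), of "1/2"] by auto
    have "org + (1/2) ^ k *\<^sub>R w \<in> orbit"

    proof (rule orbit_if_bil_1)
      show "org + (1/2) ^ k *\<^sub>R w \<in> hcone" using k by (intro e(2)) simp
      show "bil (org + (1/2) ^ k *\<^sub>R w) (org + (1/2) ^ k *\<^sub>R w) = 1" by (simp add: bil_simps bil_self[OF org_orbit] wz)
    qed
    moreover have "org + (2 ^ i * (1/2) ^ k) *\<^sub>R w \<in> orbit" if "org + (1/2) ^ k *\<^sub>R w \<in> orbit" for i
    proof (induction i)
      case (Suc i) from dbl[OF this] show ?case by (simp add: mult.assoc)
    qed (use that in simp)
    ultimately have "org + (2 ^ k * (1/2) ^ k) *\<^sub>R w \<in> orbit" by blast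
    then show ?thesis by (simp add: power_mult_distrib[symmetric])
  qed
  have last0: "w $ None = 0" if w: "bil org w = 0" for w
  proof (rule ccontr)
    assume n: "w $ None \<noteq> 0"
    \<comment> \<open>This multiple of \<open>w\<close> would bring \<open>org\<close> down to
      height 0.\<close>
    have "org + (- 1 / w $ None) *\<^sub>R w \<in> orbit" using w by (intro all) (simp only: bil_simps mult_zero_right)
    from hcone_pos[OF orbit_hcone[OF this]] show False using n by (simp add: org_def)
  qed
  have bo: "bil org x = x $ None" for x
  proof -
    have "bil org (x - bil org x *\<^sub>R org) = 0" by (simp add: bil_simps bil_self[OF org_orbit])
    from last0[OF this] show ?thesis by (simp add: org_def)
  qed
  have hato: "hat y \<in> orbit" for y
  proof -
    have "bil org (emb (y - base)) = 0" by (simp add: bo)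
    from all[OF this] show ?thesis unfolding org_def hat_add[symmetric] by simp
  qed
  have hatM: "y \<in> M" for y
    using prj_hcone[OF orbit_hcone[OF hato[of y]]] by simp
  then show "M = UNIV" by auto
  have "bil (hat p) (hat x) = 1" using dec[of "hat p" "hat x"] by (simp add: bo)
  then have "hsym (hat p) (hat x) = hat (2 *\<^sub>R p - x)"
    unfolding hsym_orbit[OF hato] by (simp add: vec_option_eq_iff)
  then show "reflect p x = 2 *\<^sub>R p - x"
    using hsym_hcone(2)[OF orbit_hcone[OF hato[of p]] orbit_hcone[OF hato[of x]]] by simp
qed

end

section \<open>The flat case\<close>

lemma additive_continuous_real:
  fixes f :: "real \<Rightarrow> real"
  assumes add: "\<And>x y. f (x + y) = f x + f y" and cont: "continuous_on UNIV f"
  shows "f x = x * f 1"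
proof -
  have f0: "f 0 = 0" using add[of 0 0] by simp
  have fneg: "f (- x) = - f x" for x using add[of x "- x"] f0 by simp
  have fnat: "f (real n * x) = real n * f x" for n x
    by (induction n) (simp_all add: f0 add distrib_right)
  have fint: "f (of_int k * x) = of_int k * f x" for k x
  proof (cases k rule: int_cases2)
    case (nonneg n) then show ?thesis using fnat by simp
  next
    case (nonpos n) then show ?thesis using fnat[of n x] fneg[of "real n * x"] by simp
  qed
  have rat: "f q - q * f 1 = 0" if "q \<in> \<rat>" for q
  proof -
    obtain a b where q: "q = of_int a / of_int b" "b > 0" using \<open>q \<in> \<rat>\<close> by (metis Rats_cases')
    have "of_int b * f q = f (of_int b * q)" by (rule fint[symmetric])
    also have "of_int b * q = of_int a * 1" using q by simp
    also have "f (of_int a * 1) = of_int a * f 1" by (rule fint)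
    finally have "of_int b * f q = of_int a * f 1" .
    moreover have "of_int a = of_int b * q" using q by simp
    ultimately have "of_int b * (f q - q * f 1) = 0" by (simp only: right_diff_distrib mult.assoc diff_self)
    then show ?thesis using q(2) by (simp only: mult_eq_0_iff of_int_eq_0_iff) auto
  qed
  have "f x - x * f 1 = 0"
  proof (rule continuous_constant_on_closure[of \<rat> "\<lambda>x. f x - x * f 1" 0])
    show "continuous_on (closure \<rat>) (\<lambda>x. f x - x * f 1)"
      by (intro continuous_intros continuous_on_subset[OF cont]) auto
    show "x \<in> closure \<rat>" by (simp add: Rats_closure_real)
  qed (rule rat)
  then show ?thesis by (rule iffD1[OF right_minus_eq])
qed

context straight_projective_metric_space
begin

text \<open>In a chart the coordinate of the curve satisfies Jensen's equation, whose continuous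
  solutions are affine. This gives homogeneity of the norm in the flat case and constant speed along
  hyperbolic lines.\<close>

lemma reflecting_curve_speed:
  fixes \<gamma> :: "real \<Rightarrow> real ^ 'n"
  assumes x: "x \<in> M" and v: "v \<noteq> 0" and line: "\<And>s. \<gamma> s = x + \<tau> s *\<^sub>R v" and \<gamma>M: "\<And>s. \<gamma> s \<in> M"
    and cont: "continuous_on UNIV \<gamma>"
    and sym: "\<And>r s. reflect (\<gamma> s) (\<gamma> r) = \<gamma> (2 * s - r)"
  shows "\<exists>c. \<forall>r s. d (\<gamma> r) (\<gamma> s) = c * \<bar>r - s\<bar>"
proof -
  obtain \<phi> where ch: "line_chart x v \<phi>" using line_chart_exists[OF x v] by blast
  note \<phi> = line_chartD[OF ch]
  have dom: "\<tau> s \<in> line_dom x v" for s using \<gamma>M[of s] by (simp add: line_dom_mem line)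
  define \<psi> where "\<psi> s = \<phi> (\<tau> s)" for s
  have d\<psi>: "d (\<gamma> r) (\<gamma> s) = \<bar>\<psi> r - \<psi> s\<bar>" for r s
    unfolding line \<psi>_def by (rule \<phi>(5)[OF dom dom])
  have \<psi>sym: "\<psi> (2 * s - r) = 2 * \<psi> s - \<psi> r" for r s
  proof -
    obtain w where w: "w \<in> line_dom x v" "reflect (x + \<tau> s *\<^sub>R v) (x + \<tau> r *\<^sub>R v) = x + w *\<^sub>R v" "\<phi> w = 2 * \<phi> (\<tau> s) - \<phi> (\<tau> r)"
      by (rule chart_reflect[OF ch dom dom])
    have "x + \<tau> (2 * s - r) *\<^sub>R v = x + w *\<^sub>R v"
      by (rule trans[OF sym[of s r, unfolded line, symmetric] w(2)])
    then have "\<tau> (2 * s - r) = w" using v by simp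
    then show ?thesis using w(3) by (simp add: \<psi>_def)
  qed
  have \<psi>cont: "continuous_on UNIV \<psi>"
    unfolding continuous_on_def
  proof
    fix s
    have "(\<gamma> \<longlongrightarrow> \<gamma> s) (at s)" using cont by (simp add: continuous_on_def)
    then have "((\<lambda>t. d (\<gamma> t) (\<gamma> s)) \<longlongrightarrow> d (\<gamma> s) (\<gamma> s)) (at s)"
      by (intro tendsto_d tendsto_const \<gamma>M)
    then have "((\<lambda>t. \<bar>\<psi> t - \<psi> s\<bar>) \<longlongrightarrow> 0) (at s)" unfolding d\<psi> by simp
    then show "(\<psi> \<longlongrightarrow> \<psi> s) (at s within UNIV)" by (simp add: tendsto_rabs_zero_iff LIM_zero_iff)
  qed
  define f where "f s = \<psi> s - \<psi> 0" for s
  have "f (a + b) = f a + f b" for a b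
  proof -
    have "\<psi> a = 2 * \<psi> ((a + b) / 2) - \<psi> b"
    proof -
      have "2 * ((a + b) / 2) - b = a" by (simp add: field_simps)
      from \<psi>sym[of "(a + b) / 2" b, unfolded this] show ?thesis .
    qed
    moreover have "\<psi> (a + b) = 2 * \<psi> ((a + b) / 2) - \<psi> 0"
    proof -
      have "2 * ((a + b) / 2) - 0 = a + b" by (simp add: field_simps)
      from \<psi>sym[of "(a + b) / 2" 0, unfolded this] show ?thesis .
    qed
    ultimately show ?thesis by (simp add: f_def)
  qed
  moreover have "continuous_on UNIV f" unfolding f_def by (intro continuous_intros \<psi>cont)
  ultimately have lin: "f s = s * f 1" for s by (rule additive_continuous_real)
  have "d (\<gamma> r) (\<gamma> s) = \<bar>f 1\<bar> * \<bar>r - s\<bar>" for r s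
  proof -
    have "\<psi> r - \<psi> s = f 1 * (r - s)" using lin[of r] lin[of s] by (simp add: f_def algebra_simps)
    then show ?thesis unfolding d\<psi> by (simp add: abs_mult)
  qed
  then show ?thesis by blast
qed

text \<open>Two affine reflections compose to a translation, so \<open>d\<close> comes from the norm
  \<open>N v = d 0 v\<close>. Strict convexity rests on the axiom that geodesic lines are straight:
  a segment in the unit sphere would admit a geodesic line with a corner.\<close>

lemma minkowski_geometry_if_affine_reflections:
  assumes U: "M = UNIV" and c: "\<And>x. center M d x" and refl: "\<And>p x. reflect p x = 2 *\<^sub>R p - x"
  shows "minkowski_geometry M d"
proof -
  define N where "N v = d 0 v" for v
  have inM [simp]: "x \<in> M" for x by (simp add: U)
  have trans: "d (x + w) (y + w) = d x y" for x y w
  proof -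
    have "x + w = reflect ((1/2) *\<^sub>R w) (reflect 0 x)" "y + w = reflect ((1/2) *\<^sub>R w) (reflect 0 y)" by (simp_all add: refl)
    then show ?thesis using center_dist[OF c] by simp
  qed
  have dN: "d x y = N (y - x)" for x y using trans[of 0 x "y - x"] by (simp add: N_def)
  have Nneg: "N (- v) = N v" for v using dN[of v 0] commute[of v 0] by (simp add: N_def)
  have N0: "N v = 0 \<longleftrightarrow> v = 0" for v unfolding N_def by (metis inM zero)
  have Nnn: "0 \<le> N v" for v by (simp add: N_def)
  have Nscale: "N (t *\<^sub>R v) = \<bar>t\<bar> * N v" for t v
  proof (cases "v = 0")
    case False
    have "\<exists>c. \<forall>r s. d (r *\<^sub>R v) (s *\<^sub>R v) = c * \<bar>r - s\<bar>"
    proof (rule reflecting_curve_speed[of 0 v _ "\<lambda>s. s"])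
      show "continuous_on UNIV (\<lambda>s. s *\<^sub>R v)" by (intro continuous_intros)
      show "reflect (s *\<^sub>R v) (r *\<^sub>R v) = (2 * s - r) *\<^sub>R v" for r s by (simp add: refl algebra_simps)
    qed (use False in auto)
    then obtain c where c: "\<And>r s. d (r *\<^sub>R v) (s *\<^sub>R v) = c * \<bar>r - s\<bar>" by blast
    have "N v = c" using c[of 0 1] by (simp add: N_def)
    then show ?thesis using c[of 0 t] by (simp add: N_def)
  qed (simp add: N0)
  have Ntri: "N (v + w) \<le> N v + N w" for v w
    using triangle[of 0 v "v + w"] dN[of v "v + w"] by (simp add: N_def)
  have Ncont: "continuous_on UNIV N" unfolding N_def by (intro continuous_on_d continuous_intros) auto
  define I where "I = {v. N v < 1}"
  have cl: "N v \<le> 1" if "v \<in> closure I" for v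
  proof -
    have "closed {v. N v \<le> 1}" using Ncont by (intro closed_Collect_le continuous_intros)
    then have "closure I \<subseteq> {v. N v \<le> 1}" by (intro closure_minimal) (auto simp: I_def)
    then show ?thesis using that by auto
  qed
  have comb: "N ((1 - t) *\<^sub>R x + t *\<^sub>R y) \<le> (1 - t) * N x + t * N y" if "0 \<le> t" "t \<le> 1" for t x y
    using Ntri[of "(1 - t) *\<^sub>R x" "t *\<^sub>R y"] that by (simp add: Nscale)
  have strict: "(1 - t) *\<^sub>R x + t *\<^sub>R y \<in> I" if xy: "N x \<le> 1" "N y \<le> 1" "x \<noteq> y" and t: "0 < t" "t < 1" for x y t
  proof (rule ccontr)
    let ?p = "\<lambda>s. (1 - s) *\<^sub>R x + s *\<^sub>R y"
    assume "?p t \<notin> I"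
    then have z: "1 \<le> N (?p t)" by (simp add: I_def)
    have le1: "N (?p s) \<le> 1" if s: "0 \<le> s" "s \<le> 1" for s
    proof -
      have "(1 - s) * N x + s * N y \<le> (1 - s) * 1 + s * 1" using s xy by (intro add_mono mult_left_mono) auto
      then show ?thesis using comb[OF s, of x y] by simp
    qed
    \<comment> \<open>A convex function bounded by 1 on the segment that attains 1 at an inner
      \<open>t\<close> is constantly 1: \<open>t\<close> lies between \<open>s\<close> and the
      endpoint \<open>q\<close> on its far side.\<close>
    have one: "N (?p s) = 1" if s: "0 \<le> s" "s \<le> 1" for s
    proof (cases "s = t")
      case True then show ?thesis using z le1[OF s] by simp
    next
      case False
      define q :: real where "q = (if s < t then 1 else 0)"
      define l where "l = (t - s) / (q - s)"
      have qs: "q - s \<noteq> 0" and l: "0 < l" "l < 1" using False s t by (auto simp: q_def l_def field_simps)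
      have "l * (q - s) = t - s" using qs by (simp add: l_def)
      then have tl: "t = (1 - l) * s + l * q" by (simp add: algebra_simps)
      have "?p t = (1 - l) *\<^sub>R ?p s + l *\<^sub>R ?p q" unfolding tl by (simp add: algebra_simps)
      then have "1 \<le> (1 - l) * N (?p s) + l * N (?p q)" using z comb[of l "?p s" "?p q"] l by simp
      moreover have "l * N (?p q) \<le> l * 1" using l le1[of q] by (intro mult_left_mono) (auto simp: q_def)
      ultimately have "(1 - l) * 1 \<le> (1 - l) * N (?p s)" by simp
      then have "1 \<le> N (?p s)" using l by (simp only: mult_le_cancel_left)
      then show ?thesis using le1[OF s] by simp
    qed
    have Nx: "N x = 1" and Ny: "N y = 1" using one[of 0] one[of 1] by simp_all
    \<comment> \<open>The broken line made of the rays from 0 through \<open>- x\<close> and through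
      \<open>y\<close>. Differences across the corner are positive multiples of points of the
      segment from \<open>x\<close> to \<open>y\<close>, where \<open>N\<close> is 1, so the
      parameter is arc length.\<close>
    define \<gamma> where "\<gamma> s = (if s \<le> 0 then s *\<^sub>R x else s *\<^sub>R y)" for s :: real
    have lt: "d (\<gamma> r) (\<gamma> s) = \<bar>r - s\<bar>" if rs: "r \<le> s" for r s
    proof -
      consider "s \<le> 0" | "0 < r" | "r \<le> 0" "0 < s" by linarith
      then show ?thesis
      proof cases
        case 1
        then have "\<gamma> s - \<gamma> r = (s - r) *\<^sub>R x" using rs by (simp add: \<gamma>_def algebra_simps)
        then show ?thesis unfolding dN by (simp add: Nscale Nx)
      next
        case 2
        then have "\<gamma> s - \<gamma> r = (s - r) *\<^sub>R y" using rs by (simp add: \<gamma>_def algebra_simps)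
        then show ?thesis unfolding dN by (simp add: Nscale Ny)
      next
        case 3
        define l where "l = s / (s - r)"
        have l: "0 \<le> l" "l \<le> 1" using 3 by (auto simp: l_def field_simps)
        have ls: "(s - r) * l = s" "(s - r) * (1 - l) = - r" using 3 by (auto simp: l_def field_simps)
        have "(s - r) *\<^sub>R ?p l = ((s - r) * (1 - l)) *\<^sub>R x + ((s - r) * l) *\<^sub>R y" by (simp add: scaleR_add_right)
        then have "\<gamma> s - \<gamma> r = (s - r) *\<^sub>R ?p l" unfolding ls using 3 by (simp add: \<gamma>_def)
        then show ?thesis unfolding dN using one[OF l] 3 by (simp add: Nscale)
      qed
    qed
    have iso: "d (\<gamma> r) (\<gamma> s) = \<bar>r - s\<bar>" for r s
      using lt[of r s] lt[of s r] commute[of "\<gamma> r" "\<gamma> s"] by (cases "r \<le> s") (auto simp: abs_minus_commute)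
    have "geodesic_line M d (range \<gamma>)"
      unfolding geodesic_line_def using iso by (intro exI[of _ \<gamma>]) (auto intro: exI[of _ 1])
    then obtain l where l: "straight_line l" "range \<gamma> = l" unfolding geodesic_line_iff by (auto simp: U)
    have "\<gamma> 0 \<in> l" "\<gamma> 1 \<in> l" "\<gamma> (-1) \<in> l" using l(2) by blast+
    then have mem: "0 \<in> l" "y \<in> l" "- x \<in> l" by (simp_all add: \<gamma>_def)
    have y0: "y \<noteq> 0" using Ny N0[of y] by auto
    have "l = affine hull {0, y}" using straight_line_eq_affine_hull[OF l(1) mem(1,2)] y0 by simp
    \<comment> \<open>The broken line is straight only if \<open>- x\<close> is a multiple of
      \<open>y\<close>. Equal norms and \<open>x \<noteq> y\<close> leave \<open>x = - y\<close>,
      and then inner points of the segment have norm below 1.\<close>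
    then obtain k where k: "- x = k *\<^sub>R y" using mem(3) affine_hull_pair_param[of 0 y] by auto
    then have "\<bar>k\<bar> = 1" using Nneg[of x] Nscale[of k y] Nx Ny by simp
    moreover have "k \<noteq> -1" using k xy(3) by auto
    ultimately have xy': "x = - y" using k by (metis abs_if minus_equation_iff minus_minus scaleR_one)
    have "?p t = (t - (1 - t)) *\<^sub>R y"
      unfolding xy' scaleR_minus_right scaleR_diff_left[of t "1 - t"] by (rule uminus_add_conv_diff)
    moreover have "N ((t - (1 - t)) *\<^sub>R y) = \<bar>t - (1 - t)\<bar>" unfolding Nscale Ny by simp
    ultimately have "\<bar>t - (1 - t)\<bar> = 1" using one[of t] t by simp
    then show False using t by linarith
  qed
  have "indicatrix I"
    unfolding indicatrix_def
  proof (intro conjI ballI impI)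
    show "open I" unfolding I_def using Ncont by (intro open_Collect_less continuous_intros)
    have "0 \<in> I" using N0[of 0] by (simp add: I_def)
    then show "I \<noteq> {}" by blast
    show "bounded I"
    proof -
      obtain m where m: "m > 0" "\<And>y. d 0 y < m \<Longrightarrow> dist 0 y < 1" using near_if_d_small[of 0 1] by auto
      have "norm v \<le> 1 / m" if "v \<in> I" for v
      proof -
        have "N (m *\<^sub>R v) < m" using that m(1) by (simp add: Nscale I_def)
        then have "d 0 (m *\<^sub>R v) < m" by (simp add: N_def)
        from m(2)[OF this] have "m * norm v < 1" using m(1) by simp
        then show ?thesis using m(1) by (simp add: field_simps)
      qed
      then show ?thesis unfolding bounded_iff by blast
    qed
    show "uminus ` I = I"
    proof -
      have "- v \<in> I" if "v \<in> I" for v using that by (simp add: I_def Nneg)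
      then show ?thesis by force
    qed
    fix x y assume xy: "x \<in> closure I" "y \<in> closure I" "x \<noteq> y"
    show "open_segment x y \<subseteq> I"
    proof
      fix z assume "z \<in> open_segment x y"
      then obtain t where "0 < t" "t < 1" "z = (1 - t) *\<^sub>R x + t *\<^sub>R y" by (auto simp: in_segment)
      then show "z \<in> I" using strict[OF cl[OF xy(1)] cl[OF xy(2)] xy(3)] by simp
    qed
  qed
  moreover have "minkowski_dist I x y = d x y" for x y
  proof -
    have "{r. 0 < r \<and> (y - x) /\<^sub>R r \<in> I} = {N (y - x)<..}"
    proof (intro set_eqI iffI)
      fix r assume "r \<in> {r. 0 < r \<and> (y - x) /\<^sub>R r \<in> I}"
      then have r: "0 < r" "inverse r * N (y - x) < 1" by (auto simp: I_def Nscale)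
      then show "r \<in> {N (y - x)<..}" by (simp add: field_simps)
    next
      fix r assume "r \<in> {N (y - x)<..}"
      then have r: "0 < r" "N (y - x) < r" using Nnn[of "y - x"] by simp_all
      have "N ((y - x) /\<^sub>R r) = N (y - x) / r" unfolding Nscale using r(1) by (simp add: divide_inverse)
      also have "\<dots> < 1" using r by simp
      finally show "r \<in> {r. 0 < r \<and> (y - x) /\<^sub>R r \<in> I}" using r(1) unfolding I_def by blast
    qed
    then show ?thesis unfolding minkowski_dist_def dN by simp
  qed
  then have "isometric_spaces M d UNIV (minkowski_dist I)"
    unfolding isometric_spaces_def isometry_between_def by (intro exI[of _ id]) (auto simp: U)
  ultimately show ?thesis unfolding minkowski_geometry_def by blast
qed

end

section \<open>The hyperboloid and the Hilbert metric of the ball\<close>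

text \<open>The Lorentz form, with the time coordinate second. On the upper sheet
  \<open>hyperboloid\<close> it is the cosh of the hyperbolic distance; \<open>klein\<close>
  projects this sheet centrally to the unit ball and \<open>lift\<close> is its inverse.\<close>

definition lor :: "('a::euclidean_space \<times> real) \<Rightarrow> ('a \<times> real) \<Rightarrow> real" where
  "lor p q = snd p * snd q - fst p \<bullet> fst q"

definition hyperboloid :: "('a::euclidean_space \<times> real) set" where
  "hyperboloid = {p. 0 < snd p \<and> lor p p = 1}"

definition klein :: "('a::euclidean_space \<times> real) \<Rightarrow> 'a" where
  "klein p = fst p /\<^sub>R snd p"

definition lift :: "'a::euclidean_space \<Rightarrow> ('a \<times> real)" where
  "lift y = (1 / sqrt (1 - (norm y)\<^sup>2)) *\<^sub>R (y, 1)"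

lemma lor_simps:
  "lor (p + p') q = lor p q + lor p' q" "lor p (q + q') = lor p q + lor p q'"
  "lor (p - p') q = lor p q - lor p' q" "lor p (q - q') = lor p q - lor p q'"
  "lor (t *\<^sub>R p) q = t * lor p q" "lor p (t *\<^sub>R q) = t * lor p q"
  by (simp_all add: lor_def inner_add_left inner_add_right inner_diff_left inner_diff_right algebra_simps)

lemma lor_commute: "lor p q = lor q p"
  by (simp add: lor_def inner_commute)

lemma lor_self: "lor p p = (snd p)\<^sup>2 - (norm (fst p))\<^sup>2"
  unfolding lor_def power2_norm_eq_inner by (simp add: power2_eq_square)

lemma norm_lt_1_sq: "norm (y :: 'a::real_normed_vector) < 1 \<longleftrightarrow> 0 < 1 - (norm y)\<^sup>2"
  by (simp add: abs_square_less_1)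

lemma lift_hyperboloid:
  fixes y :: "'a::euclidean_space"
  assumes "norm y < 1"
  shows "lift y \<in> hyperboloid" "klein (lift y) = y"
proof -
  define s where "s = sqrt (1 - (norm y)\<^sup>2)"
  have s: "s > 0" "s * s = 1 - (norm y)\<^sup>2" using assms by (auto simp: s_def norm_lt_1_sq)
  have "lor (lift y) (lift y) = (1 - (norm y)\<^sup>2) / (s * s)"
    unfolding lift_def s_def[symmetric] by (simp add: lor_def power2_norm_eq_inner diff_divide_distrib field_simps)
  moreover have "s * s \<noteq> 0" using s(1) by simp
  ultimately have "lor (lift y) (lift y) = 1" unfolding s(2)[symmetric] by simp
  moreover have "snd (lift y) > 0" unfolding lift_def s_def[symmetric] using s by simp
  ultimately show "lift y \<in> hyperboloid" by (simp add: hyperboloid_def)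
  show "klein (lift y) = y" unfolding lift_def klein_def s_def[symmetric] using s by simp
qed

lemma hyperboloid_snd:
  assumes "p \<in> hyperboloid"
  shows "0 < snd p" "(snd p)\<^sup>2 = 1 + (norm (fst p))\<^sup>2"
proof -
  have "lor p p = 1" "0 < snd p" using assms unfolding hyperboloid_def by blast+
  then show "0 < snd p" "(snd p)\<^sup>2 = 1 + (norm (fst p))\<^sup>2" using lor_self[of p] by linarith+
qed

lemma klein_hyperboloid:
  fixes p :: "'a::euclidean_space \<times> real"
  assumes "p \<in> hyperboloid"
  shows "norm (klein p) < 1" "lift (klein p) = p"
proof -
  note s = hyperboloid_snd[OF assms]
  have "(norm (klein p))\<^sup>2 = (norm (fst p))\<^sup>2 / (snd p)\<^sup>2"
    using s(1) by (simp add: klein_def power_mult_distrib power_divide divide_inverse power_inverse)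
  also have "\<dots> = ((snd p)\<^sup>2 - 1) / (snd p)\<^sup>2" unfolding s(2) by simp
  finally have n: "1 - (norm (klein p))\<^sup>2 = 1 / (snd p)\<^sup>2" using s(1) by (simp add: field_simps)
  then show "norm (klein p) < 1" unfolding norm_lt_1_sq using s(1) by simp
  have "sqrt (1 - (norm (klein p))\<^sup>2) = 1 / snd p" unfolding n using s(1) by (simp add: real_sqrt_divide)
  then show "lift (klein p) = p" using s(1) by (simp add: lift_def klein_def prod_eq_iff)
qed

lemma lor_lift:
  assumes "norm y < 1" "norm z < 1"
  shows "lor (lift y) (lift z) * (sqrt (1 - (norm y)\<^sup>2) * sqrt (1 - (norm z)\<^sup>2)) = 1 - y \<bullet> z"
proof -
  have "sqrt (1 - (norm y)\<^sup>2) > 0" "sqrt (1 - (norm z)\<^sup>2) > 0" using assms by (auto simp: norm_lt_1_sq)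
  then show ?thesis by (simp add: lift_def lor_def field_simps)
qed

lemma norm_fst_less_snd:
  assumes "p \<in> hyperboloid" shows "norm (fst p) < snd p"
proof -
  have "(norm (fst p))\<^sup>2 < (snd p)\<^sup>2" using hyperboloid_snd(2)[OF assms] by simp
  then show ?thesis using hyperboloid_snd(1)[OF assms] by (simp add: power_less_imp_less_base)
qed

text \<open>With \<open>a\<close>, \<open>b\<close> the norms of the space components, the squared
  product of the time components is the square of \<open>1 + a b\<close> plus the square of
  \<open>a - b\<close>, and the space components subtract at most \<open>a b\<close>. Equality
  forces equal space components.\<close>

lemma lor_ge_1:
  assumes p: "p \<in> hyperboloid" and q: "q \<in> hyperboloid"
  shows "1 \<le> lor p q" and "lor p q = 1 \<Longrightarrow> p = q"
proof -
  let ?a = "norm (fst p)" and ?b = "norm (fst q)" and ?t = "snd p" and ?u = "snd q"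
  note sp = hyperboloid_snd[OF p] and sq = hyperboloid_snd[OF q]
  have sqeq: "(?t * ?u)\<^sup>2 = (1 + ?a * ?b)\<^sup>2 + (?a - ?b)\<^sup>2"
    unfolding power_mult_distrib sp(2) sq(2) by (simp add: power2_eq_square algebra_simps)
  have nn: "0 \<le> 1 + ?a * ?b" by (simp add: add_nonneg_nonneg)
  have tu: "0 < ?t * ?u" using sp sq by simp
  have "(1 + ?a * ?b)\<^sup>2 \<le> (?t * ?u)\<^sup>2" unfolding sqeq by simp
  then have 1: "1 + ?a * ?b \<le> ?t * ?u" by (rule power2_le_imp_le) (use tu in simp)
  have 2: "fst p \<bullet> fst q \<le> ?a * ?b" by (rule norm_cauchy_schwarz)
  show "1 \<le> lor p q" using 1 2 by (simp add: lor_def)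
  assume "lor p q = 1"
  then have eq: "?t * ?u = 1 + ?a * ?b" "fst p \<bullet> fst q = ?a * ?b" using 1 2 unfolding lor_def by linarith+
  then have "(?a - ?b)\<^sup>2 = 0" using sqeq by simp
  then have ab: "?a = ?b" by simp
  have "(norm (fst p - fst q))\<^sup>2 = ?a\<^sup>2 - 2 * (fst p \<bullet> fst q) + ?b\<^sup>2"
    by (simp add: power2_norm_eq_inner inner_diff_left inner_diff_right inner_commute)
  also have "\<dots> = (?a - ?b)\<^sup>2" unfolding eq(2) by (simp add: power2_eq_square algebra_simps)
  finally have "fst p = fst q" using ab by simp
  moreover have "?t = ?u" using sp sq ab by (metis power2_eq_iff_nonneg less_imp_le)
  ultimately show "p = q" by (simp add: prod_eq_iff)
qed

lemma cosh_surj: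
  assumes "1 \<le> b"
  obtains s :: real where "0 \<le> s" "cosh s = b" "sinh s = sqrt (b\<^sup>2 - 1)"
proof -
  define r where "r = sqrt (b\<^sup>2 - 1)"
  have b2: "1 \<le> b\<^sup>2" using assms by (simp add: one_le_power)
  have r: "0 \<le> r" "r * r = b * b - 1" using b2 by (auto simp: r_def power2_eq_square)
  have e: "exp (ln (b + r)) = b + r" "exp (- ln (b + r)) = b - r"
  proof -
    show "exp (ln (b + r)) = b + r" using assms r by simp
    have "(b - r) * (b + r) = 1" using r by (simp add: algebra_simps)
    then show "exp (- ln (b + r)) = b - r" using assms r by (simp add: exp_minus field_simps)
  qed
  show thesis
  proof (rule that[of "ln (b + r)"])
    show "0 \<le> ln (b + r)" using assms r by simp
    show "cosh (ln (b + r)) = b" "sinh (ln (b + r)) = sqrt (b\<^sup>2 - 1)"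
      unfolding cosh_def sinh_def e r_def[symmetric] by simp_all
  qed
qed

text \<open>\<open>lor x x = 1\<close> leaves two sheets; a vector of the lower one has nonpositive
  product with \<open>p\<close>, as space components are shorter than time components.\<close>

lemma timelike_future:
  assumes p: "p \<in> hyperboloid" and x: "lor x x = 1" "0 < lor p x"
  shows "x \<in> hyperboloid"
proof -
  have "0 < snd x"
  proof (rule ccontr)
    assume neg: "\<not> 0 < snd x"
    have "(norm (fst x))\<^sup>2 \<le> (- snd x)\<^sup>2" using x(1) by (simp add: lor_self)
    then have le: "norm (fst x) \<le> - snd x" by (rule power2_le_imp_le) (use neg in simp)
    have "- (fst p \<bullet> fst x) \<le> norm (fst p) * norm (fst x)" using norm_cauchy_schwarz[of "- fst p" "fst x"] by simp
    also have "\<dots> \<le> snd p * (- snd x)"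
      using norm_fst_less_snd[OF p] le hyperboloid_snd(1)[OF p] by (intro mult_mono) auto
    finally have "lor p x \<le> 0" by (simp add: lor_def)
    then show False using x(2) by simp
  qed
  then show ?thesis using x(1) by (simp add: hyperboloid_def)
qed

lemma hyperboloid_reflection:
  assumes "p \<in> hyperboloid" "q \<in> hyperboloid"
  shows "(2 * lor p q) *\<^sub>R p - q \<in> hyperboloid"
proof (rule timelike_future[OF assms(1)])
  have pp: "lor p p = 1" "lor q q = 1" using assms by (auto simp: hyperboloid_def)
  show "lor ((2 * lor p q) *\<^sub>R p - q) ((2 * lor p q) *\<^sub>R p - q) = 1"
    using pp lor_commute[of q p] by (simp add: lor_simps)
  show "0 < lor p ((2 * lor p q) *\<^sub>R p - q)"
    using pp lor_ge_1(1)[OF assms] by (simp add: lor_simps)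
qed

lemma hyperbolic_line_identities:
  assumes pp: "lor p p = 1" and pw: "lor p w = 0" and ww: "lor w w = -1"
  defines "\<gamma> \<equiv> \<lambda>s. cosh s *\<^sub>R p + sinh s *\<^sub>R w"
  shows "lor (\<gamma> r) (\<gamma> s) = cosh (r - s)"
proof -
  have wp: "lor w p = 0" using pw lor_commute[of w p] by simp
  show ?thesis unfolding \<gamma>_def lor_simps pp pw ww wp cosh_diff by simp
qed

lemma hyperboloid_geodesic:
  assumes p: "p \<in> hyperboloid" and q: "q \<in> hyperboloid" and ne: "p \<noteq> q"
  obtains w where "lor p w = 0" "lor w w = -1"
    "\<And>s. cosh s *\<^sub>R p + sinh s *\<^sub>R w \<in> hyperboloid" "\<exists>s. q = cosh s *\<^sub>R p + sinh s *\<^sub>R w"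
proof -
  define b where "b = lor p q"
  have b: "1 < b" using lor_ge_1[OF p q] ne unfolding b_def by fastforce
  obtain \<sigma> where \<sigma>: "0 \<le> \<sigma>" "cosh \<sigma> = b" "sinh \<sigma> = sqrt (b\<^sup>2 - 1)" using b by (rule cosh_surj[OF less_imp_le])
  define r where "r = sinh \<sigma>"
  have b2: "b\<^sup>2 > 1" using b by (simp add: one_less_power)
  have r: "r > 0" "r * r = b * b - 1" using b2 \<sigma>(3) by (auto simp: r_def power2_eq_square)
  \<comment> \<open>The unit tangent vector at \<open>p\<close> towards \<open>q\<close>: the part
    of \<open>q\<close> orthogonal to \<open>p\<close> has length
    \<open>r = sinh \<sigma>\<close>.\<close>
  define w where "w = (1 / r) *\<^sub>R (q - b *\<^sub>R p)"
  have pp: "lor p p = 1" "lor q q = 1" using p q by (auto simp: hyperboloid_def)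
  have pw: "lor p w = 0" using pp by (simp add: w_def lor_simps b_def)
  have "r * r * lor w w = lor (q - b *\<^sub>R p) (q - b *\<^sub>R p)" unfolding w_def lor_simps(5,6) using r(1) by simp
  also have "\<dots> = - (r * r)" using pp r(2) lor_commute[of q p] by (simp add: lor_simps b_def algebra_simps)
  finally have "r * r * lor w w = r * r * (-1)" by simp
  then have ww: "lor w w = -1" using r(1) by (simp only: mult_cancel_left) auto
  have qs: "q = cosh \<sigma> *\<^sub>R p + sinh \<sigma> *\<^sub>R w" using r(1) unfolding \<sigma>(2) r_def[symmetric] by (simp add: w_def)
  have mem: "cosh s *\<^sub>R p + sinh s *\<^sub>R w \<in> hyperboloid" for s
  proof (rule timelike_future[OF p])
    show "lor (cosh s *\<^sub>R p + sinh s *\<^sub>R w) (cosh s *\<^sub>R p + sinh s *\<^sub>R w) = 1"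
      using hyperbolic_line_identities[OF pp(1) pw ww, of s s] by simp
    show "0 < lor p (cosh s *\<^sub>R p + sinh s *\<^sub>R w)" using pp pw by (simp add: lor_simps)
  qed
  show thesis using that[OF pw ww mem] qs by blast
qed

section \<open>The Hilbert metric of the unit ball\<close>

lemma affine_ratio_eqI:
  assumes "r *\<^sub>R (C - B) = C - A" "C \<noteq> B"
  shows "affine_ratio A B C = r"
  unfolding affine_ratio_def
proof (rule the_equality)
  show "r *\<^sub>R (C - B) = C - A" by (rule assms(1))
  fix r' assume "r' *\<^sub>R (C - B) = C - A"
  then have "r' *\<^sub>R (C - B) = r *\<^sub>R (C - B)" using assms(1) by simp
  then show "r' = r" using assms(2) by simp
qed

lemma hilbert_chord_endpoints:
  fixes y z :: "'a::euclidean_space"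
  assumes y: "norm y < 1" and z: "norm z < 1" and ne: "y \<noteq> z"
  obtains C D where "affine hull {y, z} \<inter> ball 0 1 = open_segment C D" "norm C = 1" "norm D = 1" "C \<noteq> D"
proof -
  define u where "u = z - y"
  define \<alpha> where "\<alpha> = u \<bullet> u"
  define \<beta> where "\<beta> = y \<bullet> u"
  define \<delta> where "\<delta> = 1 - y \<bullet> y"
  have \<alpha>: "\<alpha> > 0" using ne by (simp add: \<alpha>_def u_def)
  have yy: "y \<bullet> y < 1" using y by (metis norm_lt_1_sq diff_gt_0_iff_gt power2_norm_eq_inner)
  then have \<delta>: "\<delta> > 0" by (simp add: \<delta>_def)
  define R where "R = sqrt (\<beta>\<^sup>2 + \<alpha> * \<delta>)"
  have pos: "\<beta>\<^sup>2 + \<alpha> * \<delta> > 0" using \<alpha> \<delta> by (simp add: add_nonneg_pos)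
  have R: "R > 0" "R * R = \<beta> * \<beta> + \<alpha> * \<delta>" using pos by (auto simp: R_def power2_eq_square)
  \<comment> \<open>\<open>t1\<close> and \<open>t2\<close> are the parameters at which the line
    leaves the unit ball, the roots of a quadratic equation.\<close>
  define t1 where "t1 = (- \<beta> - R) / \<alpha>"
  define t2 where "t2 = (- \<beta> + R) / \<alpha>"
  have t12: "t1 < t2" using \<alpha> R(1) by (simp add: t1_def t2_def divide_strict_right_mono)
  have n: "(y + t *\<^sub>R u) \<bullet> (y + t *\<^sub>R u) - 1 = \<alpha> * ((t - t1) * (t - t2))" for t
  proof -
    have e: "\<alpha> * t1 = - \<beta> - R" "\<alpha> * t2 = - \<beta> + R" using \<alpha> by (auto simp: t1_def t2_def)
    have "\<alpha> * (\<alpha> * ((t - t1) * (t - t2))) = (\<alpha> * t - \<alpha> * t1) * (\<alpha> * t - \<alpha> * t2)" by (simp add: algebra_simps)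
    also have "\<dots> = (\<alpha> * t + \<beta>) * (\<alpha> * t + \<beta>) - R * R" unfolding e by (simp add: algebra_simps)
    also have "\<dots> = \<alpha> * (\<alpha> * t * t + 2 * \<beta> * t - \<delta>)" unfolding R(2) by (simp add: algebra_simps)
    finally have "\<alpha> * ((t - t1) * (t - t2)) = \<alpha> * t * t + 2 * \<beta> * t - \<delta>" using \<alpha> by simp
    moreover have "(y + t *\<^sub>R u) \<bullet> (y + t *\<^sub>R u) - 1 = \<alpha> * t * t + 2 * \<beta> * t - \<delta>"
      unfolding \<alpha>_def \<beta>_def \<delta>_def by (simp add: inner_add_left inner_add_right inner_commute algebra_simps)
    ultimately show ?thesis by simp
  qed
  let ?C = "y + t1 *\<^sub>R u" and ?D = "y + t2 *\<^sub>R u"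
  have u0: "u \<noteq> 0" using ne by (simp add: u_def)
  have CD: "?C \<noteq> ?D" using t12 u0 by simp
  have nC: "norm ?C = 1" "norm ?D = 1" using n[of t1] n[of t2] by (simp_all add: norm_eq_1)
  have ball: "y + t *\<^sub>R u \<in> ball 0 1 \<longleftrightarrow> t1 < t \<and> t < t2" for t
  proof -
    have "y + t *\<^sub>R u \<in> ball 0 1 \<longleftrightarrow> (y + t *\<^sub>R u) \<bullet> (y + t *\<^sub>R u) < 1"
      by (simp add: norm_lt_1_sq power2_norm_eq_inner)
    also have "\<dots> \<longleftrightarrow> \<alpha> * ((t - t1) * (t - t2)) < 0" using n[of t] by linarith
    also have "\<dots> \<longleftrightarrow> (t - t1) * (t - t2) < 0" using \<alpha> by (simp add: mult_less_0_iff)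
    also have "\<dots> \<longleftrightarrow> t1 < t \<and> t < t2" using t12 by (auto simp: mult_less_0_iff)
    finally show ?thesis .
  qed
  have seg: "open_segment ?C ?D = {y + t *\<^sub>R u | t. t1 < t \<and> t < t2}"
  proof (intro set_eqI iffI)
    fix x assume "x \<in> open_segment ?C ?D"
    then obtain l where l: "0 < l" "l < 1" "x = (1 - l) *\<^sub>R ?C + l *\<^sub>R ?D" by (auto simp: in_segment)
    have "x = y + (t1 + l * (t2 - t1)) *\<^sub>R u" unfolding l(3) by (simp add: algebra_simps)
    moreover have "0 < l * (t2 - t1)" using l t12 by simp
    moreover have "l * (t2 - t1) < t2 - t1" using mult_strict_right_mono[of l 1 "t2 - t1"] l t12 by simp
    ultimately have "t1 < t1 + l * (t2 - t1)" "t1 + l * (t2 - t1) < t2" "x = y + (t1 + l * (t2 - t1)) *\<^sub>R u" by auto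
    then show "x \<in> {y + t *\<^sub>R u | t. t1 < t \<and> t < t2}" by blast
  next
    fix x assume "x \<in> {y + t *\<^sub>R u | t. t1 < t \<and> t < t2}"
    then obtain t where t: "t1 < t" "t < t2" "x = y + t *\<^sub>R u" by blast
    define l where "l = (t - t1) / (t2 - t1)"
    have l: "0 < l" "l < 1" "l * (t2 - t1) = t - t1" using t t12 by (auto simp: l_def)
    have "(1 - l) *\<^sub>R ?C + l *\<^sub>R ?D = y + (t1 + l * (t2 - t1)) *\<^sub>R u" by (simp add: algebra_simps)
    then have "x = (1 - l) *\<^sub>R ?C + l *\<^sub>R ?D" using t(3) l(3) by simp
    then show "x \<in> open_segment ?C ?D" using l CD by (auto simp: in_segment)
  qed
  have hull: "affine hull {y, z} = range (\<lambda>t. y + t *\<^sub>R u)" unfolding u_def by (rule affine_hull_pair_param')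
  have "affine hull {y, z} \<inter> ball 0 1 = {y + t *\<^sub>R u | t. y + t *\<^sub>R u \<in> ball 0 1}" unfolding hull by blast
  then have "affine hull {y, z} \<inter> ball 0 1 = open_segment ?C ?D" unfolding ball seg .
  then show thesis by (rule that[OF _ nC CD])
qed

lemma open_segment_endpoints:
  fixes C D C' D' :: "'a::euclidean_space"
  assumes "open_segment C D = open_segment C' D'" "C \<noteq> D"
  shows "C' = C \<and> D' = D \<or> C' = D \<and> D' = C"
proof -
  have "open_segment C' D' \<noteq> {}" using assms by auto
  then have ne: "C' \<noteq> D'" by auto
  have "closed_segment C D = closed_segment C' D'"
    using assms ne by (metis closure_open_segment)
  then have "{C, D} = {C', D'}" by (simp add: closed_segment_eq)
  then show ?thesis by (auto simp: doubleton_eq_iff)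
qed

text \<open>With weights \<open>a\<close>, \<open>b\<close> of the two points along their chord from
  \<open>C\<close> to \<open>D\<close>, the cross ratio is a quotient of products of weights. As
  \<open>C\<close> and \<open>D\<close> are unit vectors, \<open>1 - y \<bullet> z\<close> and both
  terms under the roots in \<open>lift\<close> contain the factor \<open>1 - C \<bullet> D\<close>,
  which cancels; \<open>cosh (ln (P / Q))\<close> remains, with \<open>P / Q\<close> the square root
  of the cross ratio.\<close>

lemma hilbert_dist_ball:
  fixes y z :: "'a::euclidean_space"
  assumes y: "norm y < 1" and z: "norm z < 1"
  shows "0 \<le> hilbert_dist (ball 0 1) y z" "cosh (hilbert_dist (ball 0 1) y z) = lor (lift y) (lift z)"
proof -
  have "0 \<le> hilbert_dist (ball 0 1) y z \<and> cosh (hilbert_dist (ball 0 1) y z) = lor (lift y) (lift z)"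
  proof (cases "y = z")
    case True
    then show ?thesis using lift_hyperboloid(1)[OF z] by (simp add: hilbert_dist_def hyperboloid_def)
  next
    case False
    obtain C D where CD: "affine hull {y, z} \<inter> ball 0 1 = open_segment C D" "norm C = 1" "norm D = 1" "C \<noteq> D"
      by (rule hilbert_chord_endpoints[OF y z False])
    have "y \<in> open_segment C D" "z \<in> open_segment C D"
      unfolding CD(1)[symmetric] using y z by (simp_all add: hull_inc)
    then obtain a b where a: "0 < a" "a < 1" "y = (1 - a) *\<^sub>R C + a *\<^sub>R D" and b: "0 < b" "b < 1" "z = (1 - b) *\<^sub>R C + b *\<^sub>R D"
      by (auto simp: in_segment)
    define x where "x = a * (1 - b) / (b * (1 - a))"
    have x: "x > 0" using a b by (simp add: x_def)
    have ratios: "affine_ratio y z C = a / b" "affine_ratio y z D = (1 - a) / (1 - b)"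
    proof -
      have zC: "C - z = b *\<^sub>R (C - D)" "C - y = a *\<^sub>R (C - D)" unfolding a(3) b(3) by (simp_all add: algebra_simps)
      have zD: "D - z = (1 - b) *\<^sub>R (D - C)" "D - y = (1 - a) *\<^sub>R (D - C)" unfolding a(3) b(3) by (simp_all add: algebra_simps)
      have "C - z \<noteq> 0" "D - z \<noteq> 0" unfolding zC zD using b CD(4) by auto
      then have ne: "C \<noteq> z" "D \<noteq> z" by auto
      show "affine_ratio y z C = a / b"
        by (rule affine_ratio_eqI[OF _ ne(1)]) (unfold zC, use b(1) in simp)
      show "affine_ratio y z D = (1 - a) / (1 - b)"
        by (rule affine_ratio_eqI[OF _ ne(2)]) (unfold zD, use b(2) in simp)
    qed
    have cr: "affine_cross_ratio y z C D = x" "affine_cross_ratio y z D C = 1 / x"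
      unfolding affine_cross_ratio_def ratios x_def using a b by (simp_all add: field_simps)
    have h: "hilbert_dist (ball 0 1) y z = 1/2 * \<bar>ln x\<bar>"
    proof -
      have "(THE r. \<exists>C D. affine hull {y, z} \<inter> ball 0 1 = open_segment C D \<and> r = 1/2 * \<bar>ln (affine_cross_ratio y z C D)\<bar>) = 1/2 * \<bar>ln x\<bar>"
      proof (rule the_equality)
        show "\<exists>C D. affine hull {y, z} \<inter> ball 0 1 = open_segment C D \<and> 1/2 * \<bar>ln x\<bar> = 1/2 * \<bar>ln (affine_cross_ratio y z C D)\<bar>"
          using CD(1) cr by metis
      next
        fix r assume "\<exists>C D. affine hull {y, z} \<inter> ball 0 1 = open_segment C D \<and> r = 1/2 * \<bar>ln (affine_cross_ratio y z C D)\<bar>"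
        then obtain C' D' where r: "open_segment C D = open_segment C' D'" "r = 1/2 * \<bar>ln (affine_cross_ratio y z C' D')\<bar>"
          using CD(1) by auto
        from open_segment_endpoints[OF r(1) CD(4)] show "r = 1/2 * \<bar>ln x\<bar>"
          using r(2) cr x by (auto simp: ln_div)
      qed
      then show ?thesis using False by (simp add: hilbert_dist_def)
    qed
    define k where "k = C \<bullet> D"
    have CC: "C \<bullet> C = 1" "D \<bullet> D = 1" using CD by (simp_all add: norm_eq_1)
    have k: "1 - k > 0"
    proof -
      have "(C - D) \<bullet> (C - D) = 2 * (1 - k)" by (simp add: k_def inner_diff_left inner_diff_right CC inner_commute)
      moreover have "(C - D) \<bullet> (C - D) > 0" using CD(4) by simp
      ultimately show ?thesis by simp
    qed
    have yz: "1 - y \<bullet> z = (a * (1 - b) + b * (1 - a)) * (1 - k)"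
      unfolding a(3) b(3) by (simp add: inner_add_left inner_add_right CC k_def inner_commute[of D C] algebra_simps)
    have yy: "1 - (norm y)\<^sup>2 = 2 * a * (1 - a) * (1 - k)" and zz: "1 - (norm z)\<^sup>2 = 2 * b * (1 - b) * (1 - k)"
      unfolding power2_norm_eq_inner a(3) b(3) by (simp_all add: inner_add_left inner_add_right CC k_def inner_commute[of D C] algebra_simps)
    define P where "P = sqrt (a * (1 - b))"
    define Q where "Q = sqrt (b * (1 - a))"
    have PQ: "P > 0" "Q > 0" "P * P = a * (1 - b)" "Q * Q = b * (1 - a)" using a b by (auto simp: P_def Q_def)
    have "sqrt (1 - (norm y)\<^sup>2) * sqrt (1 - (norm z)\<^sup>2) = sqrt ((2 * (1 - k))\<^sup>2 * ((a * (1 - b)) * (b * (1 - a))))"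
      unfolding yy zz real_sqrt_mult[symmetric] by (simp only: power2_eq_square mult_ac)
    also have "\<dots> = 2 * (1 - k) * (P * Q)" using k unfolding real_sqrt_mult P_def Q_def by simp
    finally have sq: "sqrt (1 - (norm y)\<^sup>2) * sqrt (1 - (norm z)\<^sup>2) = 2 * (1 - k) * (P * Q)" .
    have "lor (lift y) (lift z) * (2 * (1 - k) * (P * Q)) = (P * P + Q * Q) * (1 - k)"
      using lor_lift[OF y z] unfolding sq yz PQ(3,4) .
    then have "(lor (lift y) (lift z) * (2 * (P * Q))) * (1 - k) = (P * P + Q * Q) * (1 - k)" by (simp only: mult_ac)
    then have lo: "lor (lift y) (lift z) * (2 * (P * Q)) = P * P + Q * Q" using k by (simp only: mult_cancel_right) auto
    have xPQ: "x = (P / Q)\<^sup>2" unfolding x_def PQ(3,4)[symmetric] by (simp add: power2_eq_square power_divide)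
    have "1/2 * ln x = ln (P / Q)" unfolding xPQ using PQ by (simp add: ln_realpow)
    then have "1/2 * \<bar>ln x\<bar> = \<bar>ln (P / Q)\<bar>" by linarith
    then have "cosh (1/2 * \<bar>ln x\<bar>) = cosh (ln (P / Q))" by (simp add: cosh_real_abs)
    also have "\<dots> = (P / Q + Q / P) / 2" using PQ by (simp add: cosh_def exp_minus)
    also have "\<dots> = lor (lift y) (lift z)" using lo PQ(1,2) by (simp add: field_simps)
    finally show ?thesis unfolding h by simp
  qed
  then show "0 \<le> hilbert_dist (ball 0 1) y z" "cosh (hilbert_dist (ball 0 1) y z) = lor (lift y) (lift z)" by blast+
qed

section \<open>The hyperbolic case\<close>

lemma cosh_reflect:
  fixes r s :: real
  shows "2 * cosh (s - r) * cosh s - cosh r = cosh (2 * s - r)"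
    and "2 * cosh (s - r) * sinh s - sinh r = sinh (2 * s - r)"
proof -
  define t where "t = s - r"
  have e: "r = s - t" "2 * s - r = s + t" by (simp_all add: t_def)
  show "2 * cosh (s - r) * cosh s - cosh r = cosh (2 * s - r)"
    "2 * cosh (s - r) * sinh s - sinh r = sinh (2 * s - r)"
    unfolding e(2) t_def[symmetric] unfolding e(1) by (simp_all add: cosh_add cosh_diff sinh_add sinh_diff)
qed

text \<open>Gram-Schmidt for a form that is positive definite on \<open>W\<close>: an orthonormal
  system shorter than \<open>dim W\<close> does not span \<open>W\<close> and can be
  extended.\<close>

lemma exists_orthonormal_system:
  fixes b :: "'v::euclidean_space \<Rightarrow> 'v \<Rightarrow> real"
  assumes lin: "\<And>y. linear (\<lambda>x. b x y)" and sym: "\<And>x y. b x y = b y x"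
    and W: "subspace W" and pos: "\<And>w. w \<in> W \<Longrightarrow> w \<noteq> 0 \<Longrightarrow> 0 < b w w"
  obtains S where "S \<subseteq> W" "finite S" "card S = dim W" "\<And>s t. s \<in> S \<Longrightarrow> t \<in> S \<Longrightarrow> b s t = (if s = t then 1 else 0)"
    "W \<subseteq> span S"
proof -
  have lincomb: "b (\<Sum>s\<in>S. c s *\<^sub>R s) y = (\<Sum>s\<in>S. c s * b s y)" for S c y
    by (simp add: linear_sum[OF lin] linear_scale[OF lin])
  have ex: "k \<le> dim W \<Longrightarrow> \<exists>S\<subseteq>W. finite S \<and> card S = k \<and> (\<forall>s\<in>S. \<forall>t\<in>S. b s t = (if s = t then 1 else 0))" for k
  proof (induction k)
    case 0 show ?case by (intro exI[of _ "{}"]) auto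
  next
    case (Suc k)
    then obtain S where S: "S \<subseteq> W" "finite S" "card S = k" "\<And>s t. s \<in> S \<Longrightarrow> t \<in> S \<Longrightarrow> b s t = (if s = t then 1 else 0)"
      by fastforce
    have "\<not> W \<subseteq> span S"
    proof
      assume "W \<subseteq> span S"
      then have "dim W \<le> card S" using S(2) by (rule dim_le_card)
      then show False using Suc.prems S(3) by simp
    qed
    then obtain v where v: "v \<in> W" "v \<notin> span S" by blast
    define u where "u = v - (\<Sum>s\<in>S. b v s *\<^sub>R s)"
    have sumW: "(\<Sum>s\<in>S. b v s *\<^sub>R s) \<in> W" using S(1) W by (intro subspace_sum subspace_scale) auto
    then have uW: "u \<in> W" unfolding u_def using v(1) W by (intro subspace_diff)
    have "(\<Sum>s\<in>S. b v s *\<^sub>R s) \<in> span S" by (intro span_sum span_scale span_base)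
    then have u0: "u \<noteq> 0" using v(2) by (auto simp: u_def)
    have ut: "b u t = 0" if t: "t \<in> S" for t
    proof -
      have "(\<Sum>s\<in>S. b v s * b s t) = (\<Sum>s\<in>S. if s = t then b v t else 0)"
        using S(4) t by (intro sum.cong) auto
      also have "\<dots> = b v t" using S(2) t by simp
      finally show ?thesis unfolding u_def linear_diff[OF lin] lincomb by simp
    qed
    define e where "e = (1 / sqrt (b u u)) *\<^sub>R u"
    have buu: "b u u > 0" using pos[OF uW u0] .
    have eW: "e \<in> W" unfolding e_def using uW W by (intro subspace_scale)
    have et: "b e t = 0" if "t \<in> S" for t using ut[OF that] by (simp add: e_def linear_scale[OF lin])
    have te: "b t e = 0" if "t \<in> S" for t using et[OF that] sym by simp
    have "b e e = (1 / sqrt (b u u)) * ((1 / sqrt (b u u)) * b u u)"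
      unfolding e_def linear_scale[OF lin] using sym[of u "(1 / sqrt (b u u)) *\<^sub>R u"] by (simp add: linear_scale[OF lin])
    then have ee: "b e e = 1" using buu by simp
    have eS: "e \<notin> S" using et[of e] ee by auto
    show ?case
    proof (intro exI[of _ "insert e S"] conjI ballI)
      show "card (insert e S) = Suc k" using S eS by simp
      fix s t assume "s \<in> insert e S" "t \<in> insert e S"
      then show "b s t = (if s = t then 1 else 0)" using S(4) ee et te eS by auto
    qed (use S eW in auto)
  qed
  obtain S where S: "S \<subseteq> W" "finite S" "card S = dim W" "\<And>s t. s \<in> S \<Longrightarrow> t \<in> S \<Longrightarrow> b s t = (if s = t then 1 else 0)"
    using ex[OF order_refl] by auto
  have "independent S"
  proof
    assume "dependent S"
    then obtain c v where c: "v \<in> S" "c v \<noteq> 0" "(\<Sum>s\<in>S. c s *\<^sub>R s) = 0"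
      using dependent_finite[OF S(2)] by auto
    have "0 = b (\<Sum>s\<in>S. c s *\<^sub>R s) v" unfolding c(3) by (simp add: linear_0[OF lin])
    also have "\<dots> = (\<Sum>s\<in>S. if s = v then c v else 0)" unfolding lincomb using S(4) c(1) by (intro sum.cong) auto
    also have "\<dots> = c v" using S(2) c(1) by simp
    finally show False using c(2) by simp
  qed
  then have "W \<subseteq> span S" using S by (intro card_ge_dim_independent) auto
  then show thesis using that[of S] S by blast
qed

context symmetric_projective_metric_space
begin

text \<open>A point of the orbit with a unit tangent vector, on which the form is negative.
  \<open>line p w\<close> is the branch of a hyperbola in this direction, in hyperbolic arc length,
  and \<open>p + w\<close> represents its ideal endpoint.\<close>

definition unit :: "real ^ 'n option \<Rightarrow> real ^ 'n option \<Rightarrow> bool" where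
  "unit p w \<longleftrightarrow> p \<in> orbit \<and> bil p w = 0 \<and> bil w w = -1"

definition line :: "real ^ 'n option \<Rightarrow> real ^ 'n option \<Rightarrow> real \<Rightarrow> real ^ 'n option" where
  "line p w s = cosh s *\<^sub>R p + sinh s *\<^sub>R w"

lemma unitD:
  assumes u: "unit p w"
  shows "p \<in> orbit" "bil p w = 0" "bil w p = 0" "bil w w = -1" "bil p p = 1"
proof -
  from u show p: "p \<in> orbit" and pw: "bil p w = 0" and "bil w w = -1" unfolding unit_def by blast+
  show "bil w p = 0" using pw bil_commute[of w p] by (rule trans[rotated])
  show "bil p p = 1" by (rule bil_self[OF p])
qed

lemma line_0 [simp]: "line p w 0 = p"
  by (simp add: line_def)

lemma bil_line:
  assumes "unit p w"
  shows "bil (line p w r) (line p w s) = cosh (r - s)"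
proof -
  have "bil (line p w r) (line p w s) = cosh r * (cosh s * bil p p) + cosh r * (sinh s * bil p w)
      + (sinh r * (cosh s * bil w p) + sinh r * (sinh s * bil w w))"
    unfolding line_def by (simp add: bil_simps distrib_left)
  then show ?thesis unfolding unitD(2-5)[OF assms] cosh_diff by simp
qed

lemma continuous_line: "continuous_on UNIV (line p w)"
  unfolding line_def by (intro continuous_intros)

lemma line_reflect:
  assumes "unit p w" "line p w s \<in> orbit"
  shows "hsym (line p w s) (line p w r) = line p w (2 * s - r)"
proof -
  have "hsym (line p w s) (line p w r) = (2 * cosh (s - r)) *\<^sub>R line p w s - line p w r"
    unfolding hsym_orbit[OF assms(2)] bil_line[OF assms(1)] ..
  also have "\<dots> = (2 * cosh (s - r) * cosh s - cosh r) *\<^sub>R p + (2 * cosh (s - r) * sinh s - sinh r) *\<^sub>R w"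
    unfolding line_def by (simp add: algebra_simps)
  finally show ?thesis unfolding cosh_reflect line_def .
qed

text \<open>Small parameters give points of the open cone with \<open>bil x x = 1\<close>, which are
  in the orbit. The reflection in \<open>line p w t\<close> takes \<open>p\<close> to
  \<open>line p w (2 * t)\<close>, so doubling reaches every parameter.\<close>

lemma line_orbit:
  assumes u: "unit p w"
  shows "line p w s \<in> orbit"
proof -
  have p: "p \<in> orbit" by (rule unitD[OF u])
  have "open (line p w -` hcone)" by (rule open_vimage[OF open_hcone continuous_line])
  moreover have "0 \<in> line p w -` hcone" using orbit_hcone[OF p] by simp
  ultimately obtain \<delta> where \<delta>: "\<delta> > 0" "ball 0 \<delta> \<subseteq> line p w -` hcone" using open_contains_ball by blast
  have small: "line p w t \<in> orbit" if "\<bar>t\<bar> < \<delta>" for t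
  proof (rule orbit_if_bil_1)
    have "t \<in> ball 0 \<delta>" using that by (simp add: dist_real_def)
    then show "line p w t \<in> hcone" using \<delta>(2) by blast
    show "bil (line p w t) (line p w t) = 1" by (simp add: bil_line[OF u])
  qed
  have dbl: "line p w (2 * t) \<in> orbit" if "line p w t \<in> orbit" for t
    using orbit_hsym[OF orbit_hcone[OF that] p] line_reflect[OF u that, of 0] by simp
  obtain k where k: "(1/2) ^ k < \<delta> / (\<bar>s\<bar> + 1)" using real_arch_pow_inv[of "\<delta> / (\<bar>s\<bar> + 1)" "1/2"] \<delta>(1) by auto
  have "\<bar>s * (1/2) ^ k\<bar> < \<delta>"
  proof -
    have "\<bar>s * (1/2) ^ k\<bar> = (1/2) ^ k * \<bar>s\<bar>" by (simp add: abs_mult)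
    also have "\<dots> \<le> (1/2) ^ k * (\<bar>s\<bar> + 1)" by (intro mult_left_mono) auto
    also have "\<dots> < \<delta>" using k by (simp add: pos_less_divide_eq)
    finally show ?thesis .
  qed
  then have start: "line p w (s * (1/2) ^ k) \<in> orbit" by (rule small)
  have "line p w (2 ^ i * (s * (1/2) ^ k)) \<in> orbit" for i
  proof (induction i)
    case (Suc i) from dbl[OF this] show ?case by (simp add: mult.assoc)
  qed (use start in simp)
  from this[of k] have "line p w (s * (2 ^ k * (1/2) ^ k)) \<in> orbit" by (simp only: mult_ac)
  moreover have "2 ^ k * (1/2) ^ k = (1::real)" by (simp add: power_mult_distrib[symmetric])
  ultimately show ?thesis by simp
qed

lemma line_speed_exists:
  assumes u: "unit p w"
  shows "\<exists>c. \<forall>r s. d (prj (line p w r)) (prj (line p w s)) = c * \<bar>r - s\<bar>"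
proof -
  let ?x = "prj p"
  have lo: "line p w s \<in> orbit" for s by (rule line_orbit[OF u])
  have lh: "line p w s \<in> hcone" for s by (rule orbit_hcone[OF lo])
  have p: "p \<in> hcone" by (rule orbit_hcone[OF unitD(1)[OF u]])
  have p0: "p $ None > 0" by (rule hcone_pos[OF p])
  \<comment> \<open>The direction of the projected line: \<open>w\<close> minus the multiple of
    \<open>p\<close> that brings its height to 0.\<close>
  define e where "e = (\<chi> j. w $ Some j - w $ None * ?x $ j)"
  have pj: "p $ Some j = p $ None * ?x $ j" for j using p0 by (simp add: prj_def)
  show ?thesis
  proof (rule reflecting_curve_speed[of ?x e "\<lambda>s. prj (line p w s)" "\<lambda>s. sinh s / line p w s $ None"])
    show "?x \<in> M" using p by (rule prj_hcone)
    show "e \<noteq> 0"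
    proof
      assume "e = 0"
      then have "w $ Some j = w $ None * ?x $ j" for j by (simp add: e_def vec_eq_iff)
      then have w: "w = (w $ None / p $ None) *\<^sub>R p" using p0 by (simp add: vec_option_eq_iff pj)
      have "bil p w = w $ None / p $ None" by (subst w) (simp add: bil_simps unitD(5)[OF u])
      then have "w $ None / p $ None = 0" using unitD(2)[OF u] by simp
      with w have "w = 0 *\<^sub>R p" by metis
      then have "bil w w = 0" by (simp only: bil_simps)
      then show False using unitD(4)[OF u] by simp
    qed
    fix s
    have N: "line p w s $ None > 0" by (rule hcone_pos[OF lh])
    have "prj (line p w s) $ j = (?x + (sinh s / line p w s $ None) *\<^sub>R e) $ j" for j
    proof -
      have a: "line p w s $ Some j = line p w s $ None * ?x $ j + sinh s * e $ j"
        by (simp add: line_def e_def pj algebra_simps)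
      have "prj (line p w s) $ j = line p w s $ Some j / line p w s $ None" by (simp add: prj_def)
      also have "\<dots> = ?x $ j + sinh s / line p w s $ None * e $ j" unfolding a using N by (simp add: add_divide_distrib)
      finally show ?thesis by simp
    qed
    then show "prj (line p w s) = ?x + (sinh s / line p w s $ None) *\<^sub>R e" by (simp add: vec_eq_iff)
  next
    show "prj (line p w s) \<in> M" for s by (rule prj_hcone[OF lh])
    show "continuous_on UNIV (\<lambda>s. prj (line p w s))"
      by (rule continuous_on_compose2[OF continuous_on_prj continuous_line]) (use hcone_pos[OF lh] in auto)
    show "reflect (prj (line p w s)) (prj (line p w r)) = prj (line p w (2 * s - r))" for r s
      using hsym_hcone(2)[OF lh lh, of s r] line_reflect[OF u lo, of s r] by simp
  qed
qed

text \<open>The \<open>d\<close>-length of a hyperbolic unit on this line; the aim is that all lines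
  have the same.\<close>

definition speed :: "real ^ 'n option \<Rightarrow> real ^ 'n option \<Rightarrow> real" where
  "speed p w = d (prj p) (prj (line p w 1))"

lemma speed:
  assumes "unit p w"
  shows "d (prj (line p w r)) (prj (line p w s)) = speed p w * \<bar>r - s\<bar>"
proof -
  obtain c where c: "\<And>r s. d (prj (line p w r)) (prj (line p w s)) = c * \<bar>r - s\<bar>"
    using line_speed_exists[OF assms] by blast
  have "speed p w = c" using c[of 0 1] by (simp add: speed_def)
  then show ?thesis using c by simp
qed

lemma orbit_prj_inj:
  assumes "x \<in> orbit" "y \<in> orbit" "prj x = prj y"
  shows "x = y"
proof -
  note h = orbit_hcone[OF assms(1)] orbit_hcone[OF assms(2)]
  let ?t = "y $ None / x $ None"
  have y: "y = ?t *\<^sub>R x" by (rule hcone_prj_eq[OF h assms(3)])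
  have "?t *\<^sub>R x \<in> orbit" unfolding y[symmetric] by (rule assms(2))
  then have t: "?t = 1"
    by (rule orbit_unique[OF assms(1)]) (simp add: hcone_pos[OF h(1)] hcone_pos[OF h(2)])
  show ?thesis using y unfolding t by simp
qed

lemma speed_pos:
  assumes u: "unit p w"
  shows "0 < speed p w"
proof -
  note o = unitD(1)[OF u] line_orbit[OF u, of 1]
  have "p \<noteq> line p w 1"
  proof
    assume "p = line p w 1"
    then have "cosh (0 - 1 :: real) = 1" using bil_line[OF u, of 0 1] unitD(5)[OF u] by simp
    then show False by simp
  qed
  then have "prj p \<noteq> prj (line p w 1)" using orbit_prj_inj[OF o] by blast
  then show ?thesis unfolding speed_def by (intro d_pos prj_hcone orbit_hcone o)
qed

lemma unit_minus: "unit p w \<Longrightarrow> unit p (- w)"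
  using bil_simps(5)[of "-1" w] bil_simps(6)[of _ "-1" w] by (simp add: unit_def)

lemma speed_minus:
  assumes u: "unit p w"
  shows "speed p (- w) = speed p w"
proof -
  have "line p (- w) 1 = line p w (-1)" by (simp add: line_def)
  then have "speed p (- w) = d (prj (line p w 0)) (prj (line p w (-1)))" by (simp add: speed_def)
  then show ?thesis unfolding speed[OF u] by simp
qed

text \<open>\<open>p + w\<close> carries the growing exponential of \<open>line p w s\<close>. If
  its pairing with \<open>q\<close> were not positive, the decaying term alone would have to keep
  \<open>bil q (line p w s)\<close> above 1.\<close>

lemma future_pairing_pos:
  assumes u: "unit p w" and q: "q \<in> orbit"
  shows "0 < bil q (p + w)"
proof (rule ccontr)
  assume neg: "\<not> 0 < bil q (p + w)"
  define \<mu> where "\<mu> = bil q (p - w)"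
  \<comment> \<open>Large enough to turn the estimate into \<open>2 exp s <= s\<close>.\<close>
  define s where "s = \<bar>\<mu>\<bar>"
  have "1 \<le> bil q (line p w s)" by (rule bil_ge_1[OF q line_orbit[OF u]])
  also have "bil q (line p w s) = (exp s * bil q (p + w) + exp (- s) * \<mu>) / 2"
    unfolding line_def bil_simps \<mu>_def by (simp add: cosh_def sinh_def field_simps)
  finally have "2 \<le> exp s * bil q (p + w) + exp (- s) * \<mu>" by simp
  moreover have "exp s * bil q (p + w) \<le> 0" using neg by (simp add: mult_nonneg_nonpos)
  ultimately have "2 \<le> exp (- s) * \<mu>" by linarith
  then have "exp s * 2 \<le> exp s * (exp (- s) * \<mu>)" by (intro mult_left_mono) auto
  also have "\<dots> = \<mu>" by (simp add: mult.assoc[symmetric] exp_minus)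
  finally have "exp s * 2 \<le> s" by (simp add: s_def)
  moreover have "1 + s \<le> exp s" by (rule exp_ge_add_one_self)
  moreover have "0 \<le> s" by (simp add: s_def)
  ultimately show False by linarith
qed

end

lemma isometry_between_inverse:
  assumes "isometry_between A e B h g"
  shows "isometry_between B h A e (inv_into A g)"
proof -
  have g: "bij_betw g A B" "\<And>x y. x \<in> A \<Longrightarrow> y \<in> A \<Longrightarrow> h (g x) (g y) = e x y"
    using assms unfolding isometry_between_def by blast+
  have inv: "inv_into A g x \<in> A" "g (inv_into A g x) = x" if "x \<in> B" for x
    using that g(1) unfolding bij_betw_def by (auto simp: inv_into_into f_inv_into_f)
  have "e (inv_into A g x) (inv_into A g y) = h x y" if "x \<in> B" "y \<in> B" for x y
    using g(2)[OF inv(1)[OF that(1)] inv(1)[OF that(2)]] inv(2) that by simp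
  then show ?thesis unfolding isometry_between_def using bij_betw_inv_into[OF g(1)] by blast
qed

section \<open>Definite form: the orbit is a full hyperboloid sheet\<close>

context symmetric_projective_metric_space
begin

lemma bil_hsym:
  assumes "p \<in> orbit"
  shows "bil (hsym p x) (hsym p y) = bil x y"
  unfolding hsym_orbit[OF assms] using bil_self[OF assms] bil_commute[of x p]
  by (simp add: bil_simps algebra_simps)

context
  assumes definite: "\<And>w. bil org w = 0 \<Longrightarrow> w \<noteq> 0 \<Longrightarrow> bil w w < 0"
begin

text \<open>Split off the component \<open>b\<close> along \<open>org\<close>. By definiteness the
  rest \<open>y\<close> is 0 or has length \<open>sqrt (b^2 - 1) > 0\<close>, and then
  \<open>x\<close> lies on the line from \<open>org\<close> in direction \<open>y\<close>.\<close>

lemma orbit_if_future: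
  assumes "bil x x = 1" "0 < bil org x"
  shows "x \<in> orbit"
proof -
  define b where "b = bil org x"
  define y where "y = x - b *\<^sub>R org"
  have oo: "bil org org = 1" by (rule bil_self[OF org_orbit])
  have oy: "bil org y = 0" by (simp add: y_def bil_simps oo b_def)
  have yy: "bil y y = 1 - b\<^sup>2"
    using assms(1) bil_commute[of x org] by (simp add: y_def bil_simps oo b_def[symmetric] power2_eq_square algebra_simps)
  show ?thesis
  proof (cases "y = 0")
    case True
    then have "bil y y = 0" using bil_simps(5)[of 0 y y] by simp
    then have "b\<^sup>2 = 1" using yy by simp
    then have "b = 1" using assms(2) by (simp add: b_def power2_eq_1_iff)
    then show ?thesis using True org_orbit by (simp add: y_def)
  next
    case False
    have b2: "b\<^sup>2 > 1" using definite[OF oy False] yy by simp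
    then have "1\<^sup>2 \<le> b\<^sup>2" by simp
    then have b1: "1 \<le> b" by (rule power2_le_imp_le) (use assms(2) in \<open>simp add: b_def\<close>)
    obtain s where s: "cosh s = b" "sinh s = sqrt (b\<^sup>2 - 1)" using b1 by (rule cosh_surj)
    define r where "r = sinh s"
    have r: "r > 0" "r * r = b\<^sup>2 - 1" using b2 s(2) by (auto simp: r_def)
    define w where "w = (1 / r) *\<^sub>R y"
    have "r * r * bil w w = bil y y" unfolding w_def bil_simps(5,6) using r(1) by simp
    then have "r * r * bil w w = r * r * (-1)" unfolding yy r(2) by simp
    then have "bil w w = -1" using r(1) by (simp only: mult_cancel_left) auto
    then have u: "unit org w" using oy by (simp add: unit_def org_orbit w_def bil_simps)
    have "x = line org w s" unfolding line_def s(1) r_def[symmetric] w_def using r(1) by (simp add: y_def)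
    then show ?thesis using line_orbit[OF u] by simp
  qed
qed

text \<open>A linear isometry from standard Lorentz space to \<open>bil\<close>, built on an
  orthonormal basis of the complement of \<open>org\<close>; it takes the hyperboloid onto the
  orbit.\<close>

definition chart_map :: "(real ^ 'n) \<times> real \<Rightarrow> real ^ 'n option" where
  "chart_map = (SOME \<Phi>. linear \<Phi> \<and> (\<forall>a b. bil (\<Phi> a) (\<Phi> b) = lor a b) \<and> \<Phi> (0, 1) = org \<and> orbit \<subseteq> range \<Phi>)"

lemma chart_map_exists:
  "\<exists>\<Phi> :: (real ^ 'n) \<times> real \<Rightarrow> real ^ 'n option. linear \<Phi> \<and> (\<forall>a b. bil (\<Phi> a) (\<Phi> b) = lor a b) \<and> \<Phi> (0, 1) = org \<and> orbit \<subseteq> range \<Phi>"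
proof -
  define W where "W = {w. bil org w = 0}"
  have W: "subspace W" unfolding W_def by (rule subspaceI) (simp_all add: bil_simps bil_orbit[OF org_orbit] inner_add_right)
  have oo: "bil org org = 1" by (rule bil_self[OF org_orbit])
  have Weq: "W = {w. cov org \<bullet> w = 0}" unfolding W_def bil_orbit[OF org_orbit] ..
  have "cov org \<noteq> 0" using oo by (auto simp: bil_orbit[OF org_orbit])
  then have "dim W = DIM(real ^ 'n option) - 1" unfolding Weq by (rule dim_hyperplane)
  then have dimW: "dim W = CARD('n)" by (simp add: card_UNIV_option)
  have lin: "linear (\<lambda>x. - bil x y)" for y by (rule linearI) (simp_all add: bil_simps)
  obtain S where S: "S \<subseteq> W" "finite S" "card S = dim W"
      "\<And>s t. s \<in> S \<Longrightarrow> t \<in> S \<Longrightarrow> - bil s t = (if s = t then 1 else 0)" "W \<subseteq> span S"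
  proof (rule exists_orthonormal_system[of "\<lambda>x y. - bil x y" W])
    show "0 < - bil w w" if "w \<in> W" "w \<noteq> 0" for w using definite[of w] that by (simp add: W_def)
    show "- bil x y = - bil y x" for x y by (simp add: bil_commute[of x y])
  qed (rule lin, rule W, rule that)
  obtain e :: "'n \<Rightarrow> real ^ 'n option" where e: "bij_betw e UNIV S"
    using finite_same_card_bij[of "UNIV :: 'n set" S] S(2,3) dimW by auto
  have eS: "e j \<in> S" for j using e by (auto simp: bij_betw_def)
  have ee: "bil (e i) (e j) = (if i = j then -1 else 0)" for i j
  proof -
    have "e i = e j \<longleftrightarrow> i = j" using e by (auto simp: bij_betw_def inj_on_def)
    then show ?thesis using S(4)[OF eS[of i] eS[of j]] by (auto split: if_splits)
  qed
  have eW: "bil org (e j) = 0" for j using eS[of j] S(1) by (auto simp: W_def)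
  define A where "A y = (\<Sum>j\<in>UNIV. y $ j *\<^sub>R e j)" for y :: "real ^ 'n"
  have linA: "linear A" unfolding A_def by (rule linearI) (simp_all add: scaleR_add_left sum.distrib scaleR_sum_right)
  have linb: "linear (bil x)" for x by (rule linearI) (simp_all add: bil_simps)
  have bA: "bil x (A y) = (\<Sum>j\<in>UNIV. y $ j * bil x (e j))" for x y
    unfolding A_def by (simp add: linear_sum[OF linb] bil_simps)
  have oA: "bil org (A y) = 0" for y unfolding bA by (simp add: eW)
  have Ae: "bil (A y) (e j) = - y $ j" for y j
  proof -
    have "bil (A y) (e j) = bil (e j) (A y)" by (rule bil_commute)
    also have "\<dots> = (\<Sum>i\<in>UNIV. if i = j then - y $ j else 0)" unfolding bA by (rule sum.cong) (auto simp: ee)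
    finally show ?thesis by simp
  qed
  have AA: "bil (A y) (A z) = - (y \<bullet> z)" for y z
    unfolding bA Ae by (simp add: inner_vec_def sum_negf mult.commute)
  define \<Phi> where "\<Phi> a = A (fst a) + snd a *\<^sub>R org" for a
  have "linear \<Phi>" unfolding \<Phi>_def
    by (rule linearI) (simp_all add: linear_add[OF linA] linear_scale[OF linA] algebra_simps)
  moreover have "bil (\<Phi> a) (\<Phi> b) = lor a b" for a b
    unfolding \<Phi>_def lor_def using oA bil_commute[of "A (fst a)" org] by (simp add: bil_simps AA oo)
  moreover have "\<Phi> (0, 1) = org" by (simp add: \<Phi>_def linear_0[OF linA])
  moreover have "orbit \<subseteq> range \<Phi>"
  proof (rule subsetI)
    fix x assume "x \<in> orbit"
    define y where "y = (\<chi> j. - bil x (e j))"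
    \<comment> \<open>What is left of \<open>x\<close> is orthogonal to \<open>org\<close> and to
      the basis, hence 0 by definiteness.\<close>
    define w where "w = x - bil org x *\<^sub>R org - A y"
    have ow: "bil org w = 0" by (simp add: w_def bil_simps oo oA)
    have we: "bil w (e j) = 0" for j by (simp add: w_def bil_simps Ae eW y_def)
    have "bil w s = 0" if "s \<in> S" for s
    proof -
      have "s \<in> range e" using that e unfolding bij_betw_def by simp
      then obtain j where "s = e j" by blast
      then show ?thesis using we by simp
    qed
    then have "bil w w = 0"
      using linear_eq_0_on_span[OF linb, of S w] S(5) ow by (auto simp: W_def)
    then have "w = 0" using definite[OF ow] by force
    then have "x = \<Phi> (y, bil org x)" by (simp add: \<Phi>_def w_def diff_eq_eq)
    then show "x \<in> range \<Phi>" by blast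
  qed
  ultimately show ?thesis by (intro exI[of _ \<Phi>] conjI allI)
qed

lemma chart_map:
  "linear chart_map" "bil (chart_map a) (chart_map b) = lor a b" "chart_map (0, 1) = org" "orbit \<subseteq> range chart_map"
proof -
  have *: "linear chart_map \<and> (\<forall>a b. bil (chart_map a) (chart_map b) = lor a b) \<and> chart_map (0, 1) = org \<and> orbit \<subseteq> range chart_map"
    unfolding chart_map_def by (rule someI_ex[OF chart_map_exists])
  show "linear chart_map" by (rule conjunct1[OF *])
  show "bil (chart_map a) (chart_map b) = lor a b" using conjunct1[OF conjunct2[OF *]] by (elim allE)
  show "chart_map (0, 1) = org" by (rule conjunct1[OF conjunct2[OF conjunct2[OF *]]])
  show "orbit \<subseteq> range chart_map" by (rule conjunct2[OF conjunct2[OF conjunct2[OF *]]])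
qed

lemma chart_map_orbit:
  assumes "a \<in> hyperboloid"
  shows "chart_map a \<in> orbit"
proof (rule orbit_if_future)
  show "bil (chart_map a) (chart_map a) = 1" using assms by (simp add: chart_map(2) hyperboloid_def)
  have "bil org (chart_map a) = lor (0, 1) a" using chart_map(2)[of "(0, 1)" a] chart_map(3) by simp
  then show "0 < bil org (chart_map a)" using assms by (simp add: lor_def hyperboloid_def)
qed

lemma chart_map_surj:
  assumes "x \<in> orbit"
  obtains a where "a \<in> hyperboloid" "chart_map a = x"
proof -
  obtain a where a: "x = chart_map a" using chart_map(4) assms by blast
  have "lor a a = 1" using bil_self[OF assms] chart_map(2)[of a a] a by simp
  moreover have "snd a = bil org x" using chart_map(2)[of "(0, 1)" a] chart_map(3) a by (simp add: lor_def)
  then have "0 < snd a" using bil_ge_1[OF org_orbit assms] by simp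
  ultimately show thesis using that[of a] a by (simp add: hyperboloid_def)
qed

definition ball_map :: "real ^ 'n \<Rightarrow> real ^ 'n" where
  "ball_map y = prj (chart_map (lift y))"

lemma ball_map_in: "norm y < 1 \<Longrightarrow> ball_map y \<in> M"
  unfolding ball_map_def by (intro prj_hcone orbit_hcone chart_map_orbit lift_hyperboloid)

lemma continuous_ball_map: "continuous_on (ball 0 1) ball_map"
proof -
  have "continuous_on (ball 0 1) (\<lambda>y. lift y :: (real ^ 'n) \<times> real)"
    unfolding lift_def
  proof (intro continuous_intros ballI)
    show "sqrt (1 - (norm y)\<^sup>2) \<noteq> 0" if "y \<in> ball 0 1" for y :: "real ^ 'n"
      using that norm_lt_1_sq[of y] by auto
  qed
  then have "continuous_on (ball 0 1) (\<lambda>y. chart_map (lift y))"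
    by (rule continuous_on_compose2[OF linear_continuous_on[OF chart_map(1)[unfolded linear_conv_bounded_linear]]]) auto
  then show ?thesis
    unfolding ball_map_def
    by (rule continuous_on_compose2[OF continuous_on_prj])
       (auto intro: hcone_pos[OF orbit_hcone[OF chart_map_orbit[OF lift_hyperboloid(1)]]])
qed

text \<open>A reflection moves \<open>p\<close> to \<open>org\<close>. Then \<open>q\<close> goes to
  a point of time coordinate at most 2, whose Klein image has squared norm at most 3/4, below the
  square of 9/10; on the compact ball of radius 9/10 the distance from \<open>base\<close> is
  bounded.\<close>

lemma bounded_near_orbit:
  obtains K where "\<And>p q. p \<in> orbit \<Longrightarrow> q \<in> orbit \<Longrightarrow> bil p q \<le> 2 \<Longrightarrow> d (prj p) (prj q) \<le> K"
proof -
  let ?C = "cball (0 :: real ^ 'n) (9/10)"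
  have sub: "?C \<subseteq> ball 0 1" by auto
  have "continuous_on ?C (\<lambda>y. d base (ball_map y))"
    using continuous_on_subset[OF continuous_ball_map sub] ball_map_in base_in
    by (intro continuous_on_d continuous_on_const) auto
  then have "compact ((\<lambda>y. d base (ball_map y)) ` ?C)" by (intro compact_continuous_image compact_cball)
  then obtain K where K: "\<And>y. y \<in> ?C \<Longrightarrow> d base (ball_map y) \<le> K"
    using compact_imp_bounded bounded_iff by (metis (no_types, lifting) abs_le_D1 image_eqI real_norm_def)
  have "d (prj p) (prj q) \<le> K" if pq: "p \<in> orbit" "q \<in> orbit" "bil p q \<le> 2" for p q
  proof -
    obtain m where m: "m \<in> orbit" "hsym m p = org" by (rule orbit_midpoint[OF pq(1) org_orbit])
    have q': "hsym m q \<in> orbit" by (rule orbit_hsym[OF orbit_hcone[OF m(1)] pq(2)])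
    obtain a where a: "a \<in> hyperboloid" "chart_map a = hsym m q" by (rule chart_map_surj[OF q'])
    have "snd a = bil org (hsym m q)" using chart_map(2)[of "(0, 1)" a] chart_map(3) a(2) by (simp add: lor_def)
    also have "\<dots> = bil p q" using bil_hsym[OF m(1), of p q] m(2) by simp
    finally have sa: "0 < snd a" "snd a \<le> 2" using pq(3) a(1) by (auto simp: hyperboloid_def)
    have "(norm (klein a))\<^sup>2 \<le> (9/10)\<^sup>2"
    proof -
      have "(snd a)\<^sup>2 \<le> 2\<^sup>2" using sa by (intro power_mono) auto
      have "(norm (klein a))\<^sup>2 * (snd a)\<^sup>2 = (norm (fst a))\<^sup>2"
        using sa by (simp add: klein_def power_mult_distrib[symmetric])
      also have "\<dots> = (snd a)\<^sup>2 - 1" using hyperboloid_snd(2)[OF a(1)] by simp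
      also have "\<dots> \<le> (9/10)\<^sup>2 * (snd a)\<^sup>2" using \<open>(snd a)\<^sup>2 \<le> 2\<^sup>2\<close> by (simp add: power2_eq_square)
      finally show ?thesis using sa(1) by simp
    qed
    then have "norm (klein a) \<le> 9/10" by (rule power2_le_imp_le) simp
    then have "d base (ball_map (klein a)) \<le> K" by (intro K) simp
    moreover have "ball_map (klein a) = prj (hsym m q)"
      unfolding ball_map_def klein_hyperboloid(2)[OF a(1)] a(2) ..
    moreover have "d base (prj (hsym m q)) = d (prj p) (prj q)"
    proof -
      have "base = prj (hsym m p)" unfolding m(2) org_def by simp
      then show ?thesis
        using hgroup_isometry[OF hgroup_hsym[OF orbit_hcone[OF m(1)]] orbit_hcone[OF pq(1)] orbit_hcone[OF pq(2)]] by simp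
    qed
    ultimately show ?thesis by simp
  qed
  then show thesis by (rule that)
qed

text \<open>Two lines with a common ideal endpoint, suitably parametrized, stay within bounded distance,
  hence carry the same unit of length.\<close>

lemma speed_le_asymptotic:
  assumes u: "unit p w" and u': "unit p' w'" and \<beta>: "0 < \<beta>" "p + w = \<beta> *\<^sub>R (p' + w')"
  shows "speed p w \<le> speed p' w'"
proof -
  let ?c = "speed p w" and ?c' = "speed p' w'"
  obtain K where K: "\<And>p q. p \<in> orbit \<Longrightarrow> q \<in> orbit \<Longrightarrow> bil p q \<le> 2 \<Longrightarrow> d (prj p) (prj q) \<le> K"
    by (rule bounded_near_orbit) blast
  \<comment> \<open>The parameter shift that makes the leading terms equal: \<open>exp s\<close>
    times \<open>p + w\<close> is \<open>exp (s + \<tau>)\<close> times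
    \<open>p' + w'\<close>.\<close>
  define \<tau> where "\<tau> = ln \<beta>"
  define \<kappa> where "\<kappa> = bil (p - w) (p' - w') / \<beta>"
  have e\<tau>: "exp \<tau> = \<beta>" "exp (- \<tau>) = 1 / \<beta>" using \<beta>(1) by (simp_all add: \<tau>_def exp_minus inverse_eq_divide)
  have nm: "bil (p + w) (p - w) = 2" "bil (p' + w') (p' - w') = 2"
    by (simp_all add: bil_simps unitD[OF u] unitD[OF u'])
  have nn: "bil (p' + w') (p' + w') = 0" by (simp add: bil_simps unitD[OF u'])
  have ls: "line p w s = (1/2) *\<^sub>R (exp s *\<^sub>R (p + w) + exp (- s) *\<^sub>R (p - w))" for p w s
  proof -
    have "(1/2) *\<^sub>R (exp s *\<^sub>R (p + w) + exp (- s) *\<^sub>R (p - w))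
        = ((exp s + exp (- s)) / 2) *\<^sub>R p + ((exp s - exp (- s)) / 2) *\<^sub>R w"
      by (simp add: scaleR_add_right scaleR_diff_right scaleR_add_left scaleR_diff_left add_divide_distrib diff_divide_distrib)
    then show ?thesis by (simp add: line_def cosh_def sinh_def)
  qed
  \<comment> \<open>Both points are expanded in null vectors. The square of the common one vanishes,
    the mixed terms give exactly 1, and only the decaying term remains.\<close>
  have bl: "bil (line p w s) (line p' w' (s + \<tau>)) = 1 + exp (- (2 * s)) * \<kappa> / 4" for s
  proof -
    define n where "n = p' + w'"
    define m where "m = p - w"
    define m' where "m' = p' - w'"
    define E where "E = exp s"
    define F where "F = exp (- s)"
    have EF: "E * F = 1" "F * F = exp (- (2 * s))"
      unfolding E_def F_def by (simp_all flip: exp_add)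
    have nm': "bil n m' = 2" "bil m n = 2 / \<beta>" "bil n n = 0"
    proof -
      show "bil n m' = 2" "bil n n = 0" using nm(2) nn by (simp_all add: n_def m'_def)
      have "bil (\<beta> *\<^sub>R n) m = 2" using nm(1) unfolding \<beta>(2) n_def m_def .
      then have "\<beta> * bil n m = 2" by (simp only: bil_simps)
      then show "bil m n = 2 / \<beta>" using \<beta>(1) bil_commute[of m n] by (simp add: field_simps)
    qed
    have l1: "line p w s = (1/2) *\<^sub>R (E *\<^sub>R \<beta> *\<^sub>R n + F *\<^sub>R m)"
      unfolding ls \<beta>(2) n_def m_def E_def F_def ..
    have l2: "line p' w' (s + \<tau>) = (1/2) *\<^sub>R ((E * \<beta>) *\<^sub>R n + (F * (1 / \<beta>)) *\<^sub>R m')"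
    proof -
      have sum: "- (s + \<tau>) = - s + - \<tau>" by simp
      have "exp (s + \<tau>) = E * \<beta>" "exp (- (s + \<tau>)) = F * (1 / \<beta>)"
        unfolding E_def F_def sum exp_add e\<tau> by simp_all
      then show ?thesis unfolding ls n_def m'_def by simp
    qed
    have "bil (line p w s) (line p' w' (s + \<tau>))
       = (1/4) * (E * \<beta> * (E * \<beta>) * bil n n + E * \<beta> * (F * (1 / \<beta>)) * bil n m'
          + F * (E * \<beta>) * bil m n + F * (F * (1 / \<beta>)) * bil m m')"
      unfolding l1 l2 by (simp add: bil_simps algebra_simps)
    also have "\<dots> = (1/4) * ((E * F) * 2 + (E * F) * 2 + (F * F) * \<kappa>)"
      unfolding nm' using \<beta>(1) by (simp add: \<kappa>_def m_def m'_def field_simps)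
    also have "\<dots> = 1 + exp (- (2 * s)) * \<kappa> / 4" unfolding EF by simp
    finally show ?thesis .
  qed
  define C where "C = d (prj p) (prj p') + K + ?c' * \<bar>\<tau>\<bar>"
  \<comment> \<open>For these \<open>s\<close> the product is at most 2, so corresponding points are
    within \<open>K\<close> of each other, and the lengths of the two rays differ by a bounded
    amount.\<close>
  have bd: "(?c - ?c') * s \<le> C" if s: "s \<ge> \<bar>\<kappa>\<bar>" for s
  proof -
    let ?x = "line p w s" and ?y = "line p' w' (s + \<tau>)"
    have "exp (- (2 * s)) * \<kappa> \<le> 4"
    proof -
      have "\<kappa> \<le> 1 + 2 * s" using s by linarith
      also have "\<dots> \<le> exp (2 * s)" by (rule exp_ge_add_one_self)
      finally have "exp (- (2 * s)) * \<kappa> \<le> exp (- (2 * s)) * exp (2 * s)" by (intro mult_left_mono) auto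
      then show ?thesis by (simp flip: exp_add)
    qed
    then have near: "d (prj ?x) (prj ?y) \<le> K"
      using bl[of s] by (intro K line_orbit u u') simp
    have M: "prj p \<in> M" "prj p' \<in> M" "prj ?x \<in> M" "prj ?y \<in> M"
      using prj_hcone[OF orbit_hcone[OF unitD(1)[OF u]]] prj_hcone[OF orbit_hcone[OF unitD(1)[OF u']]]
        prj_hcone[OF orbit_hcone[OF line_orbit[OF u]]] prj_hcone[OF orbit_hcone[OF line_orbit[OF u']]] by simp_all
    have "?c * \<bar>0 - s\<bar> = d (prj p) (prj ?x)" using speed[OF u, of 0 s] by simp
    also have "\<dots> \<le> d (prj p) (prj p') + d (prj p') (prj ?x)" by (rule triangle[OF M(1,2,3)])
    also have "d (prj p') (prj ?x) \<le> d (prj p') (prj ?y) + d (prj ?y) (prj ?x)" by (rule triangle[OF M(2,4,3)])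
    also have "d (prj p') (prj ?y) = ?c' * \<bar>0 - (s + \<tau>)\<bar>" using speed[OF u', of 0 "s + \<tau>"] by simp
    also have "d (prj ?y) (prj ?x) \<le> K" using near by (simp add: commute)
    finally have "?c * \<bar>0 - s\<bar> \<le> d (prj p) (prj p') + (?c' * \<bar>0 - (s + \<tau>)\<bar> + K)" by simp
    moreover have "?c' * \<bar>0 - (s + \<tau>)\<bar> \<le> ?c' * (s + \<bar>\<tau>\<bar>)" using speed_pos[OF u'] s by (intro mult_left_mono) auto
    moreover have "\<bar>0 - s\<bar> = s" using s by simp
    ultimately show ?thesis by (simp add: C_def algebra_simps)
  qed
  show ?thesis
  proof (rule ccontr)
    assume "\<not> ?c \<le> ?c'"
    then have pos: "?c - ?c' > 0" by simp
    define s where "s = \<bar>\<kappa>\<bar> + (\<bar>C\<bar> + 1) / (?c - ?c')"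
    have "(\<bar>C\<bar> + 1) / (?c - ?c') \<ge> 0" using pos by simp
    then have "(?c - ?c') * s \<le> C" by (intro bd) (simp add: s_def)
    moreover have "(?c - ?c') * ((\<bar>C\<bar> + 1) / (?c - ?c')) = \<bar>C\<bar> + 1" using pos by simp
    then have "(?c - ?c') * s = (?c - ?c') * \<bar>\<kappa>\<bar> + (\<bar>C\<bar> + 1)" unfolding s_def distrib_left by simp
    moreover have "(?c - ?c') * \<bar>\<kappa>\<bar> \<ge> 0" using pos by simp
    ultimately show False by linarith
  qed
qed

lemma speed_eq_asymptotic:
  assumes "unit p w" "unit p' w'" "0 < \<beta>" "p + w = \<beta> *\<^sub>R (p' + w')"
  shows "speed p w = speed p' w'"
proof (rule antisym)
  show "speed p w \<le> speed p' w'" by (rule speed_le_asymptotic[OF assms])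
  have "p' + w' = (1 / \<beta>) *\<^sub>R (p + w)" unfolding assms(4) using assms(3) by simp
  then show "speed p' w' \<le> speed p w" using assms(3) by (intro speed_le_asymptotic[OF assms(2,1), of "1 / \<beta>"]) auto
qed

text \<open>The line joining the ideal endpoints \<open>org + w\<close> and \<open>org + v\<close>
  is asymptotic to both given lines, one at each end, and has the same speed in both
  directions.\<close>

lemma speed_org_eq:
  assumes u: "unit org w" and v: "unit org v"
  shows "speed org w = speed org v"
proof (cases "w = v")
  case False
  define \<nu> where "\<nu> = 1 + bil w v"
  have "bil org (w - v) = 0" using unitD[OF u] unitD[OF v] by (simp add: bil_simps)
  then have "bil (w - v) (w - v) < 0" using definite False by simp
  then have \<nu>: "\<nu> > 0" using unitD[OF u] unitD[OF v] bil_commute[of v w] by (simp add: bil_simps \<nu>_def)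
  \<comment> \<open>Makes \<open>bil q q = 2 a^2 \<nu>\<close> equal to 1; as \<open>m\<close> and
    \<open>n\<close> are null, \<open>bil z z\<close> is then -1.\<close>
  define a where "a = 1 / sqrt (2 * \<nu>)"
  have a: "a > 0" "a * a * \<nu> = 1/2"
  proof -
    show "a > 0" using \<nu> by (simp add: a_def)
    have "a * a = 1 / (2 * \<nu>)" using \<nu> by (simp add: a_def)
    then show "a * a * \<nu> = 1/2" using \<nu> by simp
  qed
  define m where "m = org + w"
  define n where "n = org + v"
  have mn: "bil m m = 0" "bil n n = 0" "bil m n = \<nu>" "bil n m = \<nu>"
    using unitD[OF u] unitD[OF v] bil_commute[of v w] by (simp_all add: m_def n_def bil_simps \<nu>_def)
  define q where "q = a *\<^sub>R (m + n)"
  define z where "z = a *\<^sub>R (m - n)"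
  have q: "q \<in> orbit"
  proof (rule orbit_if_future)
    show "bil q q = 1" unfolding q_def bil_simps mn using a(2) by (simp add: algebra_simps)
    have "bil org m = 1" "bil org n = 1" using unitD[OF u] unitD[OF v] by (simp_all add: m_def n_def bil_simps)
    then have "bil org q = a * 2" unfolding q_def bil_simps by simp
    then show "0 < bil org q" using a(1) by simp
  qed
  have qz: "unit q z"
    unfolding unit_def
  proof (intro conjI q)
    show "bil q z = 0" unfolding q_def z_def bil_simps mn by simp
    show "bil z z = -1" unfolding z_def bil_simps mn using a(2) by (simp add: algebra_simps)
  qed
  have "q + z = (2 * a) *\<^sub>R (org + w)" "q + (- z) = (2 * a) *\<^sub>R (org + v)"
  proof -
    have "(m + n) + (m - n) = 2 *\<^sub>R m" "(m + n) - (m - n) = 2 *\<^sub>R n" by (simp_all add: scaleR_2)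
    then have "a *\<^sub>R ((m + n) + (m - n)) = (2 * a) *\<^sub>R m" "a *\<^sub>R ((m + n) - (m - n)) = (2 * a) *\<^sub>R n"
      by (simp_all add: mult.commute)
    then show "q + z = (2 * a) *\<^sub>R (org + w)" "q + (- z) = (2 * a) *\<^sub>R (org + v)"
      unfolding q_def z_def m_def[symmetric] n_def[symmetric] by (simp_all only: scaleR_add_right scaleR_diff_right add_uminus_conv_diff)
  qed
  then have "speed q z = speed org w" "speed q (- z) = speed org v"
    using a(1) qz unit_minus[OF qz] u v by (auto intro!: speed_eq_asymptotic[where \<beta> = "2 * a"])
  then show ?thesis using speed_minus[OF qz] by simp
qed simp

text \<open>The asymptotic line through \<open>org\<close>: division by \<beta> gives the null
  vector \<open>p + w\<close> pairing 1 with \<open>org\<close>, so subtracting \<open>org\<close>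
  leaves a tangent vector there.\<close>

lemma speed_eq_org:
  assumes u: "unit p w"
  obtains v where "unit org v" "speed p w = speed org v"
proof -
  define \<beta> where "\<beta> = bil org (p + w)"
  have \<beta>: "\<beta> > 0" unfolding \<beta>_def by (rule future_pairing_pos[OF u org_orbit])
  define v where "v = (1 / \<beta>) *\<^sub>R (p + w) - org"
  have nn: "bil (p + w) (p + w) = 0" by (simp add: bil_simps unitD[OF u])
  have on: "bil org (p + w) = \<beta>" "bil (p + w) org = \<beta>" unfolding \<beta>_def by (simp_all add: bil_commute[of "p + w" org])
  have v: "unit org v"
    unfolding unit_def
  proof (intro conjI org_orbit)
    show "bil org v = 0" unfolding v_def bil_simps(4,6) on using \<beta> by (simp add: bil_self[OF org_orbit])
    show "bil v v = -1" unfolding v_def bil_simps(3,4,5,6) on nn using \<beta> by (simp add: bil_self[OF org_orbit])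
  qed
  have "p + w = \<beta> *\<^sub>R (org + v)" using \<beta> by (simp add: v_def)
  then show thesis using that[OF v] speed_eq_asymptotic[OF u v \<beta>] by blast
qed

text \<open>Any two points of the ball lie on a common line; its parameter difference is the Hilbert
  distance, and the common speed \<open>c\<close> converts it into \<open>d\<close>.\<close>

lemma hyperbolic_if_definite: "hyperbolic_geometry M d"
proof -
  have ex: "\<exists>c>0. \<forall>p w. unit p w \<longrightarrow> speed p w = c"
  proof (cases "\<exists>v. unit org v")
    case True
    then obtain v where v: "unit org v" by blast
    have "speed p w = speed org v" if u: "unit p w" for p w
    proof -
      obtain v' where v': "unit org v'" "speed p w = speed org v'" by (rule speed_eq_org[OF u])
      then show ?thesis using speed_org_eq[OF v'(1) v] by simp
    qed
    then show ?thesis using speed_pos[OF v] by blast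
  next
    case False
    have "\<not> unit p w" for p w
    proof
      assume u: "unit p w"
      obtain v where "unit org v" by (rule speed_eq_org[OF u])
      then show False using False by blast
    qed
    then show ?thesis by (intro exI[of _ 1]) simp
  qed
  then obtain c where c: "c > 0" "\<And>p w. unit p w \<Longrightarrow> speed p w = c" by blast
  have dist: "d (ball_map y) (ball_map z) = c * hilbert_dist (ball 0 1) y z" if yz: "norm y < 1" "norm z < 1" for y z
  proof (cases "y = z")
    case True
    then show ?thesis using ball_map_in[OF yz(2)] by (simp add: hilbert_dist_def)
  next
    case False
    note ly = lift_hyperboloid[OF yz(1)] and lz = lift_hyperboloid[OF yz(2)]
    have "lift y \<noteq> lift z" using False ly(2) lz(2) by metis
    then obtain w where w: "lor (lift y) w = 0" "lor w w = -1" "\<exists>s. lift z = cosh s *\<^sub>R lift y + sinh s *\<^sub>R w"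
      by (rule hyperboloid_geodesic[OF ly(1) lz(1)]) blast
    then obtain s where s: "lift z = cosh s *\<^sub>R lift y + sinh s *\<^sub>R w" by blast
    have u: "unit (chart_map (lift y)) (chart_map w)"
      unfolding unit_def chart_map(2) using w chart_map_orbit[OF ly(1)] by simp
    have line: "chart_map (lift z) = line (chart_map (lift y)) (chart_map w) s"
      unfolding s line_def by (simp add: linear_add[OF chart_map(1)] linear_scale[OF chart_map(1)])
    have "d (ball_map y) (ball_map z) = c * \<bar>0 - s\<bar>"
      unfolding ball_map_def line using speed[OF u, of 0 s] c(2)[OF u] by simp
    moreover have "hilbert_dist (ball 0 1) y z = \<bar>s\<bar>"
    proof -
      have "lor (lift y) (lift z) = cosh s"
        using hyperbolic_line_identities[of "lift y" w 0 s] w ly(1) unfolding s by (simp add: hyperboloid_def)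
      then have "cosh (hilbert_dist (ball 0 1) y z) = cosh \<bar>s\<bar>"
        using hilbert_dist_ball(2)[OF yz] by (simp add: cosh_real_abs)
      then have "\<bar>hilbert_dist (ball 0 1) y z\<bar> = \<bar>s\<bar>" by simp
      then show ?thesis using hilbert_dist_ball(1)[OF yz] by simp
    qed
    ultimately show ?thesis by simp
  qed
  have inj: "inj_on ball_map (ball 0 1)"
  proof (rule inj_onI)
    fix y z assume yz: "y \<in> ball 0 1" "z \<in> ball 0 1" "ball_map y = ball_map z"
    then have n: "norm y < 1" "norm z < 1" by simp_all
    note ly = lift_hyperboloid[OF n(1)] and lz = lift_hyperboloid[OF n(2)]
    have "chart_map (lift y) = chart_map (lift z)"
      using yz(3) unfolding ball_map_def by (intro orbit_prj_inj chart_map_orbit ly lz)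
    then have "lor (lift y) (lift z) = lor (lift y) (lift y)" by (simp flip: chart_map(2))
    then have "lift y = lift z" using ly(1) by (intro lor_ge_1(2)[OF ly(1) lz(1)]) (simp add: hyperboloid_def)
    then show "y = z" using ly(2) lz(2) by metis
  qed
  have surj: "ball_map ` ball 0 1 = M"
  proof
    show "ball_map ` ball 0 1 \<subseteq> M" using ball_map_in by auto
    show "M \<subseteq> ball_map ` ball 0 1"
    proof
      fix x assume "x \<in> M"
      then have "hat x \<in> hcone" by simp
      then obtain t where t: "0 < t" "t *\<^sub>R hat x \<in> orbit" by (rule orbit_ray)
      obtain a where a: "a \<in> hyperboloid" "chart_map a = t *\<^sub>R hat x" by (rule chart_map_surj[OF t(2)])
      have "ball_map (klein a) = x"
        unfolding ball_map_def klein_hyperboloid(2)[OF a(1)] a(2) using t(1) by simp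
      then show "x \<in> ball_map ` ball 0 1" using klein_hyperboloid(1)[OF a(1)] by (intro image_eqI[of _ _ "klein a"]) auto
    qed
  qed
  have "isometry_between (ball 0 1) (\<lambda>x y. c * hilbert_dist (ball 0 1) x y) M d ball_map"
    unfolding isometry_between_def bij_betw_def using inj surj dist by simp
  from isometry_between_inverse[OF this]
  have iso: "isometric_spaces M d (ball (0 :: real ^ 'n) 1) (\<lambda>x y. c * hilbert_dist (ball (0 :: real ^ 'n) 1) x y)"
    unfolding isometric_spaces_def by (intro exI[where x = "inv_into (ball 0 1) ball_map"])
  have "open_ellipsoid (ball (0 :: real ^ 'n) 1)"
    unfolding open_ellipsoid_def by (intro exI[of _ id] exI[of _ 0]) (auto simp: linear_id)
  then show ?thesis unfolding hyperbolic_geometry_def using c(1) iso by blast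
qed

end

theorem minkowski_or_hyperbolic: "minkowski_geometry M d \<or> hyperbolic_geometry M d"
proof (cases "\<exists>w. bil org w = 0 \<and> w \<noteq> 0 \<and> bil w w = 0")
  case False
  have "bil w w < 0" if "bil org w = 0" "w \<noteq> 0" for w
    using bil_perp_nonpos[OF org_orbit that(1)] False that by fastforce
  then show ?thesis using hyperbolic_if_definite by blast
next
  case True
  then obtain w where w: "bil org w = 0" "w \<noteq> 0" "bil w w = 0" by blast
  have flat: "bil u u = 0" if "bil org u = 0" for u
    using form_not_mixed[OF w(1,3,2) that] by blast
  have "minkowski_geometry M d"
    using flat_case[OF flat] all_centers
    by (intro minkowski_geometry_if_affine_reflections) auto
  then show ?thesis ..
qed

end

section \<open>Minkowski and hyperbolic geometries have all centers\<close>

lemma isometry_between_compose: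
  assumes "isometry_between A e B h f" "isometry_between B h C k g"
  shows "isometry_between A e C k (g \<circ> f)"
proof -
  note f = assms(1)[unfolded isometry_between_def] and g = assms(2)[unfolded isometry_between_def]
  have "f x \<in> B" if "x \<in> A" for x using bij_betw_apply[OF conjunct1[OF f] that] .
  then have "k (g (f x)) (g (f y)) = e x y" if "x \<in> A" "y \<in> A" for x y
    using conjunct2[OF f] conjunct2[OF g] that by simp
  then show ?thesis
    unfolding isometry_between_def using bij_betw_trans[OF conjunct1[OF f] conjunct1[OF g]] by simp
qed

lemma hilbert_dist_ball_eqI:
  assumes "norm y < 1" "norm z < 1" "lor (lift y) (lift z) = cosh t"
  shows "hilbert_dist (ball 0 1) y z = \<bar>t\<bar>"
proof -
  have "cosh (hilbert_dist (ball 0 1) y z) = cosh \<bar>t\<bar>"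
    using hilbert_dist_ball(2)[OF assms(1,2)] assms(3) by (simp add: cosh_real_abs)
  then have "\<bar>hilbert_dist (ball 0 1) y z\<bar> = \<bar>t\<bar>" by simp
  then show ?thesis using hilbert_dist_ball(1)[OF assms(1,2)] by simp
qed

lemma hilbert_dist_ball_cong:
  assumes "norm y < 1" "norm z < 1" "norm y' < 1" "norm z' < 1"
    and "lor (lift y) (lift z) = lor (lift y') (lift z')"
  shows "hilbert_dist (ball 0 1) y z = hilbert_dist (ball 0 1) y' z'"
proof -
  have "hilbert_dist (ball 0 1) y z = \<bar>hilbert_dist (ball 0 1) y' z'\<bar>"
    using assms(5) hilbert_dist_ball(2)[OF assms(3,4)] by (intro hilbert_dist_ball_eqI assms) simp
  then show ?thesis using hilbert_dist_ball(1)[OF assms(3,4)] by simp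
qed

lemma affine_ratio_affine_image:
  assumes "linear f" "inj f"
  shows "affine_ratio (a + f A) (a + f B) (a + f C) = affine_ratio A B C"
proof -
  have "r *\<^sub>R (a + f C - (a + f B)) = a + f C - (a + f A) \<longleftrightarrow> r *\<^sub>R (C - B) = C - A" for r
  proof -
    have "r *\<^sub>R (a + f C - (a + f B)) = f (r *\<^sub>R (C - B))" "a + f C - (a + f A) = f (C - A)"
      by (simp_all add: linear_scale[OF assms(1)] linear_diff[OF assms(1)])
    then show ?thesis using assms(2) by (simp add: inj_eq)
  qed
  then show ?thesis unfolding affine_ratio_def by simp
qed

text \<open>Lines, segments and affine ratios are affine notions; this reduces every ellipsoid to
  the unit ball.\<close>

lemma hilbert_dist_affine_image:
  assumes f: "linear f" "bij f"
  shows "hilbert_dist ((\<lambda>x. a + f x) ` E) (a + f y) (a + f z) = hilbert_dist E y z"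
proof -
  have inj: "inj f" using f(2) by (simp add: bij_def)
  let ?T = "\<lambda>x. a + f x"
  have Tinj: "inj ?T" using inj by (simp add: inj_def)
  have hull: "affine hull {?T y, ?T z} = ?T ` (affine hull {y, z})"
    unfolding affine_hull_pair_param' image_image
    by (simp add: linear_add[OF f(1)] linear_diff[OF f(1)] linear_scale[OF f(1)] add.assoc)
  have comb: "(1 - u) *\<^sub>R ?T C + u *\<^sub>R ?T D = ?T ((1 - u) *\<^sub>R C + u *\<^sub>R D)" for u C D
    by (simp only: linear_add[OF f(1)] linear_scale[OF f(1)]) (simp add: algebra_simps)
  have seg: "open_segment (?T C) (?T D) = ?T ` open_segment C D" for C D
  proof (intro set_eqI)
    fix x
    have "?T C = ?T D \<longleftrightarrow> C = D" using inj by (simp add: inj_eq)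
    then have "x \<in> open_segment (?T C) (?T D) \<longleftrightarrow> C \<noteq> D \<and> (\<exists>u>0. u < 1 \<and> x = ?T ((1 - u) *\<^sub>R C + u *\<^sub>R D))"
      unfolding in_segment(2) comb by blast
    also have "\<dots> \<longleftrightarrow> x \<in> ?T ` {z. C \<noteq> D \<and> (\<exists>u>0. u < 1 \<and> z = (1 - u) *\<^sub>R C + u *\<^sub>R D)}" by blast
    also have "{z. C \<noteq> D \<and> (\<exists>u>0. u < 1 \<and> z = (1 - u) *\<^sub>R C + u *\<^sub>R D)} = open_segment C D"
      unfolding in_segment(2)[symmetric] by simp
    finally show "x \<in> open_segment (?T C) (?T D) \<longleftrightarrow> x \<in> ?T ` open_segment C D" .
  qed
  have surjT: "\<exists>C. C' = ?T C" for C'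
  proof -
    have "C' - a \<in> range f" using bij_is_surj[OF f(2)] by simp
    then obtain C where "C' - a = f C" by blast
    then have "C' = ?T C" by (simp add: diff_eq_eq add.commute)
    then show ?thesis by blast
  qed
  have exT: "(\<exists>C D. R C D) \<longleftrightarrow> (\<exists>C D. R (?T C) (?T D))" for R
    using surjT by metis
  have "(\<exists>C D. affine hull {?T y, ?T z} \<inter> ?T ` E = open_segment C D \<and> r = 1/2 * \<bar>ln (affine_cross_ratio (?T y) (?T z) C D)\<bar>)
    \<longleftrightarrow> (\<exists>C D. affine hull {y, z} \<inter> E = open_segment C D \<and> r = 1/2 * \<bar>ln (affine_cross_ratio y z C D)\<bar>)" for r
  proof -
    have "affine hull {?T y, ?T z} \<inter> ?T ` E = open_segment (?T C) (?T D) \<longleftrightarrow> affine hull {y, z} \<inter> E = open_segment C D" for C D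
      unfolding hull seg image_Int[OF Tinj, symmetric] by (rule inj_image_eq_iff[OF Tinj])
    moreover have "affine_cross_ratio (?T y) (?T z) (?T C) (?T D) = affine_cross_ratio y z C D" for C D
      unfolding affine_cross_ratio_def affine_ratio_affine_image[OF f(1) inj] ..
    ultimately show ?thesis unfolding exT[of "\<lambda>C D. affine hull {?T y, ?T z} \<inter> ?T ` E = open_segment C D \<and> r = _ C D"] by simp
  qed
  moreover have "?T y = ?T z \<longleftrightarrow> y = z" using inj by (simp add: inj_eq)
  ultimately show ?thesis unfolding hilbert_dist_def by simp
qed

lemma minkowski_dist_ball: "minkowski_dist (ball 0 1) x y = norm (y - x)"
proof -
  have "{r. 0 < r \<and> (y - x) /\<^sub>R r \<in> ball 0 1} = {norm (y - x)<..}"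
  proof (intro set_eqI)
    fix r
    have "0 < r \<and> inverse r * norm (y - x) < 1 \<longleftrightarrow> norm (y - x) < r"
      using norm_ge_zero[of "y - x"] by (cases "0 < r") (auto simp: field_simps simp del: norm_ge_zero)
    then show "r \<in> {r. 0 < r \<and> (y - x) /\<^sub>R r \<in> ball 0 1} \<longleftrightarrow> r \<in> {norm (y - x)<..}"
      by (cases "0 < r") auto
  qed
  then show ?thesis by (simp add: minkowski_dist_def)
qed

lemma indicatrix_ball: "indicatrix (ball (0 :: 'a::euclidean_space) 1)"
  unfolding indicatrix_def
proof (intro conjI ballI impI)
  show "uminus ` ball (0 :: 'a) 1 = ball 0 1" by (force simp: image_iff intro: bexI[of _ "- _"])
  fix x y :: 'a assume xy: "x \<in> closure (ball 0 1)" "y \<in> closure (ball 0 1)" "x \<noteq> y"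
  show "open_segment x y \<subseteq> ball 0 1"
  proof
    fix z assume "z \<in> open_segment x y"
    then have "dist 0 z < dist 0 x \<or> dist 0 z < dist 0 y" by (rule dist_decreases_open_segment)
    then show "z \<in> ball 0 1" using xy(1,2) by auto
  qed
qed auto

lemma minkowski_dist_reflect:
  assumes "indicatrix I"
  shows "minkowski_dist I (2 *\<^sub>R y - a) (2 *\<^sub>R y - b) = minkowski_dist I a b"
proof -
  have sym: "- v \<in> I \<longleftrightarrow> v \<in> I" for v
    using assms unfolding indicatrix_def by (metis image_eqI minus_minus)
  have "((2 *\<^sub>R y - b) - (2 *\<^sub>R y - a)) /\<^sub>R r \<in> I \<longleftrightarrow> (b - a) /\<^sub>R r \<in> I" for r
    using sym[of "(b - a) /\<^sub>R r"] by (simp add: scaleR_diff_right)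
  then show ?thesis unfolding minkowski_dist_def by simp
qed

text \<open>Homogeneity for positive factors follows from the inequality \<open>le\<close> for a
  factor and its inverse; symmetry of \<open>I\<close> supplies the sign.\<close>

lemma minkowski_dist_scale:
  assumes I: "indicatrix I"
  shows "minkowski_dist I (x + r *\<^sub>R v) (x + s *\<^sub>R v) = \<bar>r - s\<bar> * minkowski_dist I 0 v"
proof -
  define R where "R w = {r. 0 < r \<and> w /\<^sub>R r \<in> I}" for w
  define N where "N w = Inf (R w)" for w
  have mN: "minkowski_dist I a b = N (b - a)" for a b by (simp add: minkowski_dist_def N_def R_def)
  have sym: "- w \<in> I \<longleftrightarrow> w \<in> I" for w
    using I unfolding indicatrix_def by (metis image_eqI minus_minus)
  \<comment> \<open>0 is the midpoint of some \<open>w\<close> and \<open>- w\<close>, and strict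
    convexity puts it into \<open>I\<close>.\<close>
  have "0 \<in> I"
  proof -
    obtain w where w: "w \<in> I" using I unfolding indicatrix_def by blast
    show ?thesis
    proof (cases "w = 0")
      case False
      have cl: "w \<in> closure I" "- w \<in> closure I" using w sym closure_subset by blast+
      have "w \<noteq> - w" using False by (simp add: eq_neg_iff_add_eq_0 flip: scaleR_2)
      then have "open_segment w (- w) \<subseteq> I" using I cl unfolding indicatrix_def by blast
      moreover have "midpoint w (- w) \<in> open_segment w (- w)" using \<open>w \<noteq> - w\<close> by simp
      ultimately show ?thesis by (auto simp: midpoint_def)
    qed (use w in simp)
  qed
  moreover have "open I" using I unfolding indicatrix_def by (elim conjE)
  ultimately obtain e where e: "e > 0" "ball 0 e \<subseteq> I" using open_contains_ball[of I] by blast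
  have ne: "R w \<noteq> {}" for w
  proof -
    define t where "t = (norm w + 1) / e"
    have "0 < norm w + 1" by (rule add_nonneg_pos[OF norm_ge_zero zero_less_one])
    then have t: "t > 0" unfolding t_def using e(1) by (rule divide_pos_pos)
    have "e * t = norm w + 1" using e(1) by (simp add: t_def)
    then have "norm w < e * t" by simp
    then have "norm w / t < e" by (rule pos_divide_less_eq[OF t, THEN iffD2])
    moreover have "norm (w /\<^sub>R t) = norm w / t" using t by (simp add: divide_inverse mult.commute)
    ultimately have "norm (w /\<^sub>R t) < e" by simp
    then have "w /\<^sub>R t \<in> ball 0 e" unfolding mem_ball_0 .
    then have "w /\<^sub>R t \<in> I" using e(2) by blast
    then show ?thesis using t by (auto simp: R_def)
  qed
  have bdd: "bdd_below (R w)" for w by (rule bdd_belowI[of _ 0]) (simp add: R_def)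
  have le: "N (t *\<^sub>R w) \<le> t * N w" if t: "t > 0" for t w
  proof -
    have "N (t *\<^sub>R w) / t \<le> r" if r: "r \<in> R w" for r
    proof -
      have r0: "0 < r" "w /\<^sub>R r \<in> I" using r unfolding R_def by blast+
      have "inverse (t * r) * t = inverse r" using t r0(1) by (simp add: divide_simps)
      then have eq: "(t *\<^sub>R w) /\<^sub>R (t * r) = w /\<^sub>R r" by (simp only: scaleR_scaleR)
      have "t * r \<in> R (t *\<^sub>R w)"
        unfolding R_def mem_Collect_eq eq using r0(2) mult_pos_pos[OF t r0(1)] by blast
      then have "N (t *\<^sub>R w) \<le> t * r" unfolding N_def by (rule cInf_lower[OF _ bdd])
      then have "N (t *\<^sub>R w) \<le> r * t" unfolding mult.commute[of r t] .
      then show ?thesis by (rule pos_divide_le_eq[OF t, THEN iffD2])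
    qed
    then have "N (t *\<^sub>R w) / t \<le> N w" unfolding N_def[of w] using ne by (intro cInf_greatest)
    then have "N (t *\<^sub>R w) \<le> N w * t" by (rule pos_divide_le_eq[OF t, THEN iffD1])
    then show ?thesis unfolding mult.commute[of t] .
  qed
  have pos: "N (t *\<^sub>R w) = t * N w" if t: "t > 0" for t w
  proof (rule antisym[OF le[OF t]])
    have "N (inverse t *\<^sub>R t *\<^sub>R w) \<le> inverse t * N (t *\<^sub>R w)" using t by (intro le) simp
    then have "t * N w \<le> t * (inverse t * N (t *\<^sub>R w))" using t by simp
    then show "t * N w \<le> N (t *\<^sub>R w)" using t by (simp add: mult.assoc[symmetric])
  qed
  have "R (- w) = R w" for w
    unfolding R_def using sym[of "w /\<^sub>R _"] by simp
  then have neg: "N (- w) = N w" for w by (simp add: N_def)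
  have zero: "N 0 = 0"
  proof -
    have "R 0 = {0<..}" using \<open>0 \<in> I\<close> by (auto simp: R_def)
    then show ?thesis by (simp add: N_def)
  qed
  have "N (t *\<^sub>R w) = \<bar>t\<bar> * N w" for t w
  proof -
    consider "t > 0" | "t = 0" | "t < 0" by linarith
    then show ?thesis
    proof cases
      case 3
      have "N (t *\<^sub>R w) = N ((- t) *\<^sub>R w)" using neg[of "t *\<^sub>R w"] by simp
      then show ?thesis using pos[of "- t" w] 3 by simp
    qed (simp_all add: pos zero)
  qed
  from this[of "s - r" v] show ?thesis unfolding mN by (simp add: scaleR_diff_left abs_minus_commute)
qed

section \<open>Reflections of the models carried over to the space\<close>

context straight_projective_metric_space
begin

text \<open>A curve through \<open>y\<close> that \<sigma> reverses becomes a geodesic line of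
  \<open>M\<close>, hence a chord. On it \<open>g (\<sigma> z)\<close> has the same distance from
  \<open>g y\<close> as \<open>g z\<close> and differs from it, so it is the reflected
  point.\<close>

lemma center_if_isometric_reflection:
  assumes g: "isometry_between N e M d g" and y: "y \<in> N"
    and \<sigma>: "\<And>a b. a \<in> N \<Longrightarrow> b \<in> N \<Longrightarrow> e (\<sigma> a) (\<sigma> b) = e a b" "\<sigma> y = y"
    and lines: "\<And>z. z \<in> N \<Longrightarrow> z \<noteq> y \<Longrightarrow> \<exists>\<gamma> :: real \<Rightarrow> 'a. range \<gamma> \<subseteq> N \<and> (\<forall>r s. e (\<gamma> r) (\<gamma> s) = \<bar>r - s\<bar>) \<and>
      \<gamma> 0 = y \<and> z \<in> range \<gamma> \<and> (\<forall>s. \<sigma> (\<gamma> s) = \<gamma> (- s))"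
  shows "center M d (g y)"
proof -
  have gb: "bij_betw g N M" and gd: "\<And>a b. a \<in> N \<Longrightarrow> b \<in> N \<Longrightarrow> d (g a) (g b) = e a b"
    using g unfolding isometry_between_def by blast+
  have gM: "a \<in> N \<Longrightarrow> g a \<in> M" for a using gb by (rule bij_betw_apply)
  have ginj: "a \<in> N \<Longrightarrow> b \<in> N \<Longrightarrow> g a = g b \<Longrightarrow> a = b" for a b using gb by (meson bij_betw_def inj_onD)
  have refl: "reflect (g y) (g z) = g (\<sigma> z) \<and> \<sigma> z \<in> N" if z: "z \<in> N" for z
  proof (cases "z = y")
    case True then show ?thesis using gM[OF y] \<sigma>(2) y by simp
  next
    case False
    obtain \<gamma> :: "real \<Rightarrow> 'a" where "range \<gamma> \<subseteq> N \<and> (\<forall>r s. e (\<gamma> r) (\<gamma> s) = \<bar>r - s\<bar>) \<and>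
      \<gamma> 0 = y \<and> z \<in> range \<gamma> \<and> (\<forall>s. \<sigma> (\<gamma> s) = \<gamma> (- s))"
      using lines[OF z False] by (elim exE)
    then have \<gamma>: "\<And>s. \<gamma> s \<in> N" "\<And>r s. e (\<gamma> r) (\<gamma> s) = \<bar>r - s\<bar>" "\<gamma> 0 = y" "z \<in> range \<gamma>" "\<And>s. \<sigma> (\<gamma> s) = \<gamma> (- s)"
      by blast+
    obtain s where s: "z = \<gamma> s" using \<gamma>(4) by blast
    have dg: "d (g (\<gamma> r)) (g (\<gamma> t)) = \<bar>r - t\<bar>" for r t using gd \<gamma>(1,2) by simp
    have geo: "geodesic_line M d (range (g \<circ> \<gamma>))"
      unfolding geodesic_line_def
    proof (intro exI[of _ "g \<circ> \<gamma>"] conjI allI)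
      show "range (g \<circ> \<gamma>) \<subseteq> M" using gM \<gamma>(1) by auto
      show "\<exists>\<epsilon>>0. \<forall>r\<in>ball t \<epsilon>. \<forall>s\<in>ball t \<epsilon>. d ((g \<circ> \<gamma>) r) ((g \<circ> \<gamma>) s) = \<bar>r - s\<bar>" for t
        using dg by (intro exI[of _ 1]) simp
    qed simp
    have gy: "g (\<gamma> 0) = g y" using \<gamma>(3) by simp
    have mem: "g y \<in> range (g \<circ> \<gamma>)" "g z \<in> range (g \<circ> \<gamma>)" "g (\<sigma> z) \<in> range (g \<circ> \<gamma>)"
      using gy s \<gamma>(5) by (metis comp_apply rangeI)+
    have ne: "g z \<noteq> g y" using ginj[OF z y] False by blast
    have "range (g \<circ> \<gamma>) = chord (g y) (g z)"
      using ne by (intro geodesic_line_eq_chord[OF geo mem(1,2)]) simp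
    then have "g (\<sigma> z) \<in> chord (g y) (g z)" using mem(3) by simp
    moreover have "d (g y) (g (\<sigma> z)) = d (g y) (g z)"
      using dg[of 0 "- s"] dg[of 0 s] gy s \<gamma>(5)[of s] by simp
    ultimately have "g (\<sigma> z) = g z \<or> g (\<sigma> z) = reflect (g y) (g z)"
      using ne by (intro reflect_unique_on_chord gM y z)
    moreover have "g (\<sigma> z) \<noteq> g z"
    proof
      assume "g (\<sigma> z) = g z"
      then have "d (g (\<gamma> (- s))) (g (\<gamma> s)) = 0" using s \<gamma>(5)[of s] gM[OF z] by simp
      then have "s = 0" unfolding dg by simp
      then show False using False s \<gamma>(3) by simp
    qed
    moreover have "\<sigma> z \<in> N" using s \<gamma>(1,5) by simp
    ultimately show ?thesis by auto
  qed
  have "d (reflect (g y) x) (reflect (g y) x') = d x x'" if x: "x \<in> M" "x' \<in> M" for x x'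
  proof -
    have "g ` N = M" using gb by (simp add: bij_betw_def)
    then obtain z z' where z: "z \<in> N" "x = g z" "z' \<in> N" "x' = g z'" using x by blast
    have "d (reflect (g y) x) (reflect (g y) x') = e (\<sigma> z) (\<sigma> z')"
      using refl[OF z(1)] refl[OF z(3)] gd z(2,4) by simp
    also have "\<dots> = d x x'" using \<sigma>(1) gd z by simp
    finally show ?thesis .
  qed
  then show ?thesis using gM[OF y] by (simp add: center_iff reflect_isometryI)
qed

lemma all_centers_if_minkowski:
  assumes "minkowski_geometry M d"
  shows "M \<noteq> {} \<and> (\<forall>x\<in>M. center M d x)"
proof -
  obtain I :: "(real ^ 'n) set" and f where I: "indicatrix I" and f: "isometry_between M d UNIV (minkowski_dist I) f"
    using assms unfolding minkowski_geometry_def isometric_spaces_def by blast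
  define g where "g = inv_into M f"
  have g: "isometry_between UNIV (minkowski_dist I) M d g" unfolding g_def by (rule isometry_between_inverse[OF f])
  have gb: "bij_betw g UNIV M" and gd: "\<And>a b. d (g a) (g b) = minkowski_dist I a b"
    using g unfolding isometry_between_def by blast+
  have "center M d (g y)" for y
  proof (rule center_if_isometric_reflection[OF g UNIV_I, of "\<lambda>z. 2 *\<^sub>R y - z"])
    show "minkowski_dist I (2 *\<^sub>R y - a) (2 *\<^sub>R y - b) = minkowski_dist I a b" for a b
      by (rule minkowski_dist_reflect[OF I])
    show "2 *\<^sub>R y - y = y" by (simp add: scaleR_2)
    fix z assume zy: "z \<noteq> y"
    define \<nu> where "\<nu> = minkowski_dist I 0 (z - y)"
    have sc: "minkowski_dist I (y + r *\<^sub>R (z - y)) (y + s *\<^sub>R (z - y)) = \<bar>r - s\<bar> * \<nu>" for r s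
      unfolding \<nu>_def by (rule minkowski_dist_scale[OF I])
    \<comment> \<open>Positivity of the gauge is inherited from \<open>d\<close> through
      \<open>g\<close>.\<close>
    have "g y \<noteq> g z" using zy gb by (metis UNIV_I bij_betw_def inj_onD)
    then have "0 < d (g y) (g z)" using bij_betw_apply[OF gb] by (intro d_pos) auto
    then have \<nu>: "\<nu> > 0" using sc[of 0 1] by (simp add: gd)
    let ?\<gamma> = "\<lambda>s. y + (s / \<nu>) *\<^sub>R (z - y)"
    show "\<exists>\<gamma>. range \<gamma> \<subseteq> UNIV \<and> (\<forall>r s. minkowski_dist I (\<gamma> r) (\<gamma> s) = \<bar>r - s\<bar>) \<and> \<gamma> 0 = y \<and> z \<in> range \<gamma> \<and>
        (\<forall>s. 2 *\<^sub>R y - \<gamma> s = \<gamma> (- s))"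
    proof (intro exI[of _ ?\<gamma>] conjI allI)
      show "minkowski_dist I (?\<gamma> r) (?\<gamma> s) = \<bar>r - s\<bar>" for r s
        unfolding sc using \<nu> by (simp flip: diff_divide_distrib)
      show "z \<in> range ?\<gamma>" using \<nu> by (intro image_eqI[of _ _ \<nu>]) auto
      show "2 *\<^sub>R y - ?\<gamma> s = ?\<gamma> (- s)" for s by (simp add: scaleR_2)
    qed auto
  qed
  moreover have "g ` UNIV = M" using gb by (simp add: bij_betw_def)
  ultimately show ?thesis by blast
qed

text \<open>The Lorentz reflection in \<open>lift y\<close> fixes \<open>lift y\<close> and negates
  its orthogonal complement, so it reverses every hyperbolic line through that point.\<close>

lemma all_centers_if_hyperbolic:
  assumes "hyperbolic_geometry M d"
  shows "M \<noteq> {} \<and> (\<forall>x\<in>M. center M d x)"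
proof -
  let ?B = "ball (0 :: real ^ 'n) 1"
  obtain E :: "(real ^ 'n) set" and c f where E: "open_ellipsoid E" and c: "0 < c"
    and f: "isometry_between M d E (\<lambda>x y. c * hilbert_dist E x y) f"
    using assms unfolding hyperbolic_geometry_def isometric_spaces_def by blast
  obtain F a where F: "linear F" "bij F" "E = (\<lambda>x. a + F x) ` ?B"
    using E unfolding open_ellipsoid_def by blast
  define e where "e = (\<lambda>x y. c * hilbert_dist ?B x y)"
  have "inj (\<lambda>x. a + F x)" using F(2) by (simp add: bij_def inj_def)
  then have "bij_betw (\<lambda>x. a + F x) ?B E" unfolding F(3) by (meson bij_betw_imageI inj_on_subset subset_UNIV)
  then have T: "isometry_between ?B e E (\<lambda>x y. c * hilbert_dist E x y) (\<lambda>x. a + F x)"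
    unfolding isometry_between_def F(3) e_def hilbert_dist_affine_image[OF F(1,2)] by simp
  define g where "g = inv_into M f \<circ> (\<lambda>x. a + F x)"
  have g: "isometry_between ?B e M d g"
    unfolding g_def by (rule isometry_between_compose[OF T isometry_between_inverse[OF f]])
  have gb: "bij_betw g ?B M" using g unfolding isometry_between_def by blast
  have "center M d (g y)" if yB: "y \<in> ?B" for y
  proof -
    have y: "norm y < 1" using yB by simp
    note ly = lift_hyperboloid[OF y]
    have pp: "lor (lift y) (lift y) = 1" using ly(1) by (simp add: hyperboloid_def)
    define S where "S q = (2 * lor (lift y) q) *\<^sub>R lift y - q" for q
    have S: "S q \<in> hyperboloid" if "q \<in> hyperboloid" for q
      unfolding S_def by (rule hyperboloid_reflection[OF ly(1) that])
    have SS: "lor (S p) (S q) = lor p q" for p q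
      unfolding S_def using pp lor_commute[of p "lift y"] by (simp add: lor_simps algebra_simps)
    let ?\<sigma> = "\<lambda>z. klein (S (lift z))"
    show ?thesis
    proof (rule center_if_isometric_reflection[OF g yB, of ?\<sigma>])
      show "e (?\<sigma> u) (?\<sigma> v) = e u v" if "u \<in> ?B" "v \<in> ?B" for u v
      proof -
        have uv: "norm u < 1" "norm v < 1" using that by simp_all
        note h = S[OF lift_hyperboloid(1)[OF uv(1)]] S[OF lift_hyperboloid(1)[OF uv(2)]]
        have "hilbert_dist ?B (?\<sigma> u) (?\<sigma> v) = hilbert_dist ?B u v"
          by (intro hilbert_dist_ball_cong klein_hyperboloid(1) h uv) (simp add: klein_hyperboloid(2) h SS)
        then show ?thesis by (simp add: e_def)
      qed
      have "S (lift y) = lift y" by (simp add: S_def pp scaleR_2)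
      then show "?\<sigma> y = y" using ly(2) by simp
      fix z assume z: "z \<in> ?B" "z \<noteq> y"
      have nz: "norm z < 1" using z by simp
      note lz = lift_hyperboloid[OF nz]
      have "lift y \<noteq> lift z" using z(2) ly(2) lz(2) by metis
      then obtain w where w: "lor (lift y) w = 0" "lor w w = -1"
          "\<And>s. cosh s *\<^sub>R lift y + sinh s *\<^sub>R w \<in> hyperboloid" "\<exists>s. lift z = cosh s *\<^sub>R lift y + sinh s *\<^sub>R w"
        using hyperboloid_geodesic[OF ly(1) lz(1)] by metis
      define l where "l s = cosh s *\<^sub>R lift y + sinh s *\<^sub>R w" for s
      have l: "l s \<in> hyperboloid" for s using w(3) by (simp add: l_def)
      have ll: "lor (l r) (l s) = cosh (r - s)" for r s
        unfolding l_def by (rule hyperbolic_line_identities[OF pp w(1,2)])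
      obtain s0 where s0: "lift z = l s0" using w(4) by (auto simp: l_def)
      have Sl: "S (l s) = l (- s)" for s
      proof -
        have "lor (lift y) (l s) = cosh s" unfolding l_def lor_simps w(1) pp by simp
        moreover have "(2 * cosh s) *\<^sub>R lift y = cosh s *\<^sub>R lift y + cosh s *\<^sub>R lift y"
          by (simp flip: scaleR_add_left)
        ultimately show ?thesis unfolding S_def by (simp add: l_def)
      qed
      \<comment> \<open>Division by \<open>c\<close> makes the speed 1 in the scaled metric.\<close>
      let ?\<gamma> = "\<lambda>s. klein (l (s / c))"
      show "\<exists>\<gamma>. range \<gamma> \<subseteq> ?B \<and> (\<forall>r s. e (\<gamma> r) (\<gamma> s) = \<bar>r - s\<bar>) \<and> \<gamma> 0 = y \<and> z \<in> range \<gamma> \<and> (\<forall>s. ?\<sigma> (\<gamma> s) = \<gamma> (- s))"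
      proof (intro exI[of _ ?\<gamma>] conjI allI)
        show "range ?\<gamma> \<subseteq> ?B" using klein_hyperboloid(1)[OF l] by auto
        show "e (?\<gamma> r) (?\<gamma> s) = \<bar>r - s\<bar>" for r s
        proof -
          have "hilbert_dist ?B (?\<gamma> r) (?\<gamma> s) = \<bar>r / c - s / c\<bar>"
            by (intro hilbert_dist_ball_eqI klein_hyperboloid(1) l) (simp add: klein_hyperboloid(2) l ll)
          also have "\<dots> = \<bar>r - s\<bar> / c" using c by (simp flip: diff_divide_distrib)
          finally show ?thesis using c by (simp add: e_def)
        qed
        show "?\<gamma> 0 = y" using ly(2) by (simp add: l_def)
        show "z \<in> range ?\<gamma>" using lz(2) s0 c by (intro image_eqI[of _ _ "s0 * c"]) auto
        show "?\<sigma> (?\<gamma> s) = ?\<gamma> (- s)" for s by (simp add: klein_hyperboloid(2) l Sl)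
      qed
    qed
  qed
  moreover have "g ` ?B = M" using gb by (simp add: bij_betw_def)
  moreover have "?B \<noteq> {}" by simp
  ultimately show ?thesis by blast
qed

text \<open>Charts are onto, so each coordinate line through \<open>p\<close> has points at distance
  1 and at an irrational distance \<open>x\<close> from \<open>p\<close>; the coordinate directions
  span.\<close>

lemma pencil_if_all_centers:
  assumes p: "p \<in> M" and all: "\<And>x. x \<in> M \<Longrightarrow> center M d x"
  shows "\<exists>k P Q. CARD('n) \<le> k \<and> pencil k p P Q \<and> pencil_dim k p P = CARD('n) \<and> center M d p \<and>
     (\<forall>i\<in>{1..k}. center M d (P i) \<and> center M d (Q i)) \<and> (\<forall>i\<in>{1..k}. d p (P i) / d p (Q i) \<notin> \<rat>)"
proof -
  have "uncountable (UNIV :: real set)" by (rule uncountable_UNIV_real)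
  then obtain x0 :: real where "x0 \<notin> \<rat>" using countable_rat by (metis UNIV_eq_I)
  define x where "x = \<bar>x0\<bar>"
  have "x \<notin> \<rat>" using \<open>x0 \<notin> \<rat>\<close> by (simp add: x_def)
  moreover from this have "x \<noteq> 1" by auto
  moreover have "0 < x" using \<open>x0 \<notin> \<rat>\<close> by (auto simp: x_def)
  ultimately have x: "x \<notin> \<rat>" "0 < x" "x \<noteq> 1" by simp_all
  obtain b :: "nat \<Rightarrow> 'n" where b: "bij_betw b {1..CARD('n)} UNIV"
    using finite_same_card_bij[of "{1..CARD('n)}" "UNIV :: 'n set"] by auto
  have ex: "\<exists>s t. p + s *\<^sub>R axis j 1 \<in> M \<and> p + t *\<^sub>R axis j 1 \<in> M \<and> s \<noteq> 0 \<and> t \<noteq> 0 \<and> s \<noteq> t \<and>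
      d p (p + s *\<^sub>R axis j 1) = x \<and> d p (p + t *\<^sub>R axis j 1) = 1" for j :: 'n
  proof -
    let ?v = "axis j 1 :: real ^ 'n"
    obtain \<phi> where ch: "line_chart p ?v \<phi>" using line_chart_exists[OF p, of ?v] by (auto simp: axis_eq_0_iff)
    note \<phi> = line_chartD[OF ch]
    obtain s where s: "s \<in> line_dom p ?v" "\<phi> s = x" by (rule chart_surj[OF ch])
    obtain t where t: "t \<in> line_dom p ?v" "\<phi> t = 1" by (rule chart_surj[OF ch])
    have zdom: "0 \<in> line_dom p ?v" using p by (simp add: line_dom_mem)
    have "d p (p + s *\<^sub>R ?v) = x" "d p (p + t *\<^sub>R ?v) = 1"
      using \<phi>(5)[OF zdom s(1)] \<phi>(5)[OF zdom t(1)] s(2) t(2) \<phi>(1) x(2) by simp_all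
    moreover have "s \<noteq> 0" "t \<noteq> 0" "s \<noteq> t" using s(2) t(2) \<phi>(1) x by auto
    ultimately show ?thesis using s(1) t(1) by (auto simp: line_dom_mem)
  qed
  then obtain s t where st: "\<And>j. p + s j *\<^sub>R axis j 1 \<in> M" "\<And>j. p + t j *\<^sub>R axis j 1 \<in> M" "\<And>j. s j \<noteq> 0" "\<And>j. t j \<noteq> 0"
      "\<And>j. s j \<noteq> t j" "\<And>j. d p (p + s j *\<^sub>R axis j 1) = x" "\<And>j. d p (p + t j *\<^sub>R axis j 1) = 1"
    by metis
  define P where "P i = p + s (b i) *\<^sub>R axis (b i) 1" for i
  define Q where "Q i = p + t (b i) *\<^sub>R axis (b i) 1" for i
  have ax: "i = j \<and> u = w" if "u *\<^sub>R axis i 1 = w *\<^sub>R (axis j 1 :: real ^ 'n)" "u \<noteq> 0" for i j :: 'n and u w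
  proof -
    have "(u *\<^sub>R axis i 1 :: real ^ 'n) $ i = (w *\<^sub>R axis j 1) $ i" using that by simp
    then show ?thesis using that(2) by (auto simp: axis_def split: if_splits)
  qed
  have bi: "i = j" if "i \<in> {1..CARD('n)}" "j \<in> {1..CARD('n)}" "b i = b j" for i j
    using b that by (meson bij_betw_def inj_onD)
  have "pencil CARD('n) p P Q"
    unfolding pencil_def
  proof (intro conjI ballI)
    show "inj_on P {1..CARD('n)}" using ax st(3) bi by (auto simp: inj_on_def P_def)
    show "inj_on Q {1..CARD('n)}" using ax st(4) bi by (auto simp: inj_on_def Q_def)
    show "P ` {1..CARD('n)} \<inter> Q ` {1..CARD('n)} = {}"
    proof (rule ccontr)
      assume "P ` {1..CARD('n)} \<inter> Q ` {1..CARD('n)} \<noteq> {}"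
      then obtain i j where "P i = Q j" by blast
      then have "b i = b j \<and> s (b i) = t (b j)" unfolding P_def Q_def by (intro ax st(3)) simp
      then show False using st(5)[of "b i"] by auto
    qed
    show "p \<notin> P ` {1..CARD('n)}" "p \<notin> Q ` {1..CARD('n)}" using st(3,4) by (auto simp: P_def Q_def axis_eq_0_iff)
    show "collinear {p, P i, Q i}" for i
      unfolding collinear_alt P_def Q_def
      by (intro exI[of _ p] exI[of _ "axis (b i) 1"]) (auto intro: exI[of _ 0])
  qed
  moreover have "pencil_dim CARD('n) p P = CARD('n)"
  proof -
    let ?S = "(\<lambda>i. P i - p) ` {1..CARD('n)}"
    have "axis j 1 \<in> span ?S" for j
    proof -
      have "j \<in> b ` {1..CARD('n)}" using b by (simp add: bij_betw_def)
      then obtain i where i: "i \<in> {1..CARD('n)}" "j = b i" by blast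
      have "(1 / s j) *\<^sub>R (P i - p) \<in> span ?S" using i by (intro span_scale span_base) blast
      then show ?thesis using st(3)[of j] by (simp add: P_def i(2))
    qed
    then have "(Basis :: (real ^ 'n) set) \<subseteq> span ?S" by (auto simp: Basis_vec_def)
    then have "span ?S = UNIV" by (metis span_Basis span_mono span_span top.extremum_unique)
    then show ?thesis by (simp add: pencil_dim_def)
  qed
  moreover have "d p (P i) / d p (Q i) \<notin> \<rat>" for i using x(1) by (simp add: P_def Q_def st(6,7))
  ultimately show ?thesis
    using p all st(1,2) by (intro exI[of _ "CARD('n)"] exI[of _ P] exI[of _ Q]) (auto simp: P_def Q_def)
qed

text \<open>The chart of the only line is an isometry of \<open>M\<close> with the reals, whose
  indicatrix is the unit ball.\<close>

lemma minkowski_if_one_dimensional: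
  assumes p: "p \<in> M" and one: "CARD('n) = 1"
  shows "minkowski_geometry M d"
proof -
  obtain k :: 'n where k: "(UNIV :: 'n set) = {k}" using one by (auto simp: card_1_singleton_iff)
  let ?v = "axis k 1 :: real ^ 'n"
  have vec: "z = (z $ k) *\<^sub>R ?v" for z :: "real ^ 'n"
  proof -
    have "z $ i = ((z $ k) *\<^sub>R ?v) $ i" for i
    proof -
      have "i = k" using k by blast
      then show ?thesis by (simp add: axis_def)
    qed
    then show ?thesis unfolding vec_eq_iff by (rule allI)
  qed
  obtain \<phi> where ch: "line_chart p ?v \<phi>" using line_chart_exists[OF p, of ?v] by (auto simp: axis_eq_0_iff)
  note \<phi> = line_chartD[OF ch]
  define co where "co x = (x - p) $ k" for x
  have co: "p + co x *\<^sub>R ?v = x" for x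
  proof -
    have "co x *\<^sub>R ?v = x - p" unfolding co_def by (rule vec[symmetric])
    then show ?thesis by simp
  qed
  have coM: "co x \<in> line_dom p ?v" if "x \<in> M" for x using that by (simp add: line_dom_mem co)
  define f where "f x = \<phi> (co x) *\<^sub>R ?v" for x
  have dist: "minkowski_dist (ball 0 1) (f x) (f y) = d x y" if "x \<in> M" "y \<in> M" for x y
  proof -
    have "f y - f x = (\<phi> (co y) - \<phi> (co x)) *\<^sub>R ?v" by (simp add: f_def scaleR_diff_left)
    then have "norm (f y - f x) = \<bar>\<phi> (co x) - \<phi> (co y)\<bar>" by (simp add: abs_minus_commute)
    then show ?thesis using \<phi>(5)[OF coM[OF that(1)] coM[OF that(2)]] by (simp add: minkowski_dist_ball co)
  qed
  have "bij_betw f M UNIV"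
    unfolding bij_betw_def
  proof (intro conjI inj_onI)
    fix x y assume xy: "x \<in> M" "y \<in> M" "f x = f y"
    then have "d x y = 0" using dist[OF xy(1,2)] by (simp add: minkowski_dist_ball)
    then show "x = y" using xy by simp
  next
    have "z \<in> f ` M" for z
    proof -
      obtain t where t: "t \<in> line_dom p ?v" "\<phi> t = z $ k" by (rule chart_surj[OF ch])
      have "co (p + t *\<^sub>R ?v) = t" by (simp add: co_def axis_def)
      then have "f (p + t *\<^sub>R ?v) = (z $ k) *\<^sub>R ?v" using t(2) by (simp add: f_def)
      then have "f (p + t *\<^sub>R ?v) = z" unfolding vec[of z, symmetric] .
      then show ?thesis using t(1) by (intro image_eqI[of _ _ "p + t *\<^sub>R ?v"]) (auto simp: line_dom_mem)
    qed
    then show "f ` M = UNIV" by blast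
  qed
  then have "isometry_between M d UNIV (minkowski_dist (ball 0 1)) f"
    using dist by (simp add: isometry_between_def)
  then show ?thesis
    unfolding minkowski_geometry_def isometric_spaces_def using indicatrix_ball by blast
qed

end

theorem theorem4p3:
  fixes M :: "(real ^ 'n) set" and d :: "real ^ 'n \<Rightarrow> real ^ 'n \<Rightarrow> real"
  assumes "straight_projective_metric_space M d"
  shows "(\<exists>(k::nat) (p :: real ^ 'n) (P :: nat \<Rightarrow> real ^ 'n) (Q :: nat \<Rightarrow> real ^ 'n).
            k \<ge> CARD('n) \<and> pencil k p P Q \<and> pencil_dim k p P = CARD('n) \<and>
            center M d p \<and> (\<forall>i\<in>{1..k}. center M d (P i) \<and> center M d (Q i)) \<and>
            (\<forall>i\<in>{1..k}. d p (P i) / d p (Q i) \<notin> \<rat>))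
         \<longleftrightarrow> minkowski_geometry M d \<or> hyperbolic_geometry M d"
    (is "?pencil \<longleftrightarrow> _")
proof
  interpret straight_projective_metric_space M d by (rule assms)
  assume ?pencil
  then obtain k p P Q where pencil: "pencil k p P Q" "pencil_dim k p P = CARD('n)" "center M d p"
      "\<And>i. i \<in> {1..k} \<Longrightarrow> center M d (P i) \<and> center M d (Q i)" "\<And>i. i \<in> {1..k} \<Longrightarrow> d p (P i) / d p (Q i) \<notin> \<rat>"
    by blast
  have all: "center M d x" if "x \<in> M" for x by (rule all_centers_if_pencil[OF pencil that])
  have p: "p \<in> M" using pencil(3) by (rule centerD)
  show "minkowski_geometry M d \<or> hyperbolic_geometry M d"
  proof (cases "CARD('n) = 1")
    case True
    then show ?thesis using minkowski_if_one_dimensional[OF p] by blast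
  next
    case False
    have "0 < CARD('n)" by (simp add: card_gt_0_iff)
    then have "2 \<le> CARD('n)" using False by linarith
    then interpret symmetric_projective_metric_space M d
      using all p by unfold_locales auto
    show ?thesis by (rule minkowski_or_hyperbolic)
  qed
next
  interpret straight_projective_metric_space M d by (rule assms)
  assume "minkowski_geometry M d \<or> hyperbolic_geometry M d"
  then have "M \<noteq> {} \<and> (\<forall>x\<in>M. center M d x)"
    using all_centers_if_minkowski all_centers_if_hyperbolic by blast
  then obtain p where "p \<in> M" "\<And>x. x \<in> M \<Longrightarrow> center M d x" by blast
  from pencil_if_all_centers[OF this] show ?pencil by blast
qed

end
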